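(* Let $p\in[0,1/2)$, $q=1-p$, and let $\bar g=\{g_j\}_{j\in\mathbb N}$ be a real sequence with $\sup_j|g_j|<\infty$. Let $\gamma$ be any probability measure on $\mathbb R^\infty$ such that $\gamma$-a.e. sequence is non-decreasing. Then solutions to the infinite system of competing Brownian particles with parameters $p,\bar g$ are pathwise unique for the initial distribution $\gamma$: whenever $\{X_j\}_{j\in\mathbb N}$ and $\{X'_j\}_{j\in\mathbb N}$ are two infinite systems of competing Brownian particles with parameters $p,\bar g$, defined on the same filtered probability space, with the same driving Brownian motions $\{B_j\}$, with initial distribution $\gamma$, and with $X_j(0)=X_j'(0)$ for all $j\in\mathbb N$, then almost surely $X_j(t)=X'_j(t)$ for all $j\in\mathbb N$ and $t\in[0,\infty)$.
   Context: Setting. $(\Omega,\mathcal F,\{\mathcal F_t\}_{t\ge0},\mathbb P)$ is a filtered probability space carrying independent standard one-dimensional ($\mathcal F_t$-adapted) Brownian motions $\{B_j\}_{j\in\mathbb N}$ such that $\{B_i(t+\cdot)-B_i(t),\,i\in\mathbb N\}$ is independent of $\mathcal F_t$ for all $t\ge0$, and $\bar x=\{x_j\}_{j\in\mathbb N}$ is a non-decreasing sequence of real $\mathcal F_0$-measurable random variables (initial conditions); the law of $\bar x$ is the initial distribution. An infinite system of competing Brownian particles (a solution) with parameters $p,\bar g$, initial conditions $\bar x$ and driving Brownian motions $\{B_j\}$ is a collection $\{X_j\}_{j\in\mathbb N}$ of continuous, real-valued, $\{\mathcal F_t\}$-adapted processes for which there are continuous, real-valued, $\{\mathcal F_t\}$-adapted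 processes $\{L_{(j,j+1)}\}_{j\ge0}$ (the associated local times) such that: (P1) for all $t\ge0$, $j\in\mathbb N$: $X_j(t)=x_j+g_jt+B_j(t)+pL_{(j-1,j)}(t)-qL_{(j,j+1)}(t)$; (P2) for all $t\ge0$ the sequence $\{X_j(t)\}_{j\in\mathbb N}$ is non-decreasing; (P3) $L_{(0,1)}\equiv0$, and for $j\ge1$, $L_{(j,j+1)}$ is non-decreasing with $L_{(j,j+1)}(0)=0$ and $\int_0^\infty(X_{j+1}(t)-X_j(t))\,dL_{(j,j+1)}(t)=0$. *)

theory Defs
  imports "HOL-Probability.Probability"
begin

text \<open>Particles are numbered by the naturals \<open>j \<ge> 1\<close> and time is \<open>t \<ge> 0\<close>; the values of the processes
  outside these ranges are irrelevant.  Path properties of processes are required almost surely.\<close>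

definition standard_brownian_motion :: "'a measure \<Rightarrow> (real \<Rightarrow> 'a \<Rightarrow> real) \<Rightarrow> bool" where
  "standard_brownian_motion M W \<longleftrightarrow>
     (\<forall>t\<ge>0. W t \<in> borel_measurable M) \<and>
     (AE \<omega> in M. W 0 \<omega> = 0) \<and>
     (AE \<omega> in M. continuous_on {0..} (\<lambda>t. W t \<omega>)) \<and>
     (\<forall>s t. 0 \<le> s \<longrightarrow> s < t \<longrightarrow>
        distributed M lborel (\<lambda>\<omega>. W t \<omega> - W s \<omega>) (normal_density 0 (sqrt (t - s)))) \<and>
     (\<forall>\<tau> :: nat \<Rightarrow> real. \<forall>n. 0 \<le> \<tau> 0 \<longrightarrow> mono \<tau> \<longrightarrow>
        prob_space.indep_vars M (\<lambda>_. borel) (\<lambda>k \<omega>. W (\<tau> (Suc k)) \<omega> - W (\<tau> k) \<omega>) {..<n})"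

definition filtered_prob_space :: "'a measure \<Rightarrow> (real \<Rightarrow> 'a measure) \<Rightarrow> bool" where
  "filtered_prob_space M F \<longleftrightarrow>
     prob_space M \<and> (\<forall>t\<ge>0. subalgebra M (F t)) \<and> (\<forall>s t. 0 \<le> s \<longrightarrow> s \<le> t \<longrightarrow> subalgebra (F t) (F s))"

definition adapted :: "(real \<Rightarrow> 'a measure) \<Rightarrow> (real \<Rightarrow> 'a \<Rightarrow> real) \<Rightarrow> bool" where
  "adapted F Y \<longleftrightarrow> (\<forall>t\<ge>0. Y t \<in> borel_measurable (F t))"

text \<open>Independence of the motions is independence of the path-valued random variables, and the
  last clause uses the \<open>\<sigma>\<close>-algebra generated by all increments after time \<open>t\<close>.\<close>

definition driving_brownian_motions ::
    "'a measure \<Rightarrow> (real \<Rightarrow> 'a measure) \<Rightarrow> (nat \<Rightarrow> real \<Rightarrow> 'a \<Rightarrow> real) \<Rightarrow> bool" where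
  "driving_brownian_motions M F B \<longleftrightarrow>
     (\<forall>j\<ge>1. adapted F (B j) \<and> standard_brownian_motion M (B j)) \<and>
     prob_space.indep_vars M (\<lambda>_. \<Pi>\<^sub>M t\<in>{0..}. borel) (\<lambda>j \<omega>. \<lambda>t\<in>{0..}. B j t \<omega>) {1..} \<and>
     (\<forall>t\<ge>0. prob_space.indep_set M (sets (F t))
        (sets (vimage_algebra (space M)
           (\<lambda>\<omega>. \<lambda>(i, s)\<in>{1..} \<times> {0..}. B i (t + s) \<omega> - B i t \<omega>)
           (\<Pi>\<^sub>M (i, s)\<in>{1..} \<times> {0..}. borel))))"

definition initial_conditions ::
    "'a measure \<Rightarrow> (real \<Rightarrow> 'a measure) \<Rightarrow> (nat \<Rightarrow> 'a \<Rightarrow> real) \<Rightarrow> bool" where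
  "initial_conditions M F x \<longleftrightarrow>
     (\<forall>j\<ge>1. x j \<in> borel_measurable (F 0)) \<and> (AE \<omega> in M. mono_on {1..} (\<lambda>j. x j \<omega>))"

definition initial_distribution :: "'a measure \<Rightarrow> (nat \<Rightarrow> 'a \<Rightarrow> real) \<Rightarrow> (nat \<Rightarrow> real) measure" where
  "initial_distribution M x = distr M (\<Pi>\<^sub>M j\<in>{1..}. borel) (\<lambda>\<omega>. \<lambda>j\<in>{1..}. x j \<omega>)"

text \<open>\<open>L j\<close> is the local time \<open>L\<^bsub>(j,j+1)\<^esub>\<close>.  The integral against \<open>dL\<close> is taken with respect to the
  Lebesgue--Stieltjes measure of the path of \<open>L j\<close>, continued by its value at \<open>0\<close> to negative times;
  the integrand is nonnegative because the particles are ordered.\<close>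

definition competing_brownian_path ::
    "real \<Rightarrow> (nat \<Rightarrow> real) \<Rightarrow> (nat \<Rightarrow> real) \<Rightarrow> (nat \<Rightarrow> real \<Rightarrow> real) \<Rightarrow>
     (nat \<Rightarrow> real \<Rightarrow> real) \<Rightarrow> (nat \<Rightarrow> real \<Rightarrow> real) \<Rightarrow> bool" where
  "competing_brownian_path p g x B X L \<longleftrightarrow> (let q = 1 - p in
     (\<forall>j\<ge>1. continuous_on {0..} (X j)) \<and>
     (\<forall>j. continuous_on {0..} (L j)) \<and>
     (\<forall>t\<ge>0. \<forall>j\<ge>1. X j t = x j + g j * t + B j t + p * L (j - 1) t - q * L j t) \<and>
     (\<forall>t\<ge>0. mono_on {1..} (\<lambda>j. X j t)) \<and>
     (\<forall>t\<ge>0. L 0 t = 0) \<and>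
     (\<forall>j\<ge>1. mono_on {0..} (L j) \<and> L j 0 = 0 \<and>
        (\<integral>\<^sup>+t\<in>{0..}. ennreal (X (Suc j) t - X j t) \<partial>interval_measure (\<lambda>t. L j (max 0 t))) = 0))"

definition competing_brownian_particles ::
    "'a measure \<Rightarrow> (real \<Rightarrow> 'a measure) \<Rightarrow> real \<Rightarrow> (nat \<Rightarrow> real) \<Rightarrow> (nat \<Rightarrow> 'a \<Rightarrow> real) \<Rightarrow>
     (nat \<Rightarrow> real \<Rightarrow> 'a \<Rightarrow> real) \<Rightarrow> (nat \<Rightarrow> real \<Rightarrow> 'a \<Rightarrow> real) \<Rightarrow> bool" where
  "competing_brownian_particles M F p g x B X \<longleftrightarrow>
     (\<forall>j\<ge>1. adapted F (X j)) \<and>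
     (\<exists>L. (\<forall>j. adapted F (L j)) \<and>
        (AE \<omega> in M. competing_brownian_path p g (\<lambda>j. x j \<omega>) (\<lambda>j t. B j t \<omega>)
           (\<lambda>j t. X j t \<omega>) (\<lambda>j t. L j t \<omega>)))"

end

theory Submission
  imports Defs
begin

text \<open>Write \<open>q = 1 - p\<close>, \<open>r = p / q < 1\<close> and \<open>\<beta>\<^sub>j(t) = g\<^sub>j t + B\<^sub>j(t)\<close>.  Replace the particles by their discounted sums
\<open>Z\<^sub>j = X\<^sub>j + r X\<^sub>j\<^sub>-\<^sub>1 + r\<^sup>2 X\<^sub>j\<^sub>-\<^sub>2 + \<dots>\<close>.  As \<open>q r = p\<close>, all local times except one cancel:
\<open>Z\<^sub>j = n\<^sub>j + W\<^sub>j - q L\<^sub>(\<^sub>j\<^sub>,\<^sub>j\<^sub>+\<^sub>1\<^sub>)\<close>, where \<open>n\<close> and \<open>W\<close> are the discounted sums of the initial positions and of \<open>\<beta>\<close>.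
The ordering \<open>X\<^sub>j \<le> X\<^sub>j\<^sub>+\<^sub>1\<close> becomes \<open>Z\<^sub>j \<le> q Z\<^sub>j\<^sub>+\<^sub>1 + p Z\<^sub>j\<^sub>-\<^sub>1\<close>, with equality exactly at the collisions of \<open>j\<close> and
\<open>j + 1\<close>.  So \<open>Z\<close> solves an obstacle problem: \<open>Z\<^sub>j\<close> follows \<open>W\<^sub>j\<close> and is pushed down whenever it would exceed
the average of its two neighbours.  Follow \<open>Z\<^sub>j(t)\<close> back to the last collision of \<open>j\<close> with \<open>j + 1\<close>, replace it
there by that average, and repeat.  This describes \<open>Z\<^sub>j(t)\<close> by a backward walk on the levels with
steps \<open>+1\<close> (weight \<open>q\<close>) and \<open>-1\<close> (weight \<open>p\<close>), and two solutions can differ only by what enters from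
infinity along this walk, which drifts upwards because \<open>p < 1/2\<close>.

Two facts exclude such an influence.  First, along any backward nearest-neighbour path with \<open>k\<close>
steps that starts at level \<open>j\<close>, whatever its jump times, \<open>W\<close> varies by at most \<open>C \<surd>(j + k + 1)\<close>, with a
random constant \<open>C\<close> (\<open>AE_bounded_path_variation\<close>, \<open>bounded_path_variation_disc_sum\<close>).  Second, \<open>Z\<^sub>m(t)\<close> exceeds \<open>A \<surd>m\<close> up to a constant for
every \<open>A\<close> (\<open>superdiffusive_growth_of_gain\<close>).  This is where the initial positions are controlled, and it
comes from the existence of the solution at all later times: on \<open>[T, T + U]\<close> one can choose jump times
with \<open>Z\<^sub>1(T + U) \<le> max 0 (Z\<^sub>N\<^sub>+\<^sub>1(T)) - c \<surd>(N U) + C\<close>, and \<open>Z\<^sub>1(T + U)\<close> is finite while \<open>U\<close> is arbitrary.  Thus the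
noise collected on the way to a high level is small compared with the value found there.

For two solutions \<open>Z\<close>, \<open>Z'\<close> with the same data these facts give \<open>Z' - Z \<le> \<epsilon> (Z + const)\<close> for every
\<open>\<epsilon> > 0\<close> (\<open>obstacle_solution_le\<close>), after the same argument has shown that the total push is negligible
compared with \<open>Z\<close> at high levels (\<open>local_time_negligible\<close>).  Both steps are comparisons along all
backward paths (\<open>comparison_along_paths\<close>); the paths that stay low, against the drift, are paid for by
an exponential martingale \<open>y\<^sup>j / \<rho>\<^sup>i\<close> of the walk.

The first fact is a union bound over jump times and routes.  Time is cut into \<open>N\<close> cells of length
\<open>T / N\<close>.  Inside a cell the modulus of continuity of each motion is controlled by an exponential energy
of its dyadic increments, which has a bounded mean and is independent over levels and cells.  The
sum of the products of these energies over all routes is a directed polymer partition function whose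
mean grows only exponentially in \<open>N\<close> (\<open>nn_integral_polymer_le\<close>).  The second fact is a second moment
estimate for the gains over many short time blocks, each independent of the past (\<open>AE_total_gain\<close>).\<close>

section \<open>Discounted sums and the neighbour average\<close>

text \<open>The index \<open>0\<close> is left out: particles are numbered from \<open>1\<close>, and the empty sum at \<open>0\<close> is the boundary
value of the obstacle problem.\<close>

primrec disc_sum :: "real \<Rightarrow> (nat \<Rightarrow> real) \<Rightarrow> nat \<Rightarrow> real" where
  "disc_sum r f 0 = 0"
| "disc_sum r f (Suc j) = f (Suc j) + r * disc_sum r f j"

lemma disc_sum_mono: "(\<And>i. 1 \<le> i \<Longrightarrow> i \<le> j \<Longrightarrow> f i \<le> g i) \<Longrightarrow> 0 \<le> r \<Longrightarrow> disc_sum r f j \<le> disc_sum r g j"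
  by (induction j) (auto intro!: add_mono mult_left_mono)

lemma disc_sum_cong: "(\<And>i. 1 \<le> i \<Longrightarrow> i \<le> j \<Longrightarrow> f i = g i) \<Longrightarrow> disc_sum r f j = disc_sum r g j"
  by (induction j) auto

lemma disc_sum_const_le:
  assumes "0 \<le> r" "r < 1" "0 \<le> c"
  shows "disc_sum r (\<lambda>_. c) j \<le> c / (1 - r)"
proof (induction j)
  case (Suc j)
  have "r * disc_sum r (\<lambda>_. c) j \<le> r * (c / (1 - r))" using Suc assms by (intro mult_left_mono) auto
  then have "disc_sum r (\<lambda>_. c) (Suc j) \<le> c + r * (c / (1 - r))" by simp
  also have "\<dots> = c / (1 - r)" using assms by (simp add: field_simps)
  finally show ?case .
qed (use assms in auto)

lemma disc_sum_uminus: "disc_sum r (\<lambda>i. - f i) j = - disc_sum r f j"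
  by (induction j) auto

lemma disc_sum_abs: "0 \<le> r \<Longrightarrow> \<bar>disc_sum r f j\<bar> \<le> disc_sum r (\<lambda>i. \<bar>f i\<bar>) j"
proof (induction j)
  case (Suc j)
  have "\<bar>r * disc_sum r f j\<bar> \<le> r * disc_sum r (\<lambda>i. \<bar>f i\<bar>) j"
    using Suc by (simp add: abs_mult mult_left_mono)
  then show ?case by simp
qed auto

lemma disc_sum_diff: "disc_sum r (\<lambda>i. f i - g i) j = disc_sum r f j - disc_sum r g j"
  by (induction j) (simp_all add: right_diff_distrib)

text \<open>The transition operator of the walk with steps \<open>+1\<close> and \<open>-1\<close> that is killed at \<open>0\<close>.\<close>

definition step_avg :: "real \<Rightarrow> (nat \<Rightarrow> real) \<Rightarrow> nat \<Rightarrow> real" where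
  "step_avg p f j = (if j = 0 then 0 else (1 - p) * f (Suc j) + p * f (j - 1))"

lemma step_avg_mono:
  assumes "0 \<le> p" "p \<le> 1" "j \<ge> 1 \<Longrightarrow> f (Suc j) \<le> g (Suc j)" "j \<ge> 1 \<Longrightarrow> f (j - 1) \<le> g (j - 1)"
  shows "step_avg p f j \<le> step_avg p g j"
  using assms by (auto simp: step_avg_def intro!: add_mono mult_left_mono)

lemma step_avg_sum: "step_avg p (\<lambda>i. \<Sum>c\<in>A. f c i) j = (\<Sum>c\<in>A. step_avg p (f c) j)"
  by (auto simp: step_avg_def sum.distrib sum_distrib_left)

lemma step_avg_add: "step_avg p (\<lambda>i. f i + g i) j = step_avg p f j + step_avg p g j"
  by (auto simp: step_avg_def algebra_simps)

lemma step_avg_pow_mono: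
  assumes "0 \<le> p" "p \<le> 1" "\<And>i. i \<le> j + k \<Longrightarrow> f i \<le> g i"
  shows "(step_avg p ^^ k) f j \<le> (step_avg p ^^ k) g j"
  using assms(3)
proof (induction k arbitrary: j)
  case (Suc k)
  have "(step_avg p ^^ k) f i \<le> (step_avg p ^^ k) g i" if "i \<le> Suc j" for i
    using Suc that by (intro Suc) auto
  then show ?case using assms by (auto intro!: step_avg_mono)
qed auto

lemma step_avg_pow_const_le:
  assumes "0 \<le> p" "p \<le> 1" "0 \<le> c"
  shows "(step_avg p ^^ k) (\<lambda>_. c) j \<le> c"
proof (induction k arbitrary: j)
  case (Suc k)
  have "step_avg p ((step_avg p ^^ k) (\<lambda>_. c)) j \<le> step_avg p (\<lambda>_. c) j"
    using Suc assms by (intro step_avg_mono) auto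
  also have "\<dots> \<le> c" using assms by (auto simp: step_avg_def algebra_simps)
  finally show ?case by simp
qed auto

lemma step_avg_pow_add: "(step_avg p ^^ k) (\<lambda>i. f i + g i) j = (step_avg p ^^ k) f j + (step_avg p ^^ k) g j"
proof (induction k arbitrary: j)
  case (Suc k)
  then have "(step_avg p ^^ k) (\<lambda>i. f i + g i) = (\<lambda>j. (step_avg p ^^ k) f j + (step_avg p ^^ k) g j)" by blast
  then show ?case by (simp add: step_avg_add)
qed auto

text \<open>This identity turns the ordering of two neighbouring particles into an inequality between the
discounted sum and its neighbour average, and their collision into an equality.\<close>

lemma step_avg_disc_sum:
  assumes p: "0 \<le> p" "p < 1/2" and j: "1 \<le> j"
  shows "step_avg p (disc_sum (p / (1 - p)) f) j - disc_sum (p / (1 - p)) f j = (1 - p) * (f (Suc j) - f j)"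
proof -
  obtain l where l: "j = Suc l" using j by (cases j) auto
  define r where "r = p / (1 - p)"
  have "(1 - p) * r = p" using p by (simp add: r_def)
  then have *: "(1 - p) * (r * c) = p * c" for c by (metis mult.assoc)
  let ?g = "disc_sum r f l"
  have "(1 - p) * (f (Suc j) + r * (f j + r * ?g)) + p * ?g - (f j + r * ?g)
      = (1 - p) * f (Suc j) + p * (f j + r * ?g) + (1 - p) * (r * ?g) - (f j + r * ?g)"
    by (simp only: distrib_left *)
  also have "\<dots> = (1 - p) * (f (Suc j) - f j)" by (simp add: algebra_simps)
  finally show ?thesis by (simp add: step_avg_def l r_def)
qed

text \<open>After subtraction of the lowest particle all terms are nonnegative and increasing, so the discounted
sum increases; the subtracted constant contributes at most \<open>1 / (1 - r)\<close> times its size.\<close>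

lemma disc_sum_ordered:
  assumes r: "0 \<le> r" "r < 1" and X: "mono_on {1..} X" and jm: "j \<le> m"
  shows "disc_sum r X j \<le> disc_sum r X m + \<bar>X 1\<bar> / (1 - r)"
proof -
  have 1: "disc_sum r (\<lambda>i. X i - X 1) j \<le> disc_sum r (\<lambda>i. X i - X 1) m"
  proof (rule lift_Suc_mono_le[OF _ jm])
    fix i
    show "disc_sum r (\<lambda>i. X i - X 1) i \<le> disc_sum r (\<lambda>i. X i - X 1) (Suc i)"
    proof (induction i)
      case (Suc i)
      have "X (Suc i) \<le> X (Suc (Suc i))" using X by (auto simp: mono_on_def)
      then show ?case using mult_left_mono[OF Suc r(1)] by simp
    qed simp
  qed
  have c: "disc_sum r (\<lambda>_. a) i = a * disc_sum r (\<lambda>_. 1) i" for a i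
    by (induction i) (auto simp: algebra_simps)
  have 2: "0 \<le> disc_sum r (\<lambda>_. 1) i" "disc_sum r (\<lambda>_. 1) i \<le> 1 / (1 - r)" for i
    using disc_sum_const_le[OF r, of 1 i] disc_sum_mono[of i "\<lambda>_. 0" "\<lambda>_. 1" r] c[of 0 i] r by auto
  have e: "disc_sum r (\<lambda>i. X i - X 1) i = disc_sum r X i - X 1 * disc_sum r (\<lambda>_. 1) i" for i
    by (simp only: disc_sum_diff c[of "X 1"])
  have "disc_sum r X j - disc_sum r X m \<le> X 1 * (disc_sum r (\<lambda>_. 1) j - disc_sum r (\<lambda>_. 1) m)"
    using 1 e[of j] e[of m] unfolding right_diff_distrib by linarith
  also have "\<dots> \<le> \<bar>X 1\<bar> * \<bar>disc_sum r (\<lambda>_. 1) j - disc_sum r (\<lambda>_. 1) m\<bar>"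
    by (metis abs_ge_self abs_mult)
  also have "\<dots> \<le> \<bar>X 1\<bar> * (1 / (1 - r))"
    using 2[of j] 2[of m] by (intro mult_left_mono) (auto simp: abs_real_def)
  finally show ?thesis by simp
qed

section \<open>Backward paths\<close>

text \<open>\<open>backward_path W j t k i s v\<close>: a path that starts at level \<open>j\<close> and time \<open>t\<close>, and reaches level \<open>i\<close> at time \<open>s\<close>
after \<open>k\<close> stages, in each of which it runs back along its level and then moves to a neighbouring level
or stays; \<open>v\<close> is the total variation of \<open>W\<close> seen at the ends of the stages.\<close>

inductive backward_path :: "(nat \<Rightarrow> real \<Rightarrow> real) \<Rightarrow> nat \<Rightarrow> real \<Rightarrow> nat \<Rightarrow> nat \<Rightarrow> real \<Rightarrow> real \<Rightarrow> bool" for W where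
  stop: "backward_path W j t 0 j t 0"
| step: "\<lbrakk>0 \<le> s; s \<le> t; i \<le> Suc j; j \<le> Suc i; backward_path W i s k j' s' v\<rbrakk>
     \<Longrightarrow> backward_path W j t (Suc k) j' s' (v + \<bar>W j t - W j s\<bar>)"

lemma path_snoc:
  assumes "backward_path W j t k i s v" "0 \<le> s'" "s' \<le> s" "i' \<le> Suc i" "i \<le> Suc i'"
  shows "backward_path W j t (Suc k) i' s' (v + \<bar>W i s - W i s'\<bar>)"
  using assms
proof (induction rule: backward_path.induct)
  case (stop j t)
  then show ?case using backward_path.step[of s' t i' j W 0 i' s' 0] backward_path.stop by auto
next
  case (step s t i j k j' s'' v)
  then have "backward_path W i s (Suc k) i' s' (v + \<bar>W j' s'' - W j' s'\<bar>)" by blast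
  from backward_path.step[OF step(1-4) this] show ?case by (simp add: algebra_simps)
qed

lemma path_single: "\<lbrakk>0 \<le> s; s \<le> t\<rbrakk> \<Longrightarrow> backward_path W j t (Suc 0) j s \<bar>W j t - W j s\<bar>"
  using backward_path.step[of s t j j W 0 j s 0] backward_path.stop by auto

lemma path_time: "backward_path W j t k i s v \<Longrightarrow> 0 \<le> t \<Longrightarrow> 0 \<le> s \<and> s \<le> t"
  by (induction rule: backward_path.induct) auto

lemma path_at_zero: "backward_path W j t k i s v \<Longrightarrow> t = 0 \<Longrightarrow> v = 0"
  by (induction rule: backward_path.induct) auto

text \<open>A maximum principle in which the number \<open>i\<close> of completed stages plays the role of time.  As long as \<open>D\<close>
is not stopped, it dominates, up to the increment of \<open>W\<close>, the neighbour average of \<open>D\<close> at an earlier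
time; \<open>\<Phi>\<close> satisfies the opposite inequality without noise.  So a lower bound by \<open>\<Phi>\<close> at the stopped ends
of all paths, each charged with the variation \<open>v\<close> collected so far, propagates to the start.
Quantifying over all paths replaces the expectation over the walk: no probability enters.\<close>

lemma comparison_along_paths:
  fixes D W :: "nat \<Rightarrow> real \<Rightarrow> real" and \<Phi> :: "nat \<Rightarrow> nat \<Rightarrow> real"
  assumes p: "0 \<le> p" "p \<le> 1"
    and alt: "\<And>j t. \<lbrakk>1 \<le> j; 0 \<le> t; \<not> stopped j t\<rbrakk> \<Longrightarrow>
        \<exists>s. 0 \<le> s \<and> s \<le> t \<and> step_avg p (\<lambda>i. D i s) j - \<bar>W j t - W j s\<bar> \<le> D j t"
    and sub: "\<And>i j. 1 \<le> j \<Longrightarrow> \<Phi> i j \<le> step_avg p (\<Phi> (Suc i)) j"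
    and base: "\<And>i j s v. \<lbrakk>i \<le> k; backward_path W j0 t0 i j s v; i = k \<or> j = 0 \<or> stopped j s\<rbrakk> \<Longrightarrow> \<Phi> i j \<le> D j s - v"
    and t0: "0 \<le> t0"
  shows "\<Phi> 0 j0 \<le> D j0 t0"
proof -
  have claim: "\<forall>j s v. backward_path W j0 t0 i j s v \<longrightarrow> \<Phi> i j \<le> D j s - v" if "i \<le> k" for i
    using that
  proof (induction rule: inc_induct)
    case base
    then show ?case using assms(5)[of k] by auto
  next
    case (step i)
    show ?case
    proof (intro allI impI)
      fix j s v assume path: "backward_path W j0 t0 i j s v"
      show "\<Phi> i j \<le> D j s - v"
      proof (cases "j = 0 \<or> stopped j s")
        case True
        then show ?thesis using base[of i j s v] path step by auto
      next
        case False
        then obtain s' where s': "0 \<le> s'" "s' \<le> s" "step_avg p (\<lambda>i. D i s') j - \<bar>W j s - W j s'\<bar> \<le> D j s"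
          using alt[of j s] path_time[OF path t0] by auto
        let ?v = "v + \<bar>W j s - W j s'\<bar>"
        have 1: "\<Phi> (Suc i) i' \<le> D i' s' - ?v" if "i' \<le> Suc j" "j \<le> Suc i'" for i'
          using step.IH path_snoc[OF path s'(1,2) that] by blast
        have "\<Phi> i j \<le> step_avg p (\<Phi> (Suc i)) j" using sub False by auto
        also have "\<dots> \<le> step_avg p (\<lambda>i'. D i' s' - ?v) j"
          using p by (intro step_avg_mono 1) auto
        also have "\<dots> = step_avg p (\<lambda>i'. D i' s') j - ?v"
          using False by (simp add: step_avg_def algebra_simps)
        finally show ?thesis using s' by simp
      qed
    qed
  qed
  show ?thesis using claim[of 0] backward_path.stop[of W j0 t0] by force
qed

text \<open>The constant depends on the time horizon but on neither the route nor the jump times.  The order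
\<open>\<surd>(j + k)\<close> matters: a logarithmic factor could not be absorbed by the growth of the solution.\<close>

definition bounded_path_variation :: "(nat \<Rightarrow> real \<Rightarrow> real) \<Rightarrow> bool" where
  "bounded_path_variation W \<longleftrightarrow>
     (\<forall>T::nat. \<exists>C\<ge>0. \<forall>j t k i s v. 0 \<le> t \<longrightarrow> t \<le> T \<longrightarrow> backward_path W j t k i s v \<longrightarrow> v \<le> C * sqrt (real (j + k + 1)))"

lemma bounded_path_variationE:
  assumes "bounded_path_variation W"
  obtains C where "0 \<le> C"
    "\<And>j t k i s v. \<lbrakk>0 \<le> t; t \<le> T; backward_path W j t k i s v\<rbrakk> \<Longrightarrow> v \<le> C * sqrt (real j) + C * sqrt (real k + 1)"
    "\<And>j s t. \<lbrakk>0 \<le> s; s \<le> t; t \<le> T\<rbrakk> \<Longrightarrow> \<bar>W j t - W j s\<bar> \<le> C * sqrt (real j) + 2 * C"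
proof -
  obtain C where C0: "0 \<le> C"
    and CT: "\<And>j t k i s v. \<lbrakk>0 \<le> t; t \<le> real (nat \<lceil>T\<rceil>); backward_path W j t k i s v\<rbrakk> \<Longrightarrow> v \<le> C * sqrt (real (j + k + 1))"
    using assms unfolding bounded_path_variation_def by meson
  have "T \<le> real (nat \<lceil>T\<rceil>)" by linarith
  then have C: "0 \<le> C" "\<And>j t k i s v. \<lbrakk>0 \<le> t; t \<le> T; backward_path W j t k i s v\<rbrakk> \<Longrightarrow> v \<le> C * sqrt (real (j + k + 1))"
    using C0 CT order_trans by blast+
  have sq: "C * sqrt (real (j + k + 1)) \<le> C * sqrt (real j) + C * sqrt (real k + 1)" for j k
    using C(1) sqrt_add_le_add_sqrt[of "real j" "real k + 1"]
    by (simp add: distrib_left[symmetric] mult_left_mono add_ac)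
  have 2: "v \<le> C * sqrt (real j) + C * sqrt (real k + 1)" if "0 \<le> t" "t \<le> T" "backward_path W j t k i s v" for j t k i s v
    using C(2)[OF that] sq[of j k] by linarith
  have 3: "\<bar>W j t - W j s\<bar> \<le> C * sqrt (real j) + 2 * C" if "0 \<le> s" "s \<le> t" "t \<le> T" for j s t
  proof -
    have "sqrt 2 \<le> (2::real)" by (rule real_le_lsqrt) auto
    then have "C * sqrt 2 \<le> C * 2" using C(1) by (intro mult_left_mono) auto
    then show ?thesis using 2[OF _ that(3) path_single[OF that(1,2)], of j] that by simp
  qed
  show ?thesis by (rule that[OF C(1)]) (use 2 3 in blast)+
qed

section \<open>Uniqueness for the obstacle problem\<close>

text \<open>\<open>n\<close> is the initial position and \<open>W\<close> the driving path.  The last clause says that the push has either not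
been used up to time \<open>t\<close>, or was last used at a time \<open>s\<close> at which the obstacle was touched.\<close>

definition obstacle_solution ::
    "real \<Rightarrow> (nat \<Rightarrow> real) \<Rightarrow> (nat \<Rightarrow> real \<Rightarrow> real) \<Rightarrow> (nat \<Rightarrow> real \<Rightarrow> real) \<Rightarrow> bool" where
  "obstacle_solution p n W Z \<longleftrightarrow>
     (\<forall>t\<ge>0. Z 0 t = 0) \<and>
     (\<forall>j. \<forall>t\<ge>0. Z j t \<le> n j + W j t) \<and>
     (\<forall>j s t. 0 \<le> s \<longrightarrow> s \<le> t \<longrightarrow> Z j t - Z j s \<le> W j t - W j s) \<and>
     (\<forall>j\<ge>1. \<forall>t\<ge>0. Z j t \<le> step_avg p (\<lambda>i. Z i t) j) \<and>
     (\<forall>j\<ge>1. \<forall>t\<ge>0. Z j t = n j + W j t \<or>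
        (\<exists>s. 0 \<le> s \<and> s \<le> t \<and> Z j t = W j t - W j s + step_avg p (\<lambda>i. Z i s) j))"

definition superdiffusive_growth :: "(nat \<Rightarrow> real \<Rightarrow> real) \<Rightarrow> bool" where
  "superdiffusive_growth Z \<longleftrightarrow> (\<forall>T::nat. \<forall>A. \<exists>C. \<forall>m. A * sqrt (real m) - C \<le> Z m (real T))"

text \<open>An exponential martingale of the walk.  The equation \<open>\<rho> = q y + p / y\<close> makes \<open>y\<^sup>j / \<rho>\<^sup>i\<close> a martingale, and
\<open>\<rho> < 1\<close> holds for \<open>y\<close> strictly between the two roots \<open>p / q\<close> and \<open>1\<close> of \<open>q y\<^sup>2 - y + p = 0\<close>; this interval is
nonempty because \<open>p < 1/2\<close>.\<close>

lemma exists_tilt: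
  fixes p :: real
  assumes "0 \<le> p" "p < 1/2"
  obtains y \<rho> where "0 < y" "y < 1" "0 < \<rho>" "\<rho> < 1"
    "\<And>i j. 1 \<le> j \<Longrightarrow> step_avg p (\<lambda>j. y ^ j / \<rho> ^ Suc i) j = y ^ j / \<rho> ^ i"
proof
  define y where "y = (1 + p / (1 - p)) / 2"
  define \<rho> where "\<rho> = (1 - p) * y + p / y"
  have r: "0 \<le> p / (1 - p)" "p / (1 - p) < 1" using assms by (auto simp: field_simps)
  have y2: "2 * y = 1 + p / (1 - p)" by (simp add: y_def)
  show y: "0 < y" "y < 1" using r y2 by linarith+
  show \<rho>: "0 < \<rho>" using y assms by (auto simp: \<rho>_def intro!: add_pos_nonneg mult_pos_pos divide_nonneg_pos)
  have "((1 - p) * y - p) * (y - 1) < 0"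
  proof (rule mult_pos_neg)
    have "p / (1 - p) < y" using r y2 by linarith
    then show "0 < (1 - p) * y - p" using assms by (simp add: field_simps)
  qed (use y in simp)
  then have "(1 - p) * y * y + p < y" by (simp add: algebra_simps)
  then show "\<rho> < 1" using y by (simp add: \<rho>_def field_simps)
  fix i j :: nat assume j: "1 \<le> j"
  then obtain l where l: "j = Suc l" by (cases j) auto
  have "(1 - p) * y ^ Suc j + p * y ^ l = \<rho> * y ^ j"
    using y by (simp add: \<rho>_def l field_simps)
  then have "((1 - p) * y ^ Suc j + p * y ^ l) / \<rho> ^ Suc i = y ^ j / \<rho> ^ i"
    using \<rho> by simp
  then show "step_avg p (\<lambda>j. y ^ j / \<rho> ^ Suc i) j = y ^ j / \<rho> ^ i"
    by (simp add: step_avg_def l add_divide_distrib)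
qed

text \<open>After \<open>i\<close> stages either the level is at least a multiple of \<open>i\<close>, and then \<open>\<surd>j\<close> dominates \<open>\<surd>i\<close>, or the path has
stayed below the drift, and then the martingale of \<open>exists_tilt\<close> is exponentially large in \<open>i\<close>.\<close>

lemma sqrt_absorbed:
  fixes y \<rho> C :: real
  assumes y: "0 < y" "y < 1" and \<rho>: "0 < \<rho>" "\<rho> < 1" and C: "0 \<le> C"
  obtains A a where "0 \<le> A" "0 \<le> a" "\<And>i j :: nat. C * sqrt (real i + 1) \<le> A * sqrt j + y ^ j / \<rho> ^ i + a"
proof -
  \<comment> \<open>levels up to \<open>i / N\<close> count as low; there \<open>y\<^sup>j / \<rho>\<^sup>i\<close> is at least \<open>\<rho>\<^sup>-\<^sup>i\<^sup>/\<^sup>2 = \<tau>\<^sup>2\<^sup>i\<close>\<close>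
  obtain N where N: "\<rho> ^ N < y\<^sup>2"
    using real_arch_pow_inv[of "y\<^sup>2" \<rho>] y \<rho> by auto
  define \<tau> where "\<tau> = root 4 (1 / \<rho>)"
  define \<delta> where "\<delta> = \<tau> - 1"
  have \<tau>: "\<tau> > 1" "\<tau> ^ 4 = 1 / \<rho>" using \<rho> by (auto simp: \<tau>_def)
  have \<delta>: "\<delta> > 0" using \<tau> by (simp add: \<delta>_def)
  define a where "a = C + (C / (2 * \<delta>))\<^sup>2"
  have "C * sqrt (real i + 1) \<le> C * sqrt N * sqrt j + y ^ j / \<rho> ^ i + a" for i j :: nat
  proof (cases "j * N \<le> i")
    case True
    have "\<rho> ^ i \<le> \<rho> ^ (j * N)" using True \<rho> by (intro power_decreasing) auto
    also have "\<dots> = (\<rho> ^ N) ^ j" by (simp add: power_mult mult.commute)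
    also have "\<dots> \<le> (y\<^sup>2) ^ j" using N \<rho> by (intro power_mono) auto
    also have "\<dots> = (y ^ j)\<^sup>2" by (simp add: power_mult[symmetric] mult.commute)
    finally have 1: "\<rho> ^ i \<le> (y ^ j)\<^sup>2" .
    have 2: "\<rho> ^ i * (\<tau> ^ (2 * i))\<^sup>2 = 1"
    proof -
      have "(\<tau> ^ (2 * i))\<^sup>2 = (\<tau> ^ 4) ^ i" by (simp add: power_mult[symmetric] mult.commute)
      then show ?thesis using \<rho> by (simp add: \<tau> power_mult_distrib[symmetric])
    qed
    have "1 \<le> (y ^ j * \<tau> ^ (2 * i))\<^sup>2"
      using mult_right_mono[OF 1, of "(\<tau> ^ (2 * i))\<^sup>2"] 2 by (simp add: power_mult_distrib)
    then have "1 \<le> y ^ j * \<tau> ^ (2 * i)"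
      using y \<tau> by (smt (verit) power2_eq_square mult_le_one zero_le_power zero_less_power mult_pos_pos mult_less_cancel_left2 one_le_power power_le_one_iff abs_square_le_1 abs_square_less_1)
    then have "\<tau> ^ (2 * i) \<le> y ^ j * \<tau> ^ (2 * i) * \<tau> ^ (2 * i)"
      using \<tau> by (simp add: mult_right_mono[of 1])
    also have "\<dots> = y ^ j / \<rho> ^ i" using 2 \<rho> by (simp add: field_simps power2_eq_square)
    finally have 3: "\<tau> ^ (2 * i) \<le> y ^ j / \<rho> ^ i" .
    have "1 + real i * \<delta> \<le> \<tau> ^ i" using Bernoulli_inequality[of \<delta> i] \<delta> by (simp add: \<delta>_def)
    then have "(1 + real i * \<delta>)\<^sup>2 \<le> (\<tau> ^ i)\<^sup>2" using \<delta> by (intro power_mono) auto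
    also have "\<dots> = \<tau> ^ (2 * i)" by (simp add: power_mult[symmetric] mult.commute)
    finally have 4: "(1 + real i * \<delta>)\<^sup>2 \<le> y ^ j / \<rho> ^ i" using 3 by simp
    have "sqrt (real i + 1) \<le> real i + 1" by (rule real_le_lsqrt) (auto simp: power2_eq_square algebra_simps)
    then have 5: "C * sqrt (real i + 1) \<le> C * (real i + 1)" using C by (intro mult_left_mono) auto
    have "0 \<le> (real i * \<delta> - C / (2 * \<delta>))\<^sup>2" by simp
    also have "\<dots> = (real i * \<delta>)\<^sup>2 - C * real i + (C / (2 * \<delta>))\<^sup>2"
      using \<delta> by (simp add: power2_diff)
    finally have "C * (real i + 1) \<le> (real i * \<delta>)\<^sup>2 + a" by (simp add: a_def algebra_simps)
    also have "(real i * \<delta>)\<^sup>2 \<le> (1 + real i * \<delta>)\<^sup>2" using \<delta> by (intro power_mono) auto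
    finally have "C * sqrt (real i + 1) \<le> y ^ j / \<rho> ^ i + a" using 4 5 by linarith
    then show ?thesis using C by (smt (verit) mult_nonneg_nonneg of_nat_0_le_iff real_sqrt_ge_0_iff)
  next
    case False
    then have "real (Suc i) \<le> real (N * j)" by (intro of_nat_mono) (simp add: mult.commute)
    then have "sqrt (real i + 1) \<le> sqrt N * sqrt j" by (simp add: real_sqrt_mult[symmetric] add.commute)
    then have "C * sqrt (real i + 1) \<le> C * sqrt N * sqrt j" using C by (simp add: mult.assoc mult_left_mono)
    moreover have "0 \<le> y ^ j / \<rho> ^ i" "0 \<le> a" using y \<rho> C by (auto simp: a_def)
    ultimately show ?thesis by linarith
  qed
  moreover have "0 \<le> C * sqrt N" "0 \<le> a" using C by (auto simp: a_def)
  ultimately show ?thesis using that by blast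
qed

text \<open>Growth at the end of a time interval implies growth throughout, because \<open>Z - W\<close> decreases in time.\<close>

lemma uniform_growth:
  assumes Z: "obstacle_solution p n W Z" and W: "bounded_path_variation W"
    and gr: "superdiffusive_growth Z"
  obtains C where "0 \<le> C" "\<And>m s. \<lbrakk>0 \<le> s; s \<le> T\<rbrakk> \<Longrightarrow> A * sqrt (real m) - C \<le> Z m s"
proof -
  define N where "N = nat \<lceil>T\<rceil>"
  have TN: "T \<le> real N" unfolding N_def by linarith
  obtain C where C: "0 \<le> C" "\<And>j s t. \<lbrakk>0 \<le> s; s \<le> t; t \<le> real N\<rbrakk> \<Longrightarrow> \<bar>W j t - W j s\<bar> \<le> C * sqrt (real j) + 2 * C"
    using bounded_path_variationE[OF W, of "real N"] by metis
  obtain C' where C': "\<And>m. (A + C) * sqrt (real m) - C' \<le> Z m (real N)"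
    using gr unfolding superdiffusive_growth_def by meson
  have "A * sqrt (real m) - (\<bar>C'\<bar> + 2 * C) \<le> Z m s" if s: "0 \<le> s" "s \<le> T" for m s
  proof -
    have sN: "s \<le> real N" using s TN by simp
    have "Z m (real N) - Z m s \<le> W m (real N) - W m s" using Z s sN unfolding obstacle_solution_def by blast
    then show ?thesis using C(2)[OF s(1) sN order_refl, of m] C'[of m] by (simp add: algebra_simps)
  qed
  with C(1) show ?thesis by (intro that[of "\<bar>C'\<bar> + 2 * C"]) auto
qed

text \<open>The difference \<open>n + W - Z\<close> is \<open>q\<close> times the local time.  Compare \<open>Z\<close> along paths that start at level \<open>m\<close> and
have at most \<open>k\<close> stages with the discounted sum \<open>G\<close> of the truncated positions \<open>min x\<^sub>i x\<^sub>m\<close>, which is subharmonic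
since these increase.  \<open>G\<close> agrees with \<open>n\<close> at \<open>m\<close>, lies below \<open>n\<close>, where unpushed paths end, and is bounded by
a multiple \<open>H\<close> of \<open>max x\<^sub>m 0\<close>; so after \<open>k \<approx> (H / B)\<^sup>2\<close> stages a path ends at a value of \<open>Z\<close> above \<open>G\<close>, unless it
is low and the martingale \<open>y\<^sup>j / \<rho>\<^sup>k\<close> makes up for it.  The noise on the way is of order \<open>\<surd>m + \<surd>k\<close>, hence at most \<open>\<surd>m + x\<^sub>m / B\<close> up to constants, and \<open>B\<close> is arbitrary.\<close>

lemma local_time_negligible:
  assumes p: "0 \<le> p" "p < 1/2" and r: "r = p / (1 - p)"
    and x: "mono_on {1..} x" and n: "n = disc_sum r x"
    and Z: "obstacle_solution p n W Z" and W: "bounded_path_variation W" and W0: "\<And>j. W j 0 = 0"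
    and gr: "superdiffusive_growth Z" and T: "0 \<le> T" and e: "0 < e"
  obtains C where "0 \<le> C" "\<And>m t. \<lbrakk>0 \<le> t; t \<le> T; 1 \<le> m\<rbrakk> \<Longrightarrow> n m + W m t - Z m t \<le> e * Z m t + C"
proof -
  have r01: "0 \<le> r" "r < 1" using p by (auto simp: r field_simps)
  obtain y \<rho> where y: "0 < y" "y < 1" "0 < \<rho>" "\<rho> < 1"
    and tilt: "\<And>i j. 1 \<le> j \<Longrightarrow> step_avg p (\<lambda>j. y ^ j / \<rho> ^ Suc i) j = y ^ j / \<rho> ^ i"
    using exists_tilt[OF p] by metis
  obtain C where C: "0 \<le> C"
    "\<And>j t k i s v. \<lbrakk>0 \<le> t; t \<le> T; backward_path W j t k i s v\<rbrakk> \<Longrightarrow> v \<le> C * sqrt (real j) + C * sqrt (real k + 1)"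
    "\<And>j s t. \<lbrakk>0 \<le> s; s \<le> t; t \<le> T\<rbrakk> \<Longrightarrow> \<bar>W j t - W j s\<bar> \<le> C * sqrt (real j) + 2 * C"
    using bounded_path_variationE[OF W, of T] by metis
  define \<delta> where "\<delta> = min (1/2) (e / 4)"
  have \<delta>: "0 < \<delta>" "\<delta> \<le> 1/2" "\<delta> \<le> e / 4" using e by (auto simp: \<delta>_def)
  \<comment> \<open>the growth rate of \<open>Z\<close> to be used along the paths; it makes the noise at most \<open>\<delta> x\<^sub>m\<close>\<close>
  define B where "B = C / (\<delta> * (1 - r)) + 1"
  have B: "0 < B" "C / (B * (1 - r)) \<le> \<delta>"
  proof -
    show "0 < B" using C \<delta> r01 by (auto simp: B_def intro!: add_nonneg_pos)
    have "C / (\<delta> * (1 - r)) \<le> B" by (simp add: B_def)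
    then show "C / (B * (1 - r)) \<le> \<delta>" using \<open>0 < B\<close> \<delta> r01 by (simp add: field_simps)
  qed
  obtain A a where A: "0 \<le> A" "0 \<le> a" "\<And>i j :: nat. B * sqrt (real i + 1) \<le> A * sqrt j + y ^ j / \<rho> ^ i + a"
    using sqrt_absorbed[OF y, of B] B by auto
  \<comment> \<open>a second growth rate, which absorbs the terms of order \<open>\<surd>m\<close> at the end\<close>
  define A2 where "A2 = 12 * C / e + 1"
  have A2: "0 < A2" "6 * C \<le> e / 2 * A2" using C e by (auto simp: A2_def field_simps intro!: add_nonneg_pos)
  obtain c1 where c1: "0 \<le> c1" "\<And>m s. \<lbrakk>0 \<le> s; s \<le> T\<rbrakk> \<Longrightarrow> A * sqrt (real m) - c1 \<le> Z m s"
    using uniform_growth[OF Z W gr, of T A] by metis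
  obtain c2 where c2: "0 \<le> c2" "\<And>m s. \<lbrakk>0 \<le> s; s \<le> T\<rbrakk> \<Longrightarrow> A2 * sqrt (real m) - c2 \<le> Z m s"
    using uniform_growth[OF Z W gr, of T A2] by metis
  define c3 where "c3 = C * ((a + c1) / B + 4) + 1"
  have main: "n m - (C * sqrt m + \<delta> * max (x m) 0 + c3) \<le> Z m t" if t: "0 \<le> t" "t \<le> T" and m: "1 \<le> m" for m t
  proof -
    define G where "G = disc_sum r (\<lambda>i. min (x i) (x m))"
    define H where "H = max (x m) 0 / (1 - r)"
    have H: "0 \<le> H" using r01 by (simp add: H_def)
    have GH: "G j \<le> H" for j
    proof -
      have "G j \<le> disc_sum r (\<lambda>_. max (x m) 0) j" unfolding G_def using r01 by (intro disc_sum_mono) auto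
      also have "\<dots> \<le> H" unfolding H_def using r01 by (intro disc_sum_const_le) auto
      finally show ?thesis .
    qed
    have Gn: "G j \<le> n j" for j unfolding G_def n using r01 by (intro disc_sum_mono) auto
    have Gm: "G m = n m" unfolding G_def n using x m by (intro disc_sum_cong) (auto simp: mono_on_def)
    have Gsub: "G j \<le> step_avg p G j" if "1 \<le> j" for j
    proof -
      have "x j \<le> x (Suc j)" using x that by (auto simp: mono_on_def)
      then have "0 \<le> (1 - p) * (min (x (Suc j)) (x m) - min (x j) (x m))"
        using p by (intro mult_nonneg_nonneg) auto
      then show ?thesis using step_avg_disc_sum[OF p that, of "\<lambda>i. min (x i) (x m)"] by (simp add: G_def r)
    qed
    \<comment> \<open>chosen such that \<open>B \<surd>k\<close> exceeds the bound \<open>H\<close> of \<open>G\<close>\<close>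
    define k where "k = nat \<lceil>((H + a + c1) / B)\<^sup>2\<rceil>"
    have k1: "(H + a + c1) / B \<le> sqrt k"
      by (rule real_le_rsqrt) (simp add: k_def)
    have k2: "sqrt (real k + 2) \<le> (H + a + c1) / B + 2"
    proof (rule real_le_lsqrt)
      have aux: "real k + 2 \<le> (u + 2)\<^sup>2" if "real k \<le> u\<^sup>2 + 1" "0 \<le> u" for u :: real
        using that by (simp add: power2_eq_square algebra_simps)
      have *: "0 \<le> (H + a + c1) / B" using H A c1 B by auto
      then show "0 \<le> (H + a + c1) / B + 2" by simp
      have "real k \<le> ((H + a + c1) / B)\<^sup>2 + 1" unfolding k_def by (simp add: of_nat_ceiling)
      then show "real k + 2 \<le> ((H + a + c1) / B + 2)\<^sup>2"
        using aux * by blast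
    qed
    define b where "b = C * sqrt m + C * sqrt (real k + 2)"
    have vb: "v \<le> b" if "backward_path W m t i j s v" "i \<le> Suc k" for i j s v
    proof -
      have "C * sqrt (real i + 1) \<le> C * sqrt (real k + 2)" using C that by (intro mult_left_mono) auto
      then show ?thesis using C(2)[OF t that(1)] by (simp add: b_def)
    qed
    define \<Phi> where "\<Phi> = (\<lambda>i j. G j - b - y ^ j / \<rho> ^ i)"
    have M0: "0 \<le> y ^ j / \<rho> ^ i" for i j using y by simp
    have "\<Phi> 0 m \<le> Z m t"
    proof (rule comparison_along_paths[where k = k and p = p and W = W and \<Phi> = \<Phi> and D = Z
          and ?j0.0 = m and ?t0.0 = t and stopped = "\<lambda>j t. Z j t = n j + W j t"])
      show "0 \<le> p" "p \<le> 1" "0 \<le> t" using p t by auto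
      show "\<exists>s. 0 \<le> s \<and> s \<le> t \<and> step_avg p (\<lambda>i. Z i s) j - \<bar>W j t - W j s\<bar> \<le> Z j t"
        if "1 \<le> j" "0 \<le> t" "Z j t \<noteq> n j + W j t" for j t
      proof -
        obtain s where s: "0 \<le> s" "s \<le> t" "Z j t = W j t - W j s + step_avg p (\<lambda>i. Z i s) j"
          using Z \<open>1 \<le> j\<close> \<open>0 \<le> t\<close> \<open>Z j t \<noteq> n j + W j t\<close> unfolding obstacle_solution_def by metis
        then show ?thesis by (intro exI[of _ s]) auto
      qed
      show "\<Phi> i j \<le> step_avg p (\<Phi> (Suc i)) j" if "1 \<le> j" for i j
      proof -
        have "step_avg p (\<Phi> (Suc i)) j = step_avg p G j - b - step_avg p (\<lambda>j. y ^ j / \<rho> ^ Suc i) j"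
          using that by (simp add: \<Phi>_def step_avg_def algebra_simps)
        then show ?thesis using Gsub[OF that] tilt[OF that, of i] by (simp add: \<Phi>_def)
      qed
      show "\<Phi> i j \<le> Z j s - v" if path: "i \<le> k" "backward_path W m t i j s v" "i = k \<or> j = 0 \<or> Z j s = n j + W j s" for i j s v
      proof -
        have s: "0 \<le> s" "s \<le> T" using path_time[OF path(2) t(1)] t by auto
        consider "i = k" | "j = 0" | "Z j s = n j + W j s" using path(3) by blast
        then show ?thesis
        proof cases
          case 1
          have "H \<le> A * sqrt j - c1 + y ^ j / \<rho> ^ k"
          proof -
            have "H + a + c1 \<le> B * sqrt k" using k1 B by (simp add: field_simps)
            also have "\<dots> \<le> B * sqrt (real k + 1)" using B by simp
            finally show ?thesis using A(3)[of k j] by linarith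
          qed
          then show ?thesis using c1(2)[OF s, of j] GH[of j] vb[OF path(2)] 1 by (simp add: \<Phi>_def)
        next
          case 2
          have "v \<le> b" using vb[OF path(2)] path(1) by simp
          moreover have "0 \<le> 1 / \<rho> ^ i" using y by simp
          moreover have "Z j s = 0" using Z s 2 by (auto simp: obstacle_solution_def)
          moreover have "\<Phi> i j = - b - 1 / \<rho> ^ i" using 2 by (simp add: \<Phi>_def G_def)
          ultimately show ?thesis by linarith
        next
          case 3
          \<comment> \<open>the path is prolonged along its level to time \<open>0\<close>, where \<open>W\<close> vanishes\<close>
          have "v + \<bar>W j s - W j 0\<bar> \<le> b"
            using vb[OF path_snoc[OF path(2), of 0 j]] s path(1) by auto
          then show ?thesis using 3 Gn[of j] M0[of j i] by (simp add: \<Phi>_def W0)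
        qed
      qed
    qed
    moreover have "y ^ m \<le> 1" using y by (simp add: power_le_one)
    ultimately have 1: "n m - b - 1 \<le> Z m t" by (simp add: \<Phi>_def Gm)
    have "C * sqrt (real k + 2) \<le> C * ((H + a + c1) / B + 2)" using k2 C by (intro mult_left_mono) auto
    also have "\<dots> = C / (B * (1 - r)) * max (x m) 0 + C * ((a + c1) / B + 2)"
      using B r01 by (simp add: H_def field_simps)
    also have "\<dots> \<le> \<delta> * max (x m) 0 + C * ((a + c1) / B + 2)"
      using B by (intro add_right_mono mult_right_mono) auto
    finally show ?thesis using 1 C(1) by (simp add: b_def c3_def algebra_simps)
  qed
  define c4 where "c4 = \<bar>x 1\<bar> / (1 - r)"
  have c4: "0 \<le> c4" using r01 by (simp add: c4_def)
  have n_lower: "- c4 \<le> n j" for j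
  proof -
    have "- disc_sum r (\<lambda>_. \<bar>x 1\<bar>) j = disc_sum r (\<lambda>_. - \<bar>x 1\<bar>) j" using disc_sum_uminus[of r "\<lambda>_. \<bar>x 1\<bar>" j] by simp
    also have "\<dots> \<le> n j" unfolding n
    proof (intro disc_sum_mono r01)
      fix i :: nat assume "1 \<le> i" then have "x 1 \<le> x i" using x by (auto simp: mono_on_def)
      then show "- \<bar>x 1\<bar> \<le> x i" by simp
    qed
    finally show ?thesis using disc_sum_const_le[OF r01, of "\<bar>x 1\<bar>" j] by (simp add: c4_def)
  qed
  define D where "D = 2 * C + 2 * c3 + c4 + e * c2"
  have c3: "0 \<le> c3" using C A c1 B by (auto simp: c3_def intro!: add_nonneg_nonneg mult_nonneg_nonneg divide_nonneg_pos)
  have "n m + W m t - Z m t \<le> e * Z m t + D" if t: "0 \<le> t" "t \<le> T" and m: "1 \<le> m" for m t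
  proof -
    obtain l where l: "m = Suc l" using m by (cases m) auto
    have "r * (- c4) \<le> r * n l" using n_lower[of l] r01 by (intro mult_left_mono) auto
    moreover have "r * c4 \<le> 1 * c4" using r01 c4 by (intro mult_right_mono) auto
    moreover have "n m = x m + r * n l" by (simp add: n l)
    ultimately have "x m \<le> n m + c4" by simp
    then have xn: "max (x m) 0 \<le> n m + c4" using n_lower[of m] by simp
    let ?u = "sqrt (real m)"
    have u: "0 \<le> ?u" by simp
    have 1: "n m \<le> Z m t + C * ?u + \<delta> * (n m + c4) + c3"
      using main[OF t m] mult_left_mono[OF xn, of \<delta>] \<delta> by linarith
    have n': "0 \<le> n m + c4" using n_lower[of m] by linarith
    have 2: "n m + c4 \<le> 2 * (Z m t + C * ?u + c3 + c4)"
      using 1 mult_right_mono[OF \<delta>(2) n'] by argo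
    have 3: "\<delta> * (n m + c4) \<le> 2 * \<delta> * (Z m t + C * ?u + c3 + c4)"
      using mult_left_mono[OF 2, of \<delta>] \<delta> by (simp add: algebra_simps)
    have pos: "0 \<le> Z m t + C * ?u + c3 + c4" using 2 n' by simp
    have 4: "2 * \<delta> * (Z m t + C * ?u + c3 + c4) \<le> e / 2 * Z m t + (C * ?u + c3 + c4) + e/2 * c2"
    proof -
      have z: "- c2 \<le> Z m t" using c2(2)[OF t, of m] mult_nonneg_nonneg[OF less_imp_le[OF A2(1)] u] by linarith
      have "2 * \<delta> * (Z m t + c2) \<le> e / 2 * (Z m t + c2)" using \<delta> z by (intro mult_right_mono) auto
      moreover have "2 * \<delta> * (C * ?u + c3 + c4) \<le> 1 * (C * ?u + c3 + c4)"
        using \<delta> C u c3 c4 by (intro mult_right_mono) auto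
      moreover have "0 \<le> \<delta> * c2" using \<delta> c2 by simp
      ultimately show ?thesis by (simp add: algebra_simps)
    qed
    have W': "W m t \<le> C * ?u + 2 * C" using C(3)[of 0 t m] t by (simp add: W0)
    have 5: "n m + W m t - Z m t \<le> 6 * C * ?u + e / 2 * Z m t + 2 * C + 2 * c3 + c4 + e/2 * c2"
      using 1 3 4 W' mult_nonneg_nonneg[OF C(1) u] by linarith
    have "6 * C * ?u \<le> e / 2 * A2 * ?u" using A2 u by (intro mult_right_mono) auto
    also have "\<dots> \<le> e / 2 * (Z m t + c2)"
      using mult_left_mono[OF c2(2)[OF t, of m], of "e / 2"] e by (simp add: algebra_simps)
    finally have "n m + W m t - Z m t \<le> e * Z m t + (2 * C + 2 * c3 + c4 + e * c2)"
      using 5 by (simp add: algebra_simps)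
    then show ?thesis by (simp add: D_def)
  qed
  then show ?thesis using that[of D] C c3 c4 c2 e by (simp add: D_def)
qed

text \<open>Apply the comparison to \<open>D = Z - (Z' - Z) / \<epsilon>\<close>.  Where \<open>Z' > Z\<close>, the solution \<open>Z\<close> has been pushed, and from its
last contact both \<open>Z\<close> and \<open>Z' - Z\<close> are passed on to the neighbour average, \<open>Z\<close> at the cost of the
variation of \<open>W\<close>.  This variation is always covered by half of \<open>Z\<close>, the martingale and a constant that
does not depend on \<open>\<epsilon>\<close>.  After many stages the path is either high, where \<open>Z' - Z\<close> is at most the local
time term and hence a small multiple of \<open>Z\<close>, or low, where the martingale is large.\<close>

lemma obstacle_solution_le:
  assumes p: "0 \<le> p" "p < 1/2" and r: "r = p / (1 - p)"
    and x: "mono_on {1..} x" and n: "n = disc_sum r x"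
    and Z: "obstacle_solution p n W Z" and Z': "obstacle_solution p n W Z'"
    and W: "bounded_path_variation W" and W0: "\<And>j. W j 0 = 0"
    and gr: "superdiffusive_growth Z" and t0: "0 \<le> t0"
  shows "Z' j0 t0 \<le> Z j0 t0"
proof -
  obtain y \<rho> where y: "0 < y" "y < 1" "0 < \<rho>" "\<rho> < 1"
    and tilt: "\<And>i j. 1 \<le> j \<Longrightarrow> step_avg p (\<lambda>j. y ^ j / \<rho> ^ Suc i) j = y ^ j / \<rho> ^ i"
    using exists_tilt[OF p] by metis
  obtain C where C: "0 \<le> C"
    "\<And>j t k i s v. \<lbrakk>0 \<le> t; t \<le> t0; backward_path W j t k i s v\<rbrakk> \<Longrightarrow> v \<le> C * sqrt (real j) + C * sqrt (real k + 1)"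
    using bounded_path_variationE[OF W, of t0] by metis
  obtain A a where A: "0 \<le> A" "0 \<le> a" "\<And>i j :: nat. 2 * C * sqrt (real i + 1) \<le> A * sqrt j + y ^ j / \<rho> ^ i + a"
    using sqrt_absorbed[OF y, of "2 * C"] C by auto
  obtain c1 where c1: "0 \<le> c1" "\<And>m s. \<lbrakk>0 \<le> s; s \<le> t0\<rbrakk> \<Longrightarrow> A * sqrt (real m) - c1 \<le> Z m s"
    using uniform_growth[OF Z W gr, of t0 A] by metis
  have M0: "0 \<le> y ^ j / \<rho> ^ i" for i j using y by simp
  define a1 where "a1 = C * sqrt j0 + a / 2 + c1"
  \<comment> \<open>half of \<open>Z\<close> and half of the martingale pay for the variation; the other halves stay available\<close>
  have pay: "v \<le> Z j s / 2 + (y ^ j / \<rho> ^ i) / 2 + a1 - c1 / 2" if "backward_path W j0 t0 i j s v" for i j s v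
    using C(2)[OF t0 order_refl that] A(3)[of i j] c1(2)[of s j] path_time[OF that t0] by (simp add: a1_def)
  have eps: "Z' j0 t0 - Z j0 t0 \<le> e * (Z j0 t0 + a1 + 1)" if e: "0 < e" for e
  proof -
    obtain c2 where c2: "0 \<le> c2" "\<And>m t. \<lbrakk>0 \<le> t; t \<le> t0; 1 \<le> m\<rbrakk> \<Longrightarrow> n m + W m t - Z m t \<le> e / 4 * Z m t + c2"
      using local_time_negligible[OF p r x n Z W W0 gr t0, of "e / 4"] e by auto
    obtain c3 where c3: "0 \<le> c3" "\<And>m s. \<lbrakk>0 \<le> s; s \<le> t0\<rbrakk> \<Longrightarrow> 1 * sqrt (real m) - c3 \<le> Z m s"
      using uniform_growth[OF Z W gr, of t0 1] by metis
    \<comment> \<open>above level \<open>N\<close> the constant \<open>c2 / e\<close> is covered by a quarter of \<open>Z\<close>\<close>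
    define N where "N = nat \<lceil>(c3 + 4 * c2 / e)\<^sup>2\<rceil>"
    have Npos: "0 < y ^ N" using y by simp
    have "0 < 2 * (c2 / e + c3) + 1" using c2 c3 e by (intro add_nonneg_pos) auto
    \<comment> \<open>below level \<open>N\<close> it is covered by half of the martingale after \<open>k\<close> stages\<close>
    then obtain k where k: "\<rho> ^ k < y ^ N / (2 * (c2 / e + c3) + 1)"
      using real_arch_pow_inv[of "y ^ N / (2 * (c2 / e + c3) + 1)" \<rho>] y Npos by auto
    define D where "D = (\<lambda>j t. Z j t - (Z' j t - Z j t) / e)"
    define \<Phi> where "\<Phi> = (\<lambda>(i::nat) (j::nat). - a1 - y ^ j / \<rho> ^ i)"
    have "\<Phi> 0 j0 \<le> D j0 t0"
    proof (rule comparison_along_paths[where k = k and p = p and W = W and \<Phi> = \<Phi> and D = D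
          and ?j0.0 = j0 and ?t0.0 = t0 and stopped = "\<lambda>j t. Z' j t \<le> Z j t"])
      show "0 \<le> p" "p \<le> 1" "0 \<le> t0" using p t0 by auto
      show "\<exists>s. 0 \<le> s \<and> s \<le> t \<and> step_avg p (\<lambda>i. D i s) j - \<bar>W j t - W j s\<bar> \<le> D j t"
        if j: "1 \<le> j" and t: "0 \<le> t" and ns: "\<not> Z' j t \<le> Z j t" for j t
      proof -
        have "Z' j t \<le> n j + W j t" using Z' t unfolding obstacle_solution_def by metis
        then obtain s where s: "0 \<le> s" "s \<le> t" "Z j t = W j t - W j s + step_avg p (\<lambda>i. Z i s) j"
          using Z j t ns unfolding obstacle_solution_def by (metis order_refl)
        have "Z' j t - Z' j s \<le> W j t - W j s" using Z' s unfolding obstacle_solution_def by metis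
        moreover have "Z' j s \<le> step_avg p (\<lambda>i. Z' i s) j" using Z' s j unfolding obstacle_solution_def by metis
        ultimately have "Z' j t - Z j t \<le> step_avg p (\<lambda>i. Z' i s) j - step_avg p (\<lambda>i. Z i s) j"
          using s by linarith
        then have "(Z' j t - Z j t) / e \<le> (step_avg p (\<lambda>i. Z' i s) j - step_avg p (\<lambda>i. Z i s) j) / e"
          using e by (intro divide_right_mono) auto
        also have "\<dots> = step_avg p (\<lambda>i. Z i s) j - step_avg p (\<lambda>i. D i s) j"
          using e j by (simp add: step_avg_def D_def field_simps)
        finally show ?thesis using s by (intro exI[of _ s]) (auto simp: D_def)
      qed
      show "\<Phi> i j \<le> step_avg p (\<Phi> (Suc i)) j" if "1 \<le> j" for i j
      proof -
        have "step_avg p (\<Phi> (Suc i)) j = - a1 - step_avg p (\<lambda>j. y ^ j / \<rho> ^ Suc i) j"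
          using that by (simp add: \<Phi>_def step_avg_def algebra_simps)
        then show ?thesis using tilt[OF that, of i] by (simp add: \<Phi>_def)
      qed
      show "\<Phi> i j \<le> D j s - v" if path: "i \<le> k" "backward_path W j0 t0 i j s v" "i = k \<or> j = 0 \<or> Z' j s \<le> Z j s" for i j s v
      proof -
        have s: "0 \<le> s" "s \<le> t0" using path_time[OF path(2) t0] by auto
        have v: "v \<le> Z j s / 2 + (y ^ j / \<rho> ^ i) / 2 + a1 - c1 / 2" by (rule pay[OF path(2)])
        show ?thesis
        proof (cases "Z' j s \<le> Z j s")
          case True
          then have "(Z' j s - Z j s) / e \<le> 0" using e by (simp add: divide_nonpos_pos)
          then have "Z j s \<le> D j s" by (simp add: D_def)
          moreover have "- c1 \<le> Z j s"
            using c1(2)[OF s, of j] mult_nonneg_nonneg[OF A(1) real_sqrt_ge_zero[OF of_nat_0_le_iff, of j]] by linarith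
          ultimately show ?thesis using v M0[of j i] by (simp add: \<Phi>_def)
        next
          case False
          then have j: "1 \<le> j" using Z Z' s unfolding obstacle_solution_def by (cases j) auto
          then have i: "i = k" using path False by auto
          have "Z' j s \<le> n j + W j s" using Z' s unfolding obstacle_solution_def by metis
          then have "Z' j s - Z j s \<le> e / 4 * Z j s + c2" using c2(2)[OF s j] by linarith
          then have "(Z' j s - Z j s) / e \<le> (e / 4 * Z j s + c2) / e" using e by (intro divide_right_mono) auto
          also have "\<dots> = Z j s / 4 + c2 / e" using e by (simp add: field_simps)
          finally have 1: "3/4 * Z j s - c2 / e \<le> D j s" by (simp add: D_def)
          have 2: "c2 / e \<le> Z j s / 4 + (y ^ j / \<rho> ^ k) / 2"
          proof (cases "N \<le> j")
            case True
            have "c3 + 4 * c2 / e \<le> sqrt N" by (rule real_le_rsqrt) (simp add: N_def)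
            also have "\<dots> \<le> sqrt j" using True by simp
            finally show ?thesis using c3(2)[OF s, of j] M0[of j k] by simp
          next
            case False
            then have "y ^ N \<le> y ^ j" using y by (intro power_decreasing) auto
            then have "y ^ N / \<rho> ^ k \<le> y ^ j / \<rho> ^ k" using y by (intro divide_right_mono) auto
            moreover have "2 * (c2 / e + c3) + 1 < y ^ N / \<rho> ^ k"
            proof -
              have "0 < 2 * (c2 / e + c3) + 1" using c2 c3 e by (auto intro!: add_nonneg_pos)
              then show ?thesis using k y by (simp add: field_simps)
            qed
            ultimately have "2 * (c2 / e + c3) \<le> y ^ j / \<rho> ^ k" by linarith
            moreover have "- c3 \<le> Z j s" using c3(2)[OF s, of j] real_sqrt_ge_zero[OF of_nat_0_le_iff, of j] by linarith
            ultimately show ?thesis using c3(1) by argo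
          qed
          then show ?thesis using 1 v i c1 M0[of j k] by (simp add: \<Phi>_def)
        qed
      qed
    qed
    then have "(Z' j0 t0 - Z j0 t0) / e \<le> Z j0 t0 + a1 + y ^ j0" by (simp add: \<Phi>_def D_def)
    also have "\<dots> \<le> Z j0 t0 + a1 + 1" using y by (simp add: power_le_one)
    finally show ?thesis using e by (simp add: field_simps)
  qed
  show ?thesis
  proof (rule ccontr)
    assume "\<not> Z' j0 t0 \<le> Z j0 t0"
    define d where "d = Z' j0 t0 - Z j0 t0"
    define K where "K = \<bar>Z j0 t0 + a1 + 1\<bar> + 1"
    have d: "0 < d" using \<open>\<not> Z' j0 t0 \<le> Z j0 t0\<close> by (simp add: d_def)
    have K: "0 < K" by (simp add: K_def)
    have "d \<le> d / (2 * K) * (Z j0 t0 + a1 + 1)"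
      using eps[of "d / (2 * K)"] d K by (simp add: d_def)
    also have "\<dots> \<le> d / (2 * K) * K"
      using d K by (intro mult_left_mono) (auto simp: K_def)
    also have "\<dots> = d / 2" using K by simp
    finally show False using d by simp
  qed
qed

section \<open>Competing particles as an obstacle problem\<close>

text \<open>Take for \<open>s\<close> the first time at which \<open>l\<close> has its value \<open>l t\<close>.  Then \<open>l\<close> increases on every interval that ends
at \<open>s\<close>; if \<open>Y s\<close> were positive, such a short interval would carry positive mass of \<open>Y dl\<close>.\<close>

lemma last_contact:
  fixes Y l :: "real \<Rightarrow> real"
  assumes Y: "continuous_on {0..} Y" "\<And>t. 0 \<le> t \<Longrightarrow> 0 \<le> Y t"
    and l: "continuous_on {0..} l" "mono_on {0..} l" "l 0 = 0"
    and int: "(\<integral>\<^sup>+t\<in>{0..}. ennreal (Y t) \<partial>interval_measure (\<lambda>t. l (max 0 t))) = 0"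
    and t: "0 \<le> t" "l t \<noteq> 0"
  obtains s where "0 \<le> s" "s \<le> t" "Y s = 0" "l s = l t"
proof -
  define S where "S = {u \<in> {0..t}. l u = l t}"
  have "S = {0..t} \<inter> l -` {l t}" by (auto simp: S_def)
  moreover have "continuous_on {0..t} l" using l(1) by (rule continuous_on_subset) auto
  ultimately have "closed S" by (simp add: continuous_closed_preimage)
  moreover have ne: "S \<noteq> {}" "bdd_below S" using t by (auto simp: S_def intro!: bdd_belowI[of _ 0])
  ultimately have "Inf S \<in> S" using closed_contains_Inf by blast
  define s where "s = Inf S"
  have s: "0 \<le> s" "s \<le> t" "l s = l t" using \<open>Inf S \<in> S\<close> by (auto simp: s_def S_def)
  have "s \<noteq> 0" using s l t by auto
  then have s0: "0 < s" using s by simp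
  have below: "l u < l s" if "0 \<le> u" "u < s" for u
  proof -
    have "u \<notin> S" using that ne cInf_lower[of u S] by (auto simp: s_def)
    moreover have "l u \<le> l s" using l(2) that by (auto simp: mono_on_def)
    ultimately show ?thesis using that s by (auto simp: S_def)
  qed
  have "Y s = 0"
  proof (rule ccontr)
    assume "Y s \<noteq> 0"
    then have Ys: "0 < Y s" using Y(2)[OF s(1)] by simp
    have "\<exists>d>0. \<forall>u\<in>{0..}. dist u s < d \<longrightarrow> dist (Y u) (Y s) < Y s / 2"
      using Y(1) Ys s(1) unfolding continuous_on_iff by (metis atLeast_iff half_gt_zero)
    then obtain d where d: "0 < d" "\<And>u. 0 \<le> u \<Longrightarrow> dist u s < d \<Longrightarrow> dist (Y u) (Y s) < Y s / 2" by auto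
    define a where "a = max 0 (s - d / 2)"
    have a: "0 \<le> a" "a < s" "s - a < d" using s0 d by (auto simp: a_def)
    define F where "F = (\<lambda>t. l (max 0 t))"
    have monoF: "F u \<le> F v" if "u \<le> v" for u v using l(2) that by (auto simp: F_def mono_on_def)
    have "continuous_on UNIV F" unfolding F_def
      by (rule continuous_on_compose2[OF l(1)]) (auto intro!: continuous_intros)
    then have contF: "continuous (at_right u) F" for u
      by (simp add: continuous_on_eq_continuous_at continuous_at_imp_continuous_within)
    have em: "emeasure (interval_measure F) {a<..s} = ennreal (F s - F a)"
      using emeasure_interval_measure_Ioc[of a s F] a monoF contF by simp
    have "0 < F s - F a" using below[OF a(1,2)] a s0 by (simp add: F_def)
    then have "0 < ennreal (Y s / 2) * emeasure (interval_measure F) {a<..s}"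
      using Ys em by (auto simp: ennreal_zero_less_mult_iff)
    also have "\<dots> = (\<integral>\<^sup>+t. ennreal (Y s / 2) * indicator {a<..s} t \<partial>interval_measure F)"
      by (subst nn_integral_cmult_indicator) auto
    also have "\<dots> \<le> (\<integral>\<^sup>+t\<in>{0..}. ennreal (Y t) \<partial>interval_measure F)"
    proof (rule nn_integral_mono)
      fix u
      have "Y s / 2 \<le> Y u" if "u \<in> {a<..s}"
      proof -
        have "dist (Y u) (Y s) < Y s / 2" using that a by (intro d(2)) (auto simp: dist_real_def)
        then show ?thesis by (auto simp: dist_real_def abs_real_def split: if_splits)
      qed
      then show "ennreal (Y s / 2) * indicator {a<..s} u \<le> ennreal (Y u) * indicator {0..} u"
        using a by (auto simp: indicator_def intro!: ennreal_leI)
    qed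
    finally show False using int by (simp add: F_def)
  qed
  with s that show ?thesis by blast
qed

text \<open>By induction on \<open>j\<close> the discounted sum of the particles is \<open>n\<^sub>j + W\<^sub>j - q L\<^sub>j\<close>, since \<open>r q L\<^sub>j\<close> cancels the push
\<open>p L\<^sub>j\<close> that particle \<open>j + 1\<close> receives from below.\<close>

lemma competing_brownian_path_obstacle:
  assumes p: "0 \<le> p" "p < 1/2" and r: "r = p / (1 - p)"
    and sol: "competing_brownian_path p g x B X L"
  shows "obstacle_solution p (disc_sum r x) (\<lambda>j t. disc_sum r (\<lambda>i. g i * t + B i t) j) (\<lambda>j t. disc_sum r (\<lambda>i. X i t) j)"
proof -
  have qr: "(1 - p) * r = p" using p by (simp add: r)
  have r0: "0 \<le> r" using p by (simp add: r)
  have X: "\<And>j. 1 \<le> j \<Longrightarrow> continuous_on {0..} (X j)" and L: "\<And>j. continuous_on {0..} (L j)"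
    and eq: "\<And>t j. 0 \<le> t \<Longrightarrow> 1 \<le> j \<Longrightarrow> X j t = x j + g j * t + B j t + p * L (j - 1) t - (1 - p) * L j t"
    and mono: "\<And>t. 0 \<le> t \<Longrightarrow> mono_on {1..} (\<lambda>j. X j t)"
    and L0: "\<And>t. 0 \<le> t \<Longrightarrow> L 0 t = 0"
    and L': "\<And>j. 1 \<le> j \<Longrightarrow> mono_on {0..} (L j)" "\<And>j. 1 \<le> j \<Longrightarrow> L j 0 = 0"
    and int: "\<And>j. 1 \<le> j \<Longrightarrow> (\<integral>\<^sup>+t\<in>{0..}. ennreal (X (Suc j) t - X j t) \<partial>interval_measure (\<lambda>t. L j (max 0 t))) = 0"
    using sol unfolding competing_brownian_path_def Let_def by blast+
  define Z where "Z = (\<lambda>j t. disc_sum r (\<lambda>i. X i t) j)"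
  define W where "W = (\<lambda>j t. disc_sum r (\<lambda>i. g i * t + B i t) j)"
  define n where "n = disc_sum r x"
  have Zeq: "Z j t = n j + W j t - (1 - p) * L j t" if t: "0 \<le> t" for j t
  proof (induction j)
    case (Suc j)
    have "(1 - p) * (r * c) = p * c" for c using qr by (metis mult.assoc)
    then have *: "r * ((1 - p) * c) = p * c" for c by (simp add: mult.left_commute)
    have "Z (Suc j) t = X (Suc j) t + r * (n j + W j t - (1 - p) * L j t)" using Suc by (simp add: Z_def)
    also have "\<dots> = X (Suc j) t + r * n j + r * W j t - p * L j t" by (simp add: right_diff_distrib distrib_left *)
    also have "\<dots> = n (Suc j) + W (Suc j) t - (1 - p) * L (Suc j) t" using eq[OF t, of "Suc j"] by (simp add: n_def W_def)
    finally show ?case .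
  qed (simp add: Z_def n_def W_def L0 t)
  have Lnn: "0 \<le> L j t" "s \<le> t \<Longrightarrow> L j s \<le> L j t" if "0 \<le> t" "0 \<le> s" for j s t
  proof -
    show "s \<le> t \<Longrightarrow> L j s \<le> L j t"
      using L'(1)[of j] L0 that by (cases "j = 0") (auto simp: mono_on_def)
    have "L j 0 \<le> L j t" using L'(1)[of j] L0 that by (cases "j = 0") (auto simp: mono_on_def)
    then show "0 \<le> L j t" using L'(2)[of j] L0 by (cases "j = 0") (auto simp: that)
  qed
  have avg: "step_avg p (\<lambda>i. Z i t) j - Z j t = (1 - p) * (X (Suc j) t - X j t)" if "1 \<le> j" for j t
    using step_avg_disc_sum[OF p that, of "\<lambda>i. X i t"] by (simp add: Z_def r)
  have Xmono: "X j t \<le> X (Suc j) t" if "0 \<le> t" "1 \<le> j" for j t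
    using mono[OF that(1)] that by (auto simp: mono_on_def)
  have "obstacle_solution p n W Z"
    unfolding obstacle_solution_def
  proof (intro conjI allI impI)
    fix t :: real assume t: "0 \<le> t"
    show "Z 0 t = 0" by (simp add: Z_def)
    fix j
    show "Z j t \<le> n j + W j t" using Zeq[OF t, of j] Lnn(1)[OF t t, of j] p by simp
    assume j: "1 \<le> j"
    have "0 \<le> (1 - p) * (X (Suc j) t - X j t)" using Xmono[OF t j] p by simp
    then show "Z j t \<le> step_avg p (\<lambda>i. Z i t) j" using avg[OF j, of t] by linarith
    show "Z j t = n j + W j t \<or>
        (\<exists>s\<ge>0. s \<le> t \<and> Z j t = W j t - W j s + step_avg p (\<lambda>i. Z i s) j)"
    proof (cases "L j t = 0")
      case True
      then show ?thesis using Zeq[OF t, of j] by simp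
    next
      case False
      have "continuous_on {0..} (\<lambda>t. X (Suc j) t - X j t)" using X j by (intro continuous_intros) auto
      then obtain s where s: "0 \<le> s" "s \<le> t" "X (Suc j) s - X j s = 0" "L j s = L j t"
        using last_contact[of "\<lambda>t. X (Suc j) t - X j t" "L j" t] L[of j] L'[OF j] int[OF j] False t Xmono j
        by auto
      then have "Z j t = W j t - W j s + step_avg p (\<lambda>i. Z i s) j"
        using avg[OF j, of s] Zeq[OF t, of j] Zeq[OF s(1), of j] by simp
      then show ?thesis using s by blast
    qed
  next
    fix j and s t :: real assume st: "0 \<le> s" "s \<le> t"
    have "(1 - p) * L j s \<le> (1 - p) * L j t" using Lnn(2)[of t s j] st p by (intro mult_left_mono) auto
    then show "Z j t - Z j s \<le> W j t - W j s" using Zeq[of s j] Zeq[of t j] st by simp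
  qed
  then show ?thesis by (simp add: Z_def W_def n_def)
qed

section \<open>Growth forced by later times\<close>

text \<open>The better of two ways to go back over a time block in which the motions have increments \<open>D\<close>: run along
level \<open>j\<close> and then average over the neighbours, or average first and then run along the neighbours.
The two costs differ by \<open>q (D\<^sub>j - D\<^sub>j\<^sub>+\<^sub>1)\<close>, so the minimum has negative mean although the increments are
centred.\<close>

definition block_gain :: "real \<Rightarrow> (nat \<Rightarrow> real) \<Rightarrow> nat \<Rightarrow> real" where
  "block_gain p D j = (if j = 0 then 0
     else disc_sum (p / (1 - p)) D j - (1 - p) * max 0 (D j - D (Suc j)))"

text \<open>The cost of \<open>n\<close> successive blocks, numbered forwards in time, for the walk that starts at level \<open>1\<close> at
the end of the last block.\<close>

definition total_gain :: "real \<Rightarrow> nat \<Rightarrow> (nat \<Rightarrow> nat \<Rightarrow> real) \<Rightarrow> real" where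
  "total_gain p n D = (\<Sum>c<n. (step_avg p ^^ (n - Suc c)) (block_gain p (D c)) 1)"

text \<open>Both ways over a block are admissible because \<open>Z - W\<close> decreases in time and \<open>Z\<close> lies below its neighbour
average at every time.\<close>

lemma obstacle_block_iteration:
  assumes p: "0 \<le> p" "p < 1/2" and Z: "obstacle_solution p n (\<lambda>j t. disc_sum (p / (1 - p)) (\<lambda>i. \<beta> i t) j) Z"
    and T: "0 \<le> T" "0 \<le> h"
  shows "Z j (T + real N * h) \<le> (step_avg p ^^ N) (\<lambda>i. Z i T) j
    + (\<Sum>c<N. (step_avg p ^^ (N - Suc c)) (block_gain p (\<lambda>i. \<beta> i (T + real (Suc c) * h) - \<beta> i (T + real c * h))) j)"
proof (induction N arbitrary: j)
  case (Suc N)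
  let ?r = "p / (1 - p)"
  define t where "t = T + real N * h"
  define t' where "t' = T + real (Suc N) * h"
  have t: "0 \<le> t" "t \<le> t'" using T by (auto simp: t_def t'_def algebra_simps)
  define D where "D = (\<lambda>i. \<beta> i t' - \<beta> i t)"
  let ?g = "\<lambda>c. block_gain p (\<lambda>i. \<beta> i (T + real (Suc c) * h) - \<beta> i (T + real c * h))"
  have one: "Z j t' \<le> step_avg p (\<lambda>i. Z i t) j + block_gain p D j"
  proof (cases "j = 0")
    case True
    then show ?thesis using Z t by (simp add: obstacle_solution_def step_avg_def block_gain_def)
  next
    case False
    then have j: "1 \<le> j" by simp
    have move: "Z i t' \<le> Z i t + disc_sum ?r D i" for i
    proof -
      have "Z i t' - Z i t \<le> disc_sum ?r (\<lambda>i. \<beta> i t') i - disc_sum ?r (\<lambda>i. \<beta> i t) i"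
        using Z t unfolding obstacle_solution_def by blast
      then show ?thesis by (simp add: D_def disc_sum_diff)
    qed
    have "Z j t \<le> step_avg p (\<lambda>i. Z i t) j" using Z t j unfolding obstacle_solution_def by blast
    then have 1: "Z j t' \<le> step_avg p (\<lambda>i. Z i t) j + disc_sum ?r D j" using move[of j] by linarith
    have "Z j t' \<le> step_avg p (\<lambda>i. Z i t') j" using Z t j unfolding obstacle_solution_def by (meson order_trans)
    also have "\<dots> \<le> step_avg p (\<lambda>i. Z i t + disc_sum ?r D i) j" using p by (intro step_avg_mono move) auto
    also have "\<dots> = step_avg p (\<lambda>i. Z i t) j + (disc_sum ?r D j - (1 - p) * (D j - D (Suc j)))"
      using step_avg_disc_sum[OF p j, of D] by (simp add: step_avg_add algebra_simps)
    finally have 2: "Z j t' \<le> step_avg p (\<lambda>i. Z i t) j + (disc_sum ?r D j - (1 - p) * (D j - D (Suc j)))" .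
    have gain: "block_gain p D j = disc_sum ?r D j - (1 - p) * max 0 (D j - D (Suc j))"
      using False by (simp add: block_gain_def)
    show ?thesis
    proof (cases "D j - D (Suc j) \<le> 0")
      case True
      then have "max 0 (D j - D (Suc j)) = 0" by linarith
      then show ?thesis using 1 gain by simp
    next
      case False
      then have "max 0 (D j - D (Suc j)) = D j - D (Suc j)" by linarith
      then show ?thesis using 2 gain by simp
    qed
  qed
  have "step_avg p (\<lambda>i. Z i t) j \<le> step_avg p (\<lambda>j. (step_avg p ^^ N) (\<lambda>i. Z i T) j
      + (\<Sum>c<N. (step_avg p ^^ (N - Suc c)) (?g c) j)) j"
    using Suc p unfolding t_def by (intro step_avg_mono) auto
  also have "\<dots> = (step_avg p ^^ Suc N) (\<lambda>i. Z i T) j + (\<Sum>c<N. (step_avg p ^^ (Suc N - Suc c)) (?g c) j)"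
  proof -
    have "step_avg p ((step_avg p ^^ (N - Suc c)) f) j = (step_avg p ^^ (Suc N - Suc c)) f j" if "c < N" for c f
    proof -
      have "Suc N - Suc c = Suc (N - Suc c)" using that by simp
      then show ?thesis by (simp only: funpow.simps comp_apply)
    qed
    then have "(\<Sum>c<N. step_avg p ((step_avg p ^^ (N - Suc c)) (?g c)) j) = (\<Sum>c<N. (step_avg p ^^ (Suc N - Suc c)) (?g c) j)"
      by (intro sum.cong) auto
    then show ?thesis by (simp only: step_avg_add step_avg_sum funpow.simps comp_apply)
  qed
  finally have "Z j t' \<le> (step_avg p ^^ Suc N) (\<lambda>i. Z i T) j
      + ((\<Sum>c<N. (step_avg p ^^ (Suc N - Suc c)) (?g c) j) + block_gain p D j)"
    using one by linarith
  also have "block_gain p D j = (step_avg p ^^ (Suc N - Suc N)) (?g N) j"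
    by (simp only: diff_self_eq_0 funpow.simps id_apply D_def t_def t'_def)
  finally show ?case unfolding t'_def by (simp only: sum.lessThan_Suc)
qed auto

text \<open>This allows the drifts to be removed: over a block of length \<open>h\<close> they change the increments by at most
\<open>G h\<close>, which adds up to a constant over all blocks.\<close>

lemma block_gain_shift:
  assumes p: "0 \<le> p" "p < 1/2" and D: "\<And>i. 1 \<le> i \<Longrightarrow> \<bar>D' i - D i\<bar> \<le> e" and e: "0 \<le> e"
  shows "block_gain p D' j \<le> block_gain p D j + (1 / (1 - p / (1 - p)) + 2) * e"
proof -
  define r where "r = p / (1 - p)"
  have r: "0 \<le> r" "r < 1" using p by (auto simp: r_def field_simps)
  have "\<bar>disc_sum r D' j - disc_sum r D j\<bar> \<le> disc_sum r (\<lambda>i. \<bar>D' i - D i\<bar>) j"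
    using disc_sum_abs[OF r(1), of "\<lambda>i. D' i - D i" j] by (simp add: disc_sum_diff)
  also have "\<dots> \<le> disc_sum r (\<lambda>_. e) j" using D r by (intro disc_sum_mono) auto
  also have "\<dots> \<le> e / (1 - r)" using r e by (intro disc_sum_const_le)
  finally have 1: "disc_sum r D' j \<le> disc_sum r D j + 1 / (1 - r) * e" by simp
  have 2: "(1 - p) * (max 0 (D j - D (Suc j)) - max 0 (D' j - D' (Suc j))) \<le> 1 * (2 * e)" if "1 \<le> j"
  proof -
    have "max 0 (D j - D (Suc j)) - max 0 (D' j - D' (Suc j)) \<le> 2 * e"
      using D[OF that] D[of "Suc j"] e unfolding max_def by (simp add: abs_le_iff)
    then have "(1 - p) * (max 0 (D j - D (Suc j)) - max 0 (D' j - D' (Suc j))) \<le> (1 - p) * (2 * e)"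
      using p by (intro mult_left_mono) auto
    also have "\<dots> \<le> 1 * (2 * e)" using p e by (intro mult_right_mono) auto
    finally show ?thesis .
  qed
  show ?thesis
  proof (cases "j = 0")
    case True
    have "0 \<le> (1 / (1 - r) + 2) * e" using r e by simp
    then show ?thesis using True by (simp add: block_gain_def r_def)
  next
    case False
    have 2: "(1 - p) * (max 0 (D j - D (Suc j)) - max 0 (D' j - D' (Suc j))) \<le> 2 * e" using 2 False by simp
    then show ?thesis using 1 False unfolding block_gain_def r_def[symmetric] right_diff_distrib distrib_right by simp
  qed
qed

lemma total_gain_shift:
  assumes p: "0 \<le> p" "p < 1/2" and D: "\<And>c i. c < N \<Longrightarrow> 1 \<le> i \<Longrightarrow> \<bar>D' c i - D c i\<bar> \<le> e" and e: "0 \<le> e"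
  shows "total_gain p N D' \<le> total_gain p N D + real N * ((1 / (1 - p / (1 - p)) + 2) * e)"
proof -
  let ?e = "(1 / (1 - p / (1 - p)) + 2) * e"
  have "0 \<le> 1 / (1 - p / (1 - p))" using p by (auto simp: field_simps)
  then have e': "0 \<le> ?e" using e by simp
  have "total_gain p N D' \<le> (\<Sum>c<N. (step_avg p ^^ (N - Suc c)) (block_gain p (D c)) 1 + ?e)"
    unfolding total_gain_def
  proof (rule sum_mono)
    fix c assume "c \<in> {..<N}"
    then have "(step_avg p ^^ (N - Suc c)) (block_gain p (D' c)) 1
        \<le> (step_avg p ^^ (N - Suc c)) (\<lambda>i. block_gain p (D c) i + ?e) 1"
      using p D e by (intro step_avg_pow_mono block_gain_shift) auto
    also have "\<dots> \<le> (step_avg p ^^ (N - Suc c)) (block_gain p (D c)) 1 + ?e"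
      using step_avg_pow_const_le[of p ?e "N - Suc c" 1] p e' by (simp add: step_avg_pow_add)
    finally show "(step_avg p ^^ (N - Suc c)) (block_gain p (D' c)) 1
        \<le> (step_avg p ^^ (N - Suc c)) (block_gain p (D c)) 1 + ?e" .
  qed
  then show ?thesis by (simp add: sum.distrib total_gain_def)
qed

definition block_increments :: "(nat \<Rightarrow> real \<Rightarrow> real) \<Rightarrow> nat \<Rightarrow> nat \<Rightarrow> nat \<Rightarrow> nat \<Rightarrow> nat \<Rightarrow> real" where
  "block_increments B T U N c i = B i (real T + real (Suc c) * (real U / real N)) - B i (real T + real c * (real U / real N))"

text \<open>
Powers of two suffice, as the solution is nearly increasing in the level, and they make the bounds on the
deviations summable.
\<close>

definition large_gain :: "real \<Rightarrow> real \<Rightarrow> (nat \<Rightarrow> real \<Rightarrow> real) \<Rightarrow> bool" where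
  "large_gain p a B \<longleftrightarrow> (\<forall>T U::nat. 0 < U \<longrightarrow> (\<exists>l0. \<forall>l\<ge>l0.
     total_gain p (2 ^ l) (block_increments B T U (2 ^ l)) \<le> - a * sqrt (2 ^ l * real U)))"

text \<open>Over \<open>N = 2\<^sup>l\<close> blocks of \<open>[T, T + U]\<close> the walk from level \<open>1\<close> rises at most to level \<open>N + 1\<close>, and \<open>Z\<close> is increasing in
the level up to a constant.  Hence \<open>Z\<^sub>1(T + U)\<close> is at most \<open>max 0 Z\<^sub>N\<^sub>+\<^sub>1(T)\<close> minus \<open>a \<surd>(N U)\<close> plus a constant, and
\<open>U\<close> is chosen such that \<open>a \<surd>U \<ge> 2 A\<close>.  The factor \<open>2\<close> covers levels between two powers of two.\<close>

lemma superdiffusive_growth_of_gain: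
  assumes p: "0 \<le> p" "p < 1/2"
    and Z: "obstacle_solution p n (\<lambda>j t. disc_sum (p / (1 - p)) (\<lambda>i. g i * t + B i t) j) (\<lambda>j t. disc_sum (p / (1 - p)) (\<lambda>i. X i t) j)"
    and X: "\<And>t. 0 \<le> t \<Longrightarrow> mono_on {1..} (\<lambda>j. X j t)"
    and g: "\<And>j. 1 \<le> j \<Longrightarrow> \<bar>g j\<bar> \<le> G"
    and a: "0 < a"
    and gain: "large_gain p a B"
  shows "superdiffusive_growth (\<lambda>j t. disc_sum (p / (1 - p)) (\<lambda>i. X i t) j)"
  unfolding superdiffusive_growth_def
proof (intro allI)
  fix T :: nat and A :: real
  define r where "r = p / (1 - p)"
  have r: "0 \<le> r" "r < 1" using p by (auto simp: r_def field_simps)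
  have G: "0 \<le> G" using g[of 1] by auto
  define Z where "Z = (\<lambda>j t. disc_sum r (\<lambda>i. X i t) j)"
  define \<kappa> where "\<kappa> = \<bar>X 1 (real T)\<bar> / (1 - r)"
  have \<kappa>: "0 \<le> \<kappa>" using r by (simp add: \<kappa>_def)
  have Zord: "Z j (real T) \<le> Z m (real T) + \<kappa>" if "j \<le> m" for j m
    unfolding Z_def \<kappa>_def using disc_sum_ordered[OF r X that, of "real T"] by simp
  \<comment> \<open>the length of the time interval determines the growth rate that is forced\<close>
  define U :: nat where "U = nat \<lceil>4 * (\<bar>A\<bar> / a)\<^sup>2\<rceil> + 1"
  have U: "0 < U" "2 * \<bar>A\<bar> \<le> a * sqrt U"
  proof -
    show "0 < U" by (simp add: U_def)
    have "2 * (\<bar>A\<bar> / a) \<le> sqrt U"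
    proof (rule real_le_rsqrt)
      have "4 * (\<bar>A\<bar> / a)\<^sup>2 \<le> real U" unfolding U_def by linarith
      then show "(2 * (\<bar>A\<bar> / a))\<^sup>2 \<le> real U" by (simp only: power_mult_distrib) simp
    qed
    then show "2 * \<bar>A\<bar> \<le> a * sqrt U" using a by (simp add: field_simps)
  qed
  obtain l0 where l0: "\<And>l. l0 \<le> l \<Longrightarrow> total_gain p (2 ^ l) (block_increments B T U (2 ^ l)) \<le> - a * sqrt (2 ^ l * real U)"
    using gain U(1) unfolding large_gain_def by blast
  define K where "K = (1 / (1 - p / (1 - p)) + 2) * (G * U)"
  define C where "C = \<kappa> + K + \<bar>Z 1 (real T + real U)\<bar>"
  have K: "0 \<le> K" unfolding K_def using r G by (auto simp: r_def intro!: mult_nonneg_nonneg add_nonneg_nonneg)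
  have dyadic: "a * sqrt (2 ^ l * real U) - C \<le> max 0 (Z (Suc (2 ^ l)) (real T))" if "l0 \<le> l" for l
  proof -
    define N :: nat where "N = 2 ^ l"
    have N: "0 < N" by (simp add: N_def)
    define h where "h = real U / real N"
    have h: "0 \<le> h" "real N * h = real U" using N by (auto simp: h_def)
    let ?D' = "block_increments (\<lambda>i t. g i * t + B i t) T U N"
    have "Z 1 (real T + real N * h) \<le> (step_avg p ^^ N) (\<lambda>i. Z i (real T)) 1 + total_gain p N ?D'"
      unfolding Z_def r_def total_gain_def block_increments_def h_def[symmetric]
      by (rule obstacle_block_iteration[OF p Z]) (use h in auto)
    moreover have "total_gain p N ?D' \<le> total_gain p N (block_increments B T U N) + real N * ((1 / (1 - p / (1 - p)) + 2) * (G * h))"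
    proof (rule total_gain_shift[OF p])
      fix c i :: nat assume "1 \<le> i"
      have "?D' c i - block_increments B T U N c i = g i * h"
        by (simp add: block_increments_def h_def[symmetric] algebra_simps)
      then show "\<bar>?D' c i - block_increments B T U N c i\<bar> \<le> G * h"
        using g[OF \<open>1 \<le> i\<close>] h by (simp add: abs_mult mult_right_mono)
    qed (use G h in auto)
    moreover have "real N * ((1 / (1 - p / (1 - p)) + 2) * (G * h)) = K"
    proof -
      have "real N * ((1 / (1 - p / (1 - p)) + 2) * (G * h)) = (1 / (1 - p / (1 - p)) + 2) * (G * (real N * h))"
        by (simp only: mult_ac)
      then show ?thesis by (simp only: h(2) K_def)
    qed
    moreover have "(step_avg p ^^ N) (\<lambda>i. Z i (real T)) 1 \<le> max 0 (Z (Suc N) (real T)) + \<kappa>"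
    proof -
      have "(step_avg p ^^ N) (\<lambda>i. Z i (real T)) 1 \<le> (step_avg p ^^ N) (\<lambda>_. max 0 (Z (Suc N) (real T)) + \<kappa>) 1"
        using p by (intro step_avg_pow_mono) (auto intro: order_trans[OF Zord])
      also have "\<dots> \<le> max 0 (Z (Suc N) (real T)) + \<kappa>" using p \<kappa> by (intro step_avg_pow_const_le) auto
      finally show ?thesis .
    qed
    ultimately show ?thesis using l0[OF that] h(2) by (simp add: C_def N_def)
  qed
  have large: "A * sqrt (real m) - (C + \<kappa> + \<bar>A\<bar>) \<le> Z m (real T)" if m: "2 ^ l0 < m" and nn: "C < A * sqrt (real m)" for m
  proof -
    obtain l where l: "2 ^ l \<le> m - 1" "m - 1 < 2 ^ (l + 1)"
    proof -
      have "(1::nat) \<le> 2 ^ l0" by simp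
      then have "1 \<le> m - 1" using m by linarith
      then show ?thesis using ex_power_ivl1[of 2 "m - 1"] that by auto
    qed
    have "(2::nat) ^ l0 < 2 ^ (l + 1)" using m l by linarith
    then have "l0 < l + 1" by (rule power_less_imp_less_exp[rotated]) simp
    then have ll: "l0 \<le> l" by simp
    have "2 ^ l < m" using l m by linarith
    have m2: "real m \<le> 2 * 2 ^ l"
    proof -
      have "m \<le> 2 * 2 ^ l" using l by simp
      then have "real m \<le> real (2 * 2 ^ l)" by (rule of_nat_mono)
      then show ?thesis by simp
    qed
    have "A * sqrt (real m) \<le> \<bar>A\<bar> * (2 * sqrt (2 ^ l))"
    proof -
      have "sqrt (real m) \<le> sqrt (4 * 2 ^ l)" using m2 by simp
      also have "\<dots> = 2 * sqrt (2 ^ l)" by (simp add: real_sqrt_mult)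
      finally show ?thesis by (intro mult_mono) auto
    qed
    also have "\<dots> = (2 * \<bar>A\<bar>) * sqrt (2 ^ l)" by simp
    also have "\<dots> \<le> a * sqrt U * sqrt (2 ^ l)" using U(2) by (rule mult_right_mono) simp
    also have "\<dots> = a * sqrt (2 ^ l * real U)" by (simp add: real_sqrt_mult mult_ac)
    finally have 1: "A * sqrt (real m) \<le> a * sqrt (2 ^ l * real U)" .
    have "0 < A * sqrt (real m) - C" using nn by simp
    then have "A * sqrt (real m) - C \<le> Z (Suc (2 ^ l)) (real T)" using dyadic[OF ll] 1 by linarith
    also have "\<dots> \<le> Z m (real T) + \<kappa>" using \<open>2 ^ l < m\<close> by (intro Zord) auto
    finally show ?thesis by simp
  qed
  have Zlow: "- \<kappa> \<le> Z m (real T)" for m using Zord[of 0 m] by (simp add: Z_def)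
  have "A * sqrt (real m) - (C + \<kappa> + \<bar>A\<bar> + \<bar>A\<bar> * sqrt (2 ^ l0)) \<le> Z m (real T)" for m
  proof -
    have C: "0 \<le> C" using \<kappa> K by (simp add: C_def)
    have A: "0 \<le> \<bar>A\<bar>" "0 \<le> \<bar>A\<bar> * sqrt (2 ^ l0)" by simp_all
    consider "2 ^ l0 < m" "C < A * sqrt (real m)" | "A * sqrt (real m) \<le> C" | "m \<le> 2 ^ l0" by linarith
    then show ?thesis
    proof cases
      case 1
      then show ?thesis using large[of m] A by linarith
    next
      case 2
      then show ?thesis using Zlow[of m] A by linarith
    next
      case 3
      then have "real m \<le> real (2 ^ l0)" by (rule of_nat_mono)
      then have "real m \<le> 2 ^ l0" by simp
      then have "A * sqrt (real m) \<le> \<bar>A\<bar> * sqrt (2 ^ l0)" by (intro mult_mono) auto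
      then show ?thesis using Zlow[of m] C A by linarith
    qed
  qed
  then show "\<exists>C. \<forall>m. A * sqrt (real m) - C \<le> disc_sum (p / (1 - p)) (\<lambda>i. X i (real T)) m"
    unfolding Z_def r_def by blast
qed

section \<open>Variation of a Brownian path inside a time cell\<close>

lemma abs_le_Young: "0 < (a::real) \<Longrightarrow> x\<^sup>2 \<le> 4 * a * b \<Longrightarrow> \<bar>x\<bar> \<le> a + b"
proof -
  assume a: "0 < a" and x: "x\<^sup>2 \<le> 4 * a * b"
  have b: "0 \<le> b"
  proof -
    have "0 \<le> 4 * a * b" using x zero_le_power2[of x] by linarith
    then show ?thesis using a by (simp add: zero_le_mult_iff)
  qed
  have "4 * a * b \<le> (a + b)\<^sup>2" using zero_le_power2[of "a - b"] by (simp add: power2_eq_square algebra_simps)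
  then have "x\<^sup>2 \<le> (a + b)\<^sup>2" using x by linarith
  then show "\<bar>x\<bar> \<le> a + b" using a b by (simp add: abs_le_square_iff[symmetric])
qed

lemma geometric_sums:
  "(\<Sum>k<K. (2/3::real) ^ k) \<le> 3" "(\<Sum>k<K. (3/4::real) ^ k * (g + 2 * real k)) \<le> 4 * g + 24" if "0 \<le> g"
proof -
  have "(\<Sum>k<K. (2/3::real) ^ k) = 3 - 3 * (2/3) ^ K" by (induction K) auto
  then show "(\<Sum>k<K. (2/3::real) ^ k) \<le> 3" by simp
  have "(\<Sum>k<K. (3/4::real) ^ k * (g + 2 * real k)) = 4 * g + 24 - (3/4) ^ K * (4 * g + 24 + 8 * real K)"
  proof (induction K)
    case (Suc K)
    define w where "w = (3/4::real) ^ K"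
    have "w * (g + 2 * real K) - w * (4 * g + 24 + 8 * real K) = - (3/4 * w * (4 * g + 24 + 8 * real (Suc K)))"
      by (simp add: algebra_simps)
    then show ?case using Suc unfolding sum.lessThan_Suc power_Suc w_def[symmetric] by linarith
  qed simp
  then show "(\<Sum>k<K. (3/4::real) ^ k * (g + 2 * real k)) \<le> 4 * g + 24" using that by simp
qed

text \<open>Chaining on one cell.  If \<open>t - s\<close> is of the order of \<open>h / 2\<^sup>m\<close>, the increments at scale \<open>m + k\<close> are split by Young's
inequality into \<open>(2/3)\<^sup>k\<close> and \<open>(3/4)\<^sup>k (g + 2 m + 2 k) / 2\<^sup>m\<close>, both summable in \<open>k\<close>.  The bound is weaker than a
modulus of continuity for short times, but its second term is additive in \<open>t - s\<close>.  So a path which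
visits the same level in the same cell many times pays a constant for each visit and the random
part \<open>g\<close> only once.\<close>

lemma modulus_from_dyadic:
  fixes f :: "real \<Rightarrow> real"
  assumes h: "0 < h" and g: "0 \<le> g" and f: "continuous_on {a..a+h} f"
    and dy: "\<And>l i. i < 2 ^ l \<Longrightarrow> (f (a + real (Suc i) * h / 2 ^ l) - f (a + real i * h / 2 ^ l))\<^sup>2 \<le> 4 * h / 2 ^ l * (g + 2 * real l)"
    and st: "a \<le> s" "s \<le> t" "t \<le> a + h"
  shows "\<bar>f t - f s\<bar> \<le> 105 * sqrt h * (1 + g * ((t - s) / h))"
proof (cases "s = t")
  case True
  then show ?thesis using h by simp
next
  case False
  define u where "u = (t - s) / h"
  have u: "0 < u" "u \<le> 1" using False st h by (auto simp: u_def field_simps)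
  \<comment> \<open>at scale \<open>m\<close> the times \<open>s\<close> and \<open>t\<close> lie in the same or in adjacent dyadic intervals\<close>
  have "\<exists>m::nat. 1 / 2 ^ Suc m < u \<and> u \<le> 1 / 2 ^ m"
  proof -
    obtain k where k: "(1/2::real) ^ k < u" using real_arch_pow_inv[OF u(1), of "1/2"] by auto
    define m where "m = (LEAST k. (1/2::real) ^ k < u)"
    have m: "(1/2::real) ^ m < u" unfolding m_def by (rule LeastI[of _ k]) (rule k)
    have "m \<noteq> 0" using m u by (cases m) auto
    then obtain m' where m': "m = Suc m'" by (cases m) auto
    have "\<not> (1/2::real) ^ m' < u" using not_less_Least[of m' "\<lambda>k. (1/2::real) ^ k < u"] m' by (simp add: m_def[symmetric])
    then show ?thesis using m m' by (intro exI[of _ m']) (auto simp: power_one_over)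
  qed
  then obtain m where m: "1 / 2 ^ Suc m < u" "u \<le> 1 / 2 ^ m" by blast
  define P where "P = (\<lambda>l i. a + real i * h / 2 ^ l)"
  define R where "R = 35 + 8 * (u * g)"
  define M where "M = (\<lambda>k. sqrt h * ((2/3) ^ k + (3/4) ^ k * (g + 2 * real m + 2 * real k) / 2 ^ m))"
  have R: "(\<Sum>k<K. M k) \<le> sqrt h * R" for K
  proof -
    have g': "0 \<le> g + 2 * real m" using g by simp
    have m2: "real m / 2 ^ m \<le> 1" using of_nat_less_two_power[of m, where 'a=real] by (simp add: field_simps)
    have m3: "1 / 2 ^ m \<le> (1::real)" by simp
    have gm: "g / 2 ^ m \<le> 2 * (u * g)" using mult_right_mono[OF less_imp_le[OF m(1)] g] by (simp add: field_simps)
    have "(\<Sum>k<K. M k) = sqrt h * ((\<Sum>k<K. (2/3) ^ k) + (\<Sum>k<K. (3/4) ^ k * (g + 2 * real m + 2 * real k)) / 2 ^ m)"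
      by (simp only: M_def sum_distrib_left[symmetric] sum.distrib sum_divide_distrib[symmetric])
    also have "\<dots> \<le> sqrt h * (3 + (4 * (g + 2 * real m) + 24) / 2 ^ m)"
      using geometric_sums[OF g', of K] h by (intro mult_left_mono add_mono divide_right_mono) auto
    also have "(4 * (g + 2 * real m) + 24) / 2 ^ m = 4 * (g / 2 ^ m) + 8 * (real m / 2 ^ m) + 24 * (1 / 2 ^ m)"
      by (simp add: add_divide_distrib)
    also have "sqrt h * (3 + \<dots>) \<le> sqrt h * R" using gm m2 m3 h unfolding R_def by (intro mult_left_mono) (linarith, simp)
    finally show ?thesis .
  qed
  have M0: "0 \<le> M k" for k using g h by (auto simp: M_def)
  have step: "\<bar>f (P (m + k) (Suc i)) - f (P (m + k) i)\<bar> \<le> M k" if "i < 2 ^ (m + k)" for k i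
  proof -
    have "\<bar>f (P (m + k) (Suc i)) - f (P (m + k) i)\<bar> \<le> sqrt h * (2/3) ^ k + sqrt h * ((3/4) ^ k * (g + 2 * real m + 2 * real k) / 2 ^ m)"
    proof (rule abs_le_Young)
      show "0 < sqrt h * (2/3) ^ k" using h by simp
      have "4 * h / 2 ^ (m + k) * (g + 2 * real (m + k)) = 4 * (sqrt h * (2/3) ^ k) * (sqrt h * ((3/4) ^ k * (g + 2 * real m + 2 * real k) / 2 ^ m))"
      proof -
        have "(2/3::real) ^ k * (3/4) ^ k = 1 / 2 ^ k" by (simp add: power_mult_distrib[symmetric] power_one_over)
        moreover have "4 * (x * \<alpha>) * (x * (\<beta> * G / M)) = 4 * (x * x) * (\<alpha> * \<beta>) * (G / M)" for x \<alpha> \<beta> G M :: real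
          by simp
        ultimately have E: "4 * (sqrt h * (2/3) ^ k) * (sqrt h * ((3/4) ^ k * G / 2 ^ m))
          = 4 * (sqrt h * sqrt h) * (1 / 2 ^ k) * (G / 2 ^ m)" for G
          by metis
        show ?thesis unfolding E using h by (simp add: power_add add.assoc mult.commute)
      qed
      then show "(f (P (m + k) (Suc i)) - f (P (m + k) i))\<^sup>2 \<le> 4 * (sqrt h * (2/3) ^ k) * (sqrt h * ((3/4) ^ k * (g + 2 * real m + 2 * real k) / 2 ^ m))"
        using dy[OF that] by (simp only: P_def)
    qed
    then show ?thesis by (simp add: M_def distrib_left)
  qed
  \<comment> \<open>the left end of the dyadic interval of scale \<open>l\<close> that contains \<open>w\<close>\<close>
  define idx where "idx = (\<lambda>l w. nat \<lfloor>2 ^ l * ((w - a) / h)\<rfloor>)"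
  have approx: "\<bar>f w - f (P m (idx m w))\<bar> \<le> sqrt h * R" if w: "a \<le> w" "w \<le> a + h" for w
  proof -
    define \<tau> where "\<tau> = (w - a) / h"
    have \<tau>: "0 \<le> \<tau>" "\<tau> \<le> 1" "w = a + \<tau> * h" using w h by (auto simp: \<tau>_def field_simps)
    have idx: "real (idx l w) \<le> 2 ^ l * \<tau>" "2 ^ l * \<tau> < real (idx l w) + 1" for l
    proof -
      have "0 \<le> 2 ^ l * \<tau>" using \<tau>(1) by simp
      then show "real (idx l w) \<le> 2 ^ l * \<tau>" "2 ^ l * \<tau> < real (idx l w) + 1"
        unfolding idx_def \<tau>_def[symmetric] by linarith+
    qed
    have idx1: "real (idx l w) \<le> 2 ^ l" for l
      using idx(1)[of l] mult_left_le[OF \<tau>(2), of "2 ^ l"] by (rule order_trans) simp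
    have nxt: "\<bar>f (P (m + Suc k) (idx (m + Suc k) w)) - f (P (m + k) (idx (m + k) w))\<bar> \<le> M (Suc k)" for k
    proof -
      let ?l = "m + k"
      have eq: "P ?l (idx ?l w) = P (Suc ?l) (2 * idx ?l w)" by (simp add: P_def)
      have "real (2 * idx ?l w) < real (idx (Suc ?l) w) + 1" "real (idx (Suc ?l) w) < real (2 * idx ?l w) + 2"
        using idx[of ?l] idx[of "Suc ?l"] by auto
      then have "2 * idx ?l w < idx (Suc ?l) w + 1" "idx (Suc ?l) w < 2 * idx ?l w + 2" by linarith+
      then consider "idx (Suc ?l) w = 2 * idx ?l w" | "idx (Suc ?l) w = Suc (2 * idx ?l w)" by linarith
      then show ?thesis
      proof cases
        case 1
        then show ?thesis using eq M0 by simp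
      next
        case 2
        have "real (idx (Suc ?l) w) \<le> 2 ^ Suc ?l" by (rule idx1)
        then have "real (Suc (2 * idx ?l w)) \<le> real (2 ^ Suc ?l)" using 2 by simp
        then have "2 * idx ?l w < 2 ^ (m + Suc k)" unfolding of_nat_le_iff by simp
        from step[OF this] show ?thesis using 2 eq by simp
      qed
    qed
    have sum: "\<bar>f (P (m + K) (idx (m + K) w)) - f (P m (idx m w))\<bar> \<le> (\<Sum>k<K. M (Suc k))" for K
    proof (induction K)
      case (Suc K)
      then show ?case using nxt[of K] by simp
    qed simp
    have bd: "\<bar>f (P (m + K) (idx (m + K) w)) - f (P m (idx m w))\<bar> \<le> sqrt h * R" for K
    proof -
      have "(\<Sum>k<K. M (Suc k)) \<le> (\<Sum>k<Suc K. M k)" using M0[of 0] unfolding sum.lessThan_Suc_shift by simp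
      then show ?thesis using sum[of K] R[of "Suc K"] by linarith
    qed
    have conv: "(\<lambda>K. P (m + K) (idx (m + K) w)) \<longlonglongrightarrow> w"
    proof -
      have "\<bar>P (m + K) (idx (m + K) w) - w\<bar> \<le> h * (1/2) ^ K" for K
      proof -
        have "P (m + K) (idx (m + K) w) - w = (real (idx (m + K) w) - 2 ^ (m + K) * \<tau>) / 2 ^ (m + K) * h"
        proof -
          have alg: "a + x * h / D - (a + \<tau> * h) = (x - D * \<tau>) / D * h" if "0 < D" for x D :: real
            using that by (simp add: field_simps)
          have "P (m + K) (idx (m + K) w) - w = a + real (idx (m + K) w) * h / 2 ^ (m + K) - (a + \<tau> * h)"
            by (simp only: P_def \<tau>(3)[symmetric])
          also have "\<dots> = (real (idx (m + K) w) - 2 ^ (m + K) * \<tau>) / 2 ^ (m + K) * h"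
            by (rule alg) simp
          finally show ?thesis .
        qed
        also have "\<bar>\<dots>\<bar> = \<bar>real (idx (m + K) w) - 2 ^ (m + K) * \<tau>\<bar> / 2 ^ (m + K) * h"
          using h by (simp add: abs_mult)
        also have "\<dots> \<le> 1 / 2 ^ (m + K) * h"
          using idx[of "m + K"] h by (intro mult_right_mono divide_right_mono) auto
        also have "\<dots> \<le> 1 / 2 ^ K * h"
          using h by (intro mult_right_mono divide_left_mono power_increasing) auto
        finally show ?thesis by (simp only: power_one_over mult.commute[of h])
      qed
      then have "\<forall>\<^sub>F K in sequentially. norm (P (m + K) (idx (m + K) w) - w) \<le> h * (1/2) ^ K"
        by (simp only: real_norm_def eventually_True)
      moreover have "(\<lambda>K. h * (1/2) ^ K) \<longlonglongrightarrow> 0"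
        by (rule tendsto_mult_right_zero) (rule LIMSEQ_power_zero, simp)
      ultimately have "(\<lambda>K. P (m + K) (idx (m + K) w) - w) \<longlonglongrightarrow> 0"
        by (rule Lim_null_comparison)
      then show ?thesis by (rule LIM_zero_cancel)
    qed
    have inI: "P (m + K) (idx (m + K) w) \<in> {a..a+h}" for K
    proof -
      have "real (idx (m + K) w) \<le> 2 ^ (m + K)" by (rule idx1)
      then have "real (idx (m + K) w) / 2 ^ (m + K) \<le> 1" by simp
      then have "real (idx (m + K) w) / 2 ^ (m + K) * h \<le> 1 * h" using h by (intro mult_right_mono) auto
      then show ?thesis using h by (simp add: P_def)
    qed
    have "(\<lambda>K. f (P (m + K) (idx (m + K) w))) \<longlonglongrightarrow> f w"
      using f conv inI w by (auto intro!: continuous_on_tendsto_compose[OF f conv])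
    then have "(\<lambda>K. \<bar>f (P (m + K) (idx (m + K) w)) - f (P m (idx m w))\<bar>) \<longlonglongrightarrow> \<bar>f w - f (P m (idx m w))\<bar>"
      by (intro tendsto_intros)
    then show ?thesis by (rule LIMSEQ_le_const2) (use bd in blast)
  qed
  have coarse: "\<bar>f (P m (idx m t)) - f (P m (idx m s))\<bar> \<le> sqrt h * R"
  proof -
    have ts: "(t - a) / h = (s - a) / h + u" by (simp add: u_def diff_divide_distrib)
    have "2 ^ m * ((s - a) / h) \<le> 2 ^ m * ((t - a) / h)" "2 ^ m * ((t - a) / h) \<le> 2 ^ m * ((s - a) / h) + 1"
      using m(2) u by (auto simp: ts distrib_left field_simps)
    then have "\<lfloor>2 ^ m * ((s - a) / h)\<rfloor> \<le> \<lfloor>2 ^ m * ((t - a) / h)\<rfloor>" "\<lfloor>2 ^ m * ((t - a) / h)\<rfloor> \<le> \<lfloor>2 ^ m * ((s - a) / h)\<rfloor> + 1"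
      by (auto intro: floor_mono) linarith
    moreover have "0 \<le> \<lfloor>2 ^ m * ((s - a) / h)\<rfloor>" using st h by simp
    ultimately consider "idx m t = idx m s" | "idx m t = Suc (idx m s)"
      unfolding idx_def by linarith
    then show ?thesis
    proof cases
      case 1
      then show ?thesis using R[of 0] by simp
    next
      case 2
      have "real (idx m t) \<le> 2 ^ m * ((t - a) / h)" using st h by (simp add: idx_def)
      also have "\<dots> \<le> 2 ^ m * 1" using st h by (intro mult_left_mono) (auto simp: field_simps)
      finally have "real (Suc (idx m s)) \<le> real (2 ^ m)" using 2 by simp
      then have "idx m s < 2 ^ (m + 0)" unfolding of_nat_le_iff by simp
      from step[OF this] show ?thesis using 2 R[of 1] by simp
    qed
  qed
  have "\<bar>f t - f s\<bar> \<le> 3 * (sqrt h * R)"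
    using approx[of s] approx[of t] coarse st by linarith
  also have "\<dots> \<le> 105 * sqrt h * (1 + g * u)"
  proof -
    have "3 * R \<le> 105 * (1 + g * u)" using u g by (simp add: R_def algebra_simps)
    then have "sqrt h * (3 * R) \<le> sqrt h * (105 * (1 + g * u))" using h by (intro mult_left_mono) auto
    then show ?thesis by (simp add: mult_ac)
  qed
  finally show ?thesis by (simp add: u_def)
qed

abbreviation exp_square :: "real \<Rightarrow> real \<Rightarrow> ennreal" where
  "exp_square D \<delta> \<equiv> ennreal (exp (D\<^sup>2 / (4 * \<delta>)))"

text \<open>For Brownian motion each summand \<open>exp (D\<^sup>2 / (4 \<delta>))\<close> has mean \<open>\<surd>2\<close>; the weights \<open>4\<^sup>-\<^sup>l\<close> make the sum over the \<open>2\<^sup>l\<close>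
increments of scale \<open>l\<close> summable in \<open>l\<close>.\<close>

definition dyadic_energy :: "real \<Rightarrow> real \<Rightarrow> (real \<Rightarrow> real) \<Rightarrow> ennreal" where
  "dyadic_energy a h f = (\<Sum>l. ennreal (1 / 4 ^ l) *
     (\<Sum>i<2 ^ l. exp_square (f (a + real (Suc i) * h / 2 ^ l) - f (a + real i * h / 2 ^ l)) (h / 2 ^ l)))"

lemma dyadic_energy_shift: "dyadic_energy a h f = dyadic_energy 0 h (\<lambda>s. f (a + s) - f a)"
  by (simp add: dyadic_energy_def)

lemma dyadic_energy_term:
  assumes "i < 2 ^ l"
  shows "ennreal (1 / 4 ^ l) * exp_square (f (a + real (Suc i) * h / 2 ^ l) - f (a + real i * h / 2 ^ l)) (h / 2 ^ l)
    \<le> dyadic_energy a h f"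
proof -
  let ?e = "\<lambda>l i. exp_square (f (a + real (Suc i) * h / 2 ^ l) - f (a + real i * h / 2 ^ l)) (h / 2 ^ l)"
  have "?e l i \<le> (\<Sum>i<2 ^ l. ?e l i)" using assms by (intro member_le_sum) auto
  then have "ennreal (1 / 4 ^ l) * ?e l i \<le> ennreal (1 / 4 ^ l) * (\<Sum>i<2 ^ l. ?e l i)"
    by (rule mult_left_mono) simp
  also have "\<dots> = (\<Sum>l\<in>{l}. ennreal (1 / 4 ^ l) * (\<Sum>i<2 ^ l. ?e l i))" by simp
  also have "\<dots> \<le> dyadic_energy a h f"
    unfolding dyadic_energy_def by (rule sum_le_suminf) auto
  finally show ?thesis .
qed

lemma dyadic_energy_ge_1: "0 < h \<Longrightarrow> 1 \<le> dyadic_energy a h f"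
proof -
  assume h: "0 < h"
  have "ennreal 1 \<le> ennreal (exp ((f (a + h) - f a)\<^sup>2 / (4 * h)))"
    using h by (intro ennreal_leI) simp
  then show ?thesis using order_trans[OF _ dyadic_energy_term[of 0 0 f a h]] by simp
qed

text \<open>A single summand of the energy bounds each dyadic increment; the weight \<open>4\<^sup>-\<^sup>l\<close> costs at most \<open>2 l\<close> in the exponent.\<close>

lemma dyadic_energy_modulus:
  assumes h: "0 < h" and f: "continuous_on {a..a+h} f" and g: "dyadic_energy a h f = ennreal (exp g)" "0 \<le> g"
    and st: "a \<le> s" "s \<le> t" "t \<le> a + h"
  shows "\<bar>f t - f s\<bar> \<le> 105 * sqrt h * (1 + g * ((t - s) / h))"
proof (rule modulus_from_dyadic[OF h g(2) f _ st])
  fix l i :: nat assume i: "i < 2 ^ l"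
  let ?x = "f (a + real (Suc i) * h / 2 ^ l) - f (a + real i * h / 2 ^ l)"
  let ?d = "h / 2 ^ l"
  have d: "0 < ?d" using h by simp
  have "ennreal (1 / 4 ^ l * exp (?x\<^sup>2 / (4 * ?d))) \<le> ennreal (exp g)"
    using dyadic_energy_term[OF i, of f a h] g(1) by (simp add: ennreal_mult[symmetric])
  then have "1 / 4 ^ l * exp (?x\<^sup>2 / (4 * ?d)) \<le> exp g" by (simp add: ennreal_le_iff)
  then have "exp (?x\<^sup>2 / (4 * ?d)) \<le> 4 ^ l * exp g" by (simp add: field_simps)
  also have "\<dots> \<le> exp (2 * real l) * exp g"
  proof -
    have "(2::real) \<le> exp 1" using exp_ge_add_one_self[of 1] by simp
    then have "(2::real) * 2 \<le> exp 1 * exp 1" by (intro mult_mono) auto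
    then have "(4::real) \<le> exp 2" by (simp add: exp_add[symmetric])
    then have "(4::real) ^ l \<le> exp 2 ^ l" by (intro power_mono) auto
    also have "\<dots> = exp (2 * real l)" by (simp add: exp_of_nat_mult[symmetric] mult.commute)
    finally show ?thesis by (intro mult_right_mono) auto
  qed
  finally have "exp (?x\<^sup>2 / (4 * ?d)) \<le> exp (g + 2 * real l)" by (simp add: exp_add mult.commute)
  then have "?x\<^sup>2 / (4 * ?d) \<le> g + 2 * real l" by simp
  then have "?x\<^sup>2 \<le> (g + 2 * real l) * (4 * ?d)"
    by (rule pos_divide_le_eq[THEN iffD1, rotated]) (use d in simp)
  also have "\<dots> = 4 * h / 2 ^ l * (g + 2 * real l)" by simp
  finally show "?x\<^sup>2 \<le> 4 * h / 2 ^ l * (g + 2 * real l)" .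
qed

section \<open>Variation along paths and the polymer partition function\<close>

text \<open>A path that starts in the cell \<open>[c, c + h]\<close> and makes \<open>d\<close> moves before it leaves the cell stays within
distance \<open>d\<close> of its first level.  As the second part of the bound on increments is additive in time, the
whole visit costs \<open>a0\<close> for each of the \<open>d + 1\<close> stages, and the coefficients \<open>b\<close> of the levels in reach
once.\<close>

lemma path_split_at_cell:
  assumes "backward_path W j t k i s v" "c \<le> t" "0 \<le> c" "0 < h" "t \<le> c + h" "0 \<le> a0" "\<And>i. 0 \<le> b i"
    and inc: "\<And>i s t. \<lbrakk>c \<le> s; s \<le> t; t \<le> c + h\<rbrakk> \<Longrightarrow> \<bar>W i t - W i s\<bar> \<le> a0 + b i * ((t - s) / h)"
  shows "\<exists>d e i' s' v'. d \<le> k \<and> e \<le> j + d \<and> j \<le> e + d \<and> backward_path W e c (k - d) i' s' v' \<and>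
    v \<le> v' + a0 * (real d + 1) + (\<Sum>i\<in>{j - d..j + d}. b i) * ((t - c) / h)"
  using assms(1-7)
proof (induction rule: backward_path.induct)
  case (stop j t)
  have "0 \<le> b j * ((t - c) / h)" using stop by simp
  then show ?case using backward_path.stop[of W j c] stop
    by (intro exI[of _ 0] exI[of _ j] exI[of _ c]) auto
next
  case (step s t i j k j' s'' v)
  show ?case
  proof (cases "c \<le> s")
    case True
    then obtain d e i' s' v' where IH: "d \<le> k" "e \<le> i + d" "i \<le> e + d" "backward_path W e c (k - d) i' s' v'"
      "v \<le> v' + a0 * (real d + 1) + (\<Sum>i\<in>{i - d..i + d}. b i) * ((s - c) / h)"
      using step by auto
    have 1: "\<bar>W j t - W j s\<bar> \<le> a0 + b j * ((t - s) / h)" using True step by (intro inc) auto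
    let ?B = "\<Sum>i\<in>{j - Suc d..j + Suc d}. b i"
    have "(\<Sum>i\<in>{i - d..i + d}. b i) \<le> ?B" using step by (intro sum_mono2) auto
    then have "(\<Sum>i\<in>{i - d..i + d}. b i) * ((s - c) / h) \<le> ?B * ((s - c) / h)"
      using True step by (intro mult_right_mono) auto
    moreover have "b j \<le> ?B" using step by (intro member_le_sum) auto
    then have "b j * ((t - s) / h) \<le> ?B * ((t - s) / h)"
      using True step by (intro mult_right_mono) auto
    moreover have "?B * ((s - c) / h) + ?B * ((t - s) / h) = ?B * ((t - c) / h)"
      unfolding distrib_left[symmetric] add_divide_distrib[symmetric] by simp
    moreover have "a0 * (real (Suc d) + 1) = a0 * (real d + 1) + a0" by (simp add: algebra_simps)
    ultimately have 2: "v + \<bar>W j t - W j s\<bar> \<le> v' + a0 * (real (Suc d) + 1) + ?B * ((t - c) / h)"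
      using IH(5) 1 by linarith
    have 3: "backward_path W e c (Suc k - Suc d) i' s' v'" using IH(4) by simp
    have 4: "Suc d \<le> Suc k" "e \<le> j + Suc d" "j \<le> e + Suc d" using IH(1-3) step(3,4) by linarith+
    show ?thesis using 2 3 4 by blast
  next
    case False
    have "\<bar>W j t - W j c\<bar> \<le> a0 + b j * ((t - c) / h)" using False step by (intro inc) auto
    moreover have "backward_path W j c (Suc k) j' s'' (v + \<bar>W j c - W j s\<bar>)"
      using step False by (intro backward_path.step) auto
    ultimately show ?thesis
      by (intro exI[of _ 0] exI[of _ j] exI[of _ j'] exI[of _ s''] exI[of _ "v + \<bar>W j c - W j s\<bar>"]) auto
  qed
qed

text \<open>The sum, over all ways to enter \<open>c\<close> successive cells, of the products of the weights of all levels that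
are in reach; \<open>k\<close> is the number of moves left and \<open>d\<close> the number used in the current cell.  The
recursion goes backwards in time, so the latest cell is the outermost.\<close>

primrec polymer :: "(nat \<Rightarrow> nat \<Rightarrow> ennreal) \<Rightarrow> nat \<Rightarrow> nat \<Rightarrow> nat \<Rightarrow> ennreal" where
  "polymer \<Gamma> 0 e k = 1"
| "polymer \<Gamma> (Suc c) e k =
    (\<Sum>d\<le>k. \<Sum>e'\<in>{e - d..e + d}. (\<Prod>j\<in>{e - d..e + d}. \<Gamma> c j) * polymer \<Gamma> c e' (k - d))"

text \<open>The path picks one term of the polymer sum, and all weights are at least \<open>1\<close>, so the exponential of the
sum of the random parts \<open>g\<close> met by the path is at most the whole sum.\<close>

lemma path_variation_le_polymer:
  assumes h: "0 < h" and a0: "0 \<le> a0" and g: "\<And>c j. 0 \<le> g c j" and \<Gamma>: "\<And>c j. \<Gamma> c j = ennreal (exp (g c j))"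
    and inc: "\<And>c i s t. \<lbrakk>c < n; real c * h \<le> s; s \<le> t; t \<le> real c * h + h\<rbrakk> \<Longrightarrow> \<bar>W i t - W i s\<bar> \<le> a0 + a0 * g c i * ((t - s) / h)"
    and "backward_path W j t k i s v" "0 \<le> t" "t \<le> real c * h" "c \<le> n"
  shows "\<exists>S\<ge>0. v \<le> a0 * (real k + real c + S) \<and> ennreal (exp S) \<le> polymer \<Gamma> c j k"
  using assms(6-)
proof (induction c arbitrary: j t k i s v)
  case 0
  then have "v = 0" using path_at_zero by auto
  then show ?case using a0 by (intro exI[of _ 0]) auto
next
  case (Suc c)
  have mem: "(\<Prod>i\<in>{j - d..j + d}. \<Gamma> c i) * polymer \<Gamma> c e (k - d) \<le> polymer \<Gamma> (Suc c) j k"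
    if "d \<le> k" "e \<le> j + d" "j \<le> e + d" for d e
  proof -
    have "(\<Prod>i\<in>{j - d..j + d}. \<Gamma> c i) * polymer \<Gamma> c e (k - d)
      \<le> (\<Sum>e'\<in>{j - d..j + d}. (\<Prod>j\<in>{j - d..j + d}. \<Gamma> c j) * polymer \<Gamma> c e' (k - d))"
      using that by (intro member_le_sum) auto
    also have "\<dots> \<le> polymer \<Gamma> (Suc c) j k"
      unfolding polymer.simps using that by (intro member_le_sum) auto
    finally show ?thesis .
  qed
  show ?case
  proof (cases "t \<le> real c * h")
    case True
    then obtain S where S: "0 \<le> S" "v \<le> a0 * (real k + real c + S)" "ennreal (exp S) \<le> polymer \<Gamma> c j k"
      using Suc.IH[OF Suc.prems(1,2)] Suc.prems by auto
    have "1 * polymer \<Gamma> c j k \<le> \<Gamma> c j * polymer \<Gamma> c j k"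
      using g[of c j] by (intro mult_right_mono) (auto simp: \<Gamma>)
    also have "\<dots> \<le> polymer \<Gamma> (Suc c) j k" using mem[of 0 j] by simp
    finally have "ennreal (exp S) \<le> polymer \<Gamma> (Suc c) j k" using S(3) by simp
    moreover have "v \<le> a0 * (real k + real (Suc c) + S)" using S(2) a0 by (simp add: algebra_simps)
    ultimately show ?thesis using S(1) by blast
  next
    case False
    have cn: "c < n" using Suc.prems by simp
    have "\<exists>d e i' s' v'. d \<le> k \<and> e \<le> j + d \<and> j \<le> e + d \<and> backward_path W e (real c * h) (k - d) i' s' v' \<and>
      v \<le> v' + a0 * (real d + 1) + (\<Sum>i\<in>{j - d..j + d}. a0 * g c i) * ((t - real c * h) / h)"
    proof (rule path_split_at_cell[OF Suc.prems(1)])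
      show "t \<le> real c * h + h" using Suc.prems(3) by (simp add: algebra_simps)
    qed (use False h a0 g inc[OF cn] in auto)
    then obtain d e i' s' v' where sp: "d \<le> k" "e \<le> j + d" "j \<le> e + d" "backward_path W e (real c * h) (k - d) i' s' v'"
      "v \<le> v' + a0 * (real d + 1) + (\<Sum>i\<in>{j - d..j + d}. a0 * g c i) * ((t - real c * h) / h)" by blast
    obtain S where S: "0 \<le> S" "v' \<le> a0 * (real (k - d) + real c + S)" "ennreal (exp S) \<le> polymer \<Gamma> c e (k - d)"
      using Suc.IH[OF sp(4)] h cn by auto
    let ?g = "\<Sum>i\<in>{j - d..j + d}. g c i"
    have g0: "0 \<le> ?g" using g by (intro sum_nonneg) auto
    have "(\<Sum>i\<in>{j - d..j + d}. a0 * g c i) * ((t - real c * h) / h) \<le> (\<Sum>i\<in>{j - d..j + d}. a0 * g c i) * 1"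
      using Suc.prems(3) h a0 g by (intro mult_left_mono sum_nonneg) (auto simp: field_simps)
    then have "v \<le> a0 * (real (k - d) + real c + S) + a0 * (real d + 1) + a0 * ?g"
      using sp(5) S(2) by (simp add: sum_distrib_left)
    also have "\<dots> = a0 * (real k + real (Suc c) + (?g + S))" using sp(1) by (simp add: of_nat_diff algebra_simps)
    finally have v: "v \<le> a0 * (real k + real (Suc c) + (?g + S))" .
    have "ennreal (exp (?g + S)) = (\<Prod>i\<in>{j - d..j + d}. \<Gamma> c i) * ennreal (exp S)"
      by (simp add: exp_add exp_sum \<Gamma> prod_ennreal ennreal_mult prod_nonneg)
    also have "\<dots> \<le> (\<Prod>i\<in>{j - d..j + d}. \<Gamma> c i) * polymer \<Gamma> c e (k - d)"
      using S(3) by (intro mult_left_mono) auto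
    also have "\<dots> \<le> polymer \<Gamma> (Suc c) j k" using sp by (intro mem)
    finally show ?thesis using v g0 S(1) by (intro exI[of _ "?g + S"]) auto
  qed
qed

text \<open>
Level \<open>0\<close> is set to zero because paths that are shifted down by truncated subtraction end there.
\<close>

abbreviation drifted :: "(nat \<Rightarrow> real) \<Rightarrow> (nat \<Rightarrow> real \<Rightarrow> real) \<Rightarrow> nat \<Rightarrow> real \<Rightarrow> real" where
  "drifted g B \<equiv> \<lambda>j t. if j = 0 then 0 else g j * t + B j t"

text \<open>With cells of length \<open>h = T / N\<close> each of the at most \<open>14 N + ln D\<close> units costs a multiple of \<open>\<surd>h\<close>, and
\<open>N \<surd>h = \<surd>(T N)\<close>.  Here \<open>S \<le> ln D + 12 N\<close> because \<open>4096 = 2\<^sup>1\<^sup>2 \<le> e\<^sup>1\<^sup>2\<close>.\<close>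

lemma path_variation_bound:
  fixes B :: "nat \<Rightarrow> real \<Rightarrow> real"
  assumes T: "0 < T" and G: "0 \<le> G" "\<And>j. 1 \<le> j \<Longrightarrow> \<bar>g j\<bar> \<le> G"
    and cont: "\<And>j. 1 \<le> j \<Longrightarrow> continuous_on {0..} (B j)"
    and \<Gamma>: "\<And>c j. \<Gamma> c j = (if j = 0 then 1 else dyadic_energy (real c * (T / real N)) (T / real N) (B j))"
    and fin: "\<And>c j. \<Gamma> c j < \<infinity>" and N: "0 < N"
    and D: "1 \<le> D" "polymer \<Gamma> N j k \<le> ennreal (D * 4096 ^ N)" "N = j + k + 1"
    and path: "0 \<le> t" "t \<le> T" "backward_path (drifted g B) j t k i s v"
  shows "v \<le> (105 * sqrt T + G * T) * (14 + ln D) * sqrt (real N)"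
proof -
  define h where "h = T / real N"
  have h: "0 < h" "real N * h = T" using T N by (auto simp: h_def)
  define a0 where "a0 = 105 * sqrt h + G * h"
  have a0: "0 \<le> a0" "105 * sqrt h \<le> a0" using h G by (auto simp: a0_def)
  have \<Gamma>1: "1 \<le> \<Gamma> c j" for c j using dyadic_energy_ge_1[OF h(1)] by (simp add: \<Gamma> h_def)
  define \<gamma> where "\<gamma> = (\<lambda>c j. ln (enn2real (\<Gamma> c j)))"
  have enn: "1 \<le> enn2real (\<Gamma> c j)" "\<Gamma> c j = ennreal (enn2real (\<Gamma> c j))" for c j
  proof -
    show e: "\<Gamma> c j = ennreal (enn2real (\<Gamma> c j))" using fin[of c j] by simp
    have "ennreal 1 \<le> ennreal (enn2real (\<Gamma> c j))" using \<Gamma>1[of c j] e by simp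
    then show "1 \<le> enn2real (\<Gamma> c j)" by (simp only: ennreal_le_iff enn2real_nonneg)
  qed
  have \<gamma>: "0 \<le> \<gamma> c j" "\<Gamma> c j = ennreal (exp (\<gamma> c j))" for c j
    using enn[of c j] by (auto simp: \<gamma>_def)
  let ?\<beta> = "drifted g B"
  have inc: "\<bar>?\<beta> i t - ?\<beta> i s\<bar> \<le> a0 + a0 * \<gamma> c i * ((t - s) / h)"
    if st: "real c * h \<le> s" "s \<le> t" "t \<le> real c * h + h" for c i s t
  proof (cases "i = 0")
    case True
    have "0 \<le> a0 * \<gamma> c i * ((t - s) / h)" using a0 \<gamma> st h by (intro mult_nonneg_nonneg) auto
    then show ?thesis using True a0 by simp
  next
    case False
    then have i: "1 \<le> i" by simp
    have "continuous_on {real c * h..real c * h + h} (B i)"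
      by (rule continuous_on_subset[OF cont[OF i]]) (use h in auto)
    moreover have "dyadic_energy (real c * h) h (B i) = ennreal (exp (\<gamma> c i))"
      using \<gamma>(2)[of c i] \<Gamma>[of c i] False by (simp add: h_def)
    ultimately have 1: "\<bar>B i t - B i s\<bar> \<le> 105 * sqrt h * (1 + \<gamma> c i * ((t - s) / h))"
      using dyadic_energy_modulus[OF h(1)] \<gamma>(1) st by blast
    have "\<bar>g i * (t - s)\<bar> \<le> G * h"
      unfolding abs_mult using G(2)[OF i] G(1) st by (intro mult_mono) auto
    moreover have "?\<beta> i t - ?\<beta> i s = g i * (t - s) + (B i t - B i s)" using False by (simp add: algebra_simps)
    ultimately have "\<bar>?\<beta> i t - ?\<beta> i s\<bar> \<le> a0 + 105 * sqrt h * (\<gamma> c i * ((t - s) / h))"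
      using 1 unfolding a0_def distrib_left by linarith
    also have "105 * sqrt h * (\<gamma> c i * ((t - s) / h)) \<le> a0 * (\<gamma> c i * ((t - s) / h))"
      using a0 \<gamma> st h by (intro mult_right_mono) auto
    finally show ?thesis by (simp add: mult.assoc)
  qed
  have "\<exists>S\<ge>0. v \<le> a0 * (real k + real N + S) \<and> ennreal (exp S) \<le> polymer \<Gamma> N j k"
    by (rule path_variation_le_polymer[where n = N and c = N, OF h(1) a0(1) \<gamma>(1) \<gamma>(2) _ path(3,1)])
      (use inc path(2) h(2) in auto)
  then obtain S where S: "0 \<le> S" "v \<le> a0 * (real k + real N + S)" "ennreal (exp S) \<le> polymer \<Gamma> N j k"
    by blast
  have "ennreal (exp S) \<le> ennreal (D * 4096 ^ N)" using S(3) D(2) by (rule order_trans)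
  then have "exp S \<le> D * 4096 ^ N" using D(1) by (simp add: ennreal_le_iff)
  also have "\<dots> \<le> D * exp (12 * real N)"
  proof -
    have "(2::real) \<le> exp 1" using exp_ge_add_one_self[of 1] by simp
    then have "(2::real) ^ 12 \<le> exp 1 ^ 12" by (intro power_mono) auto
    also have "exp 1 ^ 12 = exp (12::real)" by (simp add: exp_of_nat_mult[symmetric])
    finally have "(4096::real) ^ N \<le> exp 12 ^ N" by (intro power_mono) auto
    also have "\<dots> = exp (12 * real N)" by (simp add: exp_of_nat_mult[symmetric] mult.commute)
    finally show ?thesis using D(1) by (intro mult_left_mono) auto
  qed
  also have "\<dots> = exp (ln D + 12 * real N)" using D(1) by (simp add: exp_add)
  finally have S': "S \<le> ln D + 12 * real N" by simp
  have lnD: "0 \<le> ln D" using D(1) by simp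
  have N1: "1 \<le> real N" using N by simp
  have "real k + real N + S \<le> (14 + ln D) * real N"
  proof -
    have "ln D * 1 \<le> ln D * real N" using lnD N1 by (intro mult_left_mono) auto
    moreover have "real k \<le> real N" using D(3) by simp
    ultimately show ?thesis using S' by (simp add: algebra_simps)
  qed
  then have "v \<le> a0 * ((14 + ln D) * real N)"
    using S(2) mult_left_mono[OF _ a0(1)] by (meson order_trans)
  also have "\<dots> = (105 * (sqrt h * real N) + G * (real N * h)) * (14 + ln D)"
    by (simp add: a0_def algebra_simps)
  also have "sqrt h * real N = sqrt T * sqrt (real N)"
  proof -
    have "sqrt h * sqrt (real N) = sqrt T" using h(2) by (simp add: real_sqrt_mult[symmetric] mult.commute)
    then have "sqrt h * (sqrt (real N) * sqrt (real N)) = sqrt T * sqrt (real N)" by (metis mult.assoc)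
    then show ?thesis by simp
  qed
  also have "(105 * (sqrt T * sqrt (real N)) + G * (real N * h)) * (14 + ln D)
    \<le> (105 * (sqrt T * sqrt (real N)) + G * T * sqrt (real N)) * (14 + ln D)"
  proof (intro mult_right_mono add_left_mono)
    have "G * T * 1 \<le> G * T * sqrt (real N)" using G T N1 by (intro mult_left_mono) auto
    then show "G * (real N * h) \<le> G * T * sqrt (real N)" by (simp add: h(2))
  qed (use lnD in simp)
  also have "\<dots> = (105 * sqrt T + G * T) * (14 + ln D) * sqrt (real N)" by (simp add: algebra_simps)
  finally show ?thesis .
qed

text \<open>A path for the discounted sum is a superposition of the same path shifted down by \<open>d\<close> levels, with weight
\<open>r\<^sup>d\<close>.  Truncated subtraction at level \<open>0\<close> keeps nearest-neighbour steps, and level \<open>0\<close> carries no noise.\<close>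

lemma path_variation_disc_sum:
  assumes r: "0 \<le> r" and b0: "\<And>t. \<beta> 0 t = 0"
    and path: "backward_path (\<lambda>j t. disc_sum r (\<lambda>i. \<beta> i t) j) j t k i s v" and m: "j + k \<le> m"
  shows "\<exists>u. (\<forall>d. backward_path \<beta> (j - d) t k (i - d) s (u d)) \<and> v \<le> (\<Sum>d<m. r ^ d * u d)"
  using path m
proof (induction rule: backward_path.induct)
  case (stop j t)
  then show ?case by (intro exI[of _ "\<lambda>_. 0"]) (auto intro: backward_path.stop)
next
  case (step s t i j k j' s' v)
  then obtain u where u: "\<And>d. backward_path \<beta> (i - d) s k (j' - d) s' (u d)" "v \<le> (\<Sum>d<m. r ^ d * u d)" by auto
  have g: "\<bar>disc_sum r (\<lambda>i. f i) j\<bar> \<le> (\<Sum>d<m. r ^ d * \<bar>f (j - d)\<bar>)" if "j \<le> m" "f 0 = 0" for f j m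
    using that(1)
  proof (induction m arbitrary: j)
    case (Suc m)
    show ?case
    proof (cases j)
      case 0
      then show ?thesis using r that by (simp add: sum_nonneg)
    next
      case (Suc l)
      have "\<bar>disc_sum r f (Suc l)\<bar> \<le> \<bar>f (Suc l)\<bar> + r * \<bar>disc_sum r f l\<bar>"
        using abs_triangle_ineq[of "f (Suc l)" "r * disc_sum r f l"] r by (simp add: abs_mult)
      also have "\<dots> \<le> \<bar>f (Suc l)\<bar> + r * (\<Sum>d<m. r ^ d * \<bar>f (l - d)\<bar>)"
        using Suc.IH[of l] Suc.prems Suc r by (intro add_left_mono mult_left_mono) auto
      also have "\<dots> = (\<Sum>d<Suc m. r ^ d * \<bar>f (Suc l - d)\<bar>)"
        unfolding sum.lessThan_Suc_shift by (simp add: sum_distrib_left mult.assoc)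
      finally show ?thesis using Suc by simp
    qed
  qed simp
  let ?u = "\<lambda>d. u d + \<bar>\<beta> (j - d) t - \<beta> (j - d) s\<bar>"
  have "\<bar>disc_sum r (\<lambda>i. \<beta> i t - \<beta> i s) j\<bar> \<le> (\<Sum>d<m. r ^ d * \<bar>\<beta> (j - d) t - \<beta> (j - d) s\<bar>)"
    using step b0 by (intro g) auto
  then have "v + \<bar>disc_sum r (\<lambda>i. \<beta> i t) j - disc_sum r (\<lambda>i. \<beta> i s) j\<bar> \<le> (\<Sum>d<m. r ^ d * ?u d)"
    using u(2) by (simp add: disc_sum_diff distrib_left sum.distrib)
  moreover have "backward_path \<beta> (j - d) t (Suc k) (j' - d) s' (?u d)" for d
    using step by (intro backward_path.step[OF _ _ _ _ u(1)]) auto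
  ultimately show ?case by (intro exI[of _ ?u]) auto
qed

lemma bounded_path_variation_disc_sum:
  assumes r: "0 \<le> r" "r < 1" and b0: "\<And>t. \<beta> 0 t = 0" and b: "bounded_path_variation \<beta>"
  shows "bounded_path_variation (\<lambda>j t. disc_sum r (\<lambda>i. \<beta> i t) j)"
  unfolding bounded_path_variation_def
proof (intro allI)
  fix T :: nat
  obtain C where C: "0 \<le> C" "\<And>j t k i s v. \<lbrakk>0 \<le> t; t \<le> real T; backward_path \<beta> j t k i s v\<rbrakk> \<Longrightarrow> v \<le> C * sqrt (real (j + k + 1))"
    using b unfolding bounded_path_variation_def by meson
  have "v \<le> C / (1 - r) * sqrt (real (j + k + 1))"
    if t: "0 \<le> t" "t \<le> real T" and path: "backward_path (\<lambda>j t. disc_sum r (\<lambda>i. \<beta> i t) j) j t k i s v" for j t k i s v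
  proof -
    obtain u where u: "\<And>d. backward_path \<beta> (j - d) t k (i - d) s (u d)" "v \<le> (\<Sum>d<j + k. r ^ d * u d)"
      using path_variation_disc_sum[OF r(1) b0 path, of "j + k"] by auto
    let ?K = "C * sqrt (real (j + k + 1))"
    have K: "0 \<le> ?K" using C by simp
    have "u d \<le> ?K" for d
    proof -
      have "u d \<le> C * sqrt (real (j - d + k + 1))" using C(2)[OF t u(1)] .
      also have "\<dots> \<le> ?K" using C(1) by (intro mult_left_mono) auto
      finally show ?thesis .
    qed
    then have "v \<le> (\<Sum>d<j + k. r ^ d * ?K)"
      using r by (intro order_trans[OF u(2)] sum_mono mult_left_mono) auto
    also have "\<dots> = (\<Sum>d<j + k. r ^ d) * ?K" by (simp only: sum_distrib_right)
    also have "\<dots> \<le> 1 / (1 - r) * ?K"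
    proof (rule mult_right_mono[OF _ K])
      have "(\<Sum>d<j + k. r ^ d) = (1 - r ^ (j + k)) / (1 - r)" using r by (subst sum_gp_strict) auto
      also have "\<dots> \<le> 1 / (1 - r)" using r by (intro divide_right_mono) auto
      finally show "(\<Sum>d<j + k. r ^ d) \<le> 1 / (1 - r)" .
    qed
    finally show ?thesis by simp
  qed
  then show "\<exists>C\<ge>0. \<forall>j t k i s v. 0 \<le> t \<longrightarrow> t \<le> real T \<longrightarrow>
      backward_path (\<lambda>j t. disc_sum r (\<lambda>i. \<beta> i t) j) j t k i s v \<longrightarrow> v \<le> C * sqrt (real (j + k + 1))"
    using C(1) r by (intro exI[of _ "C / (1 - r)"] conjI) (simp, blast)
qed

section \<open>Moments of the partition function\<close>

lemma measurable_dyadic_energy: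
  assumes "0 \<le> a" "0 \<le> h" "\<And>t. a \<le> t \<Longrightarrow> t \<le> a + h \<Longrightarrow> (\<lambda>\<omega>. W t \<omega>) \<in> borel_measurable N"
  shows "(\<lambda>\<omega>. dyadic_energy a h (\<lambda>t. W t \<omega>)) \<in> borel_measurable N"
proof -
  let ?D = "\<lambda>l i \<omega>. W (a + real (Suc i) * h / 2 ^ l) \<omega> - W (a + real i * h / 2 ^ l) \<omega>"
  have "(\<lambda>\<omega>. W (a + real i * h / 2 ^ l) \<omega>) \<in> borel_measurable N" if "i \<le> 2 ^ l" for i l
  proof (rule assms(3))
    show "a \<le> a + real i * h / 2 ^ l" using assms by simp
    have "real i \<le> real (2 ^ l)" using that by (rule of_nat_mono)
    then have "real i / 2 ^ l \<le> 1" by simp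
    then have "real i / 2 ^ l * h \<le> 1 * h" using assms by (intro mult_right_mono) auto
    then show "a + real i * h / 2 ^ l \<le> a + h" by simp
  qed
  note Wm = this
  have "(\<lambda>\<omega>. \<Sum>i<2 ^ l. exp_square (?D l i \<omega>) (h / 2 ^ l))
      \<in> borel_measurable N" for l
  proof (rule borel_measurable_sum)
    fix i :: nat assume "i \<in> {..<2 ^ l}"
    then have [measurable]: "W (a + real (Suc i) * h / 2 ^ l) \<in> borel_measurable N"
      "W (a + real i * h / 2 ^ l) \<in> borel_measurable N"
      using Wm[of "Suc i" l] Wm[of i l] by auto
    show "(\<lambda>\<omega>. exp_square (?D l i \<omega>) (h / 2 ^ l)) \<in> borel_measurable N"
      by measurable
  qed
  note [measurable] = this
  show ?thesis unfolding dyadic_energy_def by measurable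
qed

lemma (in prob_space) expectation_exp_square_normal:
  assumes D: "distributed M lborel D (normal_density 0 (sqrt \<delta>))" and \<delta>: "0 < \<delta>"
  shows "(\<integral>\<^sup>+\<omega>. ennreal (exp ((D \<omega>)\<^sup>2 / (4 * \<delta>))) \<partial>M) = ennreal (sqrt 2)"
proof -
  have "(\<integral>\<^sup>+\<omega>. ennreal (exp ((D \<omega>)\<^sup>2 / (4 * \<delta>))) \<partial>M)
    = (\<integral>\<^sup>+x. ennreal (normal_density 0 (sqrt \<delta>) x) * ennreal (exp (x\<^sup>2 / (4 * \<delta>))) \<partial>lborel)"
    by (rule distributed_nn_integral[OF D, symmetric]) auto
  also have "\<dots> = (\<integral>\<^sup>+x. ennreal (sqrt 2) * ennreal (normal_density 0 (sqrt (2 * \<delta>)) x) \<partial>lborel)"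
  proof (rule nn_integral_cong)
    fix x :: real
    have "exp (- (x\<^sup>2 / (2 * \<delta>))) * exp (x\<^sup>2 / (4 * \<delta>)) = exp (- (x\<^sup>2 / (4 * \<delta>)))"
      unfolding exp_add[symmetric] using \<delta> by (simp add: field_simps)
    then have "normal_density 0 (sqrt \<delta>) x * exp (x\<^sup>2 / (4 * \<delta>)) = sqrt 2 * normal_density 0 (sqrt (2 * \<delta>)) x"
      using \<delta> by (simp add: normal_density_def real_sqrt_mult field_simps)
    then show "ennreal (normal_density 0 (sqrt \<delta>) x) * ennreal (exp (x\<^sup>2 / (4 * \<delta>)))
      = ennreal (sqrt 2) * ennreal (normal_density 0 (sqrt (2 * \<delta>)) x)"
      by (simp add: ennreal_mult[symmetric])
  qed
  also have "\<dots> = ennreal (sqrt 2) * (\<integral>\<^sup>+x. ennreal (normal_density 0 (sqrt (2 * \<delta>)) x) \<partial>lborel)"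
    by (rule nn_integral_cmult) auto
  also have "(\<integral>\<^sup>+x. ennreal (normal_density 0 (sqrt (2 * \<delta>)) x) \<partial>lborel) = 1"
    using \<delta> by (subst nn_integral_eq_integral) (auto intro!: integrable_normal_density simp: integral_normal_density)
  finally show ?thesis by simp
qed

lemma (in prob_space) expectation_dyadic_energy:
  assumes W: "standard_brownian_motion M W" and a: "0 \<le> a" and h: "0 < h"
  shows "(\<integral>\<^sup>+\<omega>. dyadic_energy a h (\<lambda>t. W t \<omega>) \<partial>M) \<le> 3"
proof -
  let ?D = "\<lambda>l i \<omega>. W (a + real (Suc i) * h / 2 ^ l) \<omega> - W (a + real i * h / 2 ^ l) \<omega>"
  have m[measurable]: "W t \<in> borel_measurable M" if "0 \<le> t" for t
    using W that unfolding standard_brownian_motion_def by blast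
  have m2[measurable]: "W (a + real i * h / 2 ^ l) \<in> borel_measurable M" for i l
    using a h by (intro m) simp
  have inc: "\<And>s t. \<lbrakk>0 \<le> s; s < t\<rbrakk> \<Longrightarrow> distributed M lborel (\<lambda>\<omega>. W t \<omega> - W s \<omega>) (normal_density 0 (sqrt (t - s)))"
    using W unfolding standard_brownian_motion_def by blast
  have one: "(\<integral>\<^sup>+\<omega>. exp_square (?D l i \<omega>) (h / 2 ^ l) \<partial>M) = ennreal (sqrt 2)" for i l
  proof (rule expectation_exp_square_normal)
    have lt: "a + real i * h / 2 ^ l < a + real (Suc i) * h / 2 ^ l" using h by (simp add: divide_strict_right_mono)
    have eq: "a + real (Suc i) * h / 2 ^ l - (a + real i * h / 2 ^ l) = h / 2 ^ l" by (simp add: field_simps)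
    show "distributed M lborel (\<lambda>\<omega>. ?D l i \<omega>) (normal_density 0 (sqrt (h / 2 ^ l)))"
      by (rule inc[OF _ lt, unfolded eq]) (use a h in simp)
  qed (use h in simp)
  have "(\<integral>\<^sup>+\<omega>. dyadic_energy a h (\<lambda>t. W t \<omega>) \<partial>M)
    = (\<Sum>l. ennreal (1 / 4 ^ l) * (\<Sum>i<2 ^ l. \<integral>\<^sup>+\<omega>. exp_square (?D l i \<omega>) (h / 2 ^ l) \<partial>M))"
    unfolding dyadic_energy_def
    by (simp add: nn_integral_suminf nn_integral_cmult nn_integral_sum del: of_nat_Suc sum_ennreal)
  also have "\<dots> = (\<Sum>l. ennreal (sqrt 2 * (1 / 2) ^ l))"
  proof (rule suminf_cong)
    fix l :: nat
    have "ennreal (1 / 4 ^ l) * (\<Sum>i<(2::nat) ^ l. ennreal (sqrt 2)) = ennreal (1 / 4 ^ l) * ennreal (2 ^ l * sqrt 2)"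
      by (simp add: ennreal_mult ennreal_power[symmetric])
    also have "\<dots> = ennreal (sqrt 2 * (1 / 2) ^ l)"
    proof -
      have "(1::real) / 4 ^ l * (2 ^ l * sqrt 2) = sqrt 2 * (1 / 2) ^ l"
        using power_mult_distrib[of "2::real" 2 l] by (simp add: power_one_over)
      then show ?thesis by (simp add: ennreal_mult[symmetric])
    qed
    finally show "ennreal (1 / 4 ^ l) * (\<Sum>i<2 ^ l. \<integral>\<^sup>+\<omega>. exp_square (?D l i \<omega>) (h / 2 ^ l) \<partial>M) = ennreal (sqrt 2 * (1 / 2) ^ l)"
      by (simp only: one)
  qed
  also have "\<dots> = ennreal (\<Sum>l. sqrt 2 * (1 / 2) ^ l)"
    by (intro suminf_ennreal2 summable_mult) auto
  also have "(\<Sum>l. sqrt 2 * (1 / 2) ^ l) = sqrt 2 * 2"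
    by (subst suminf_mult) (auto simp: suminf_geometric)
  also have "ennreal (sqrt 2 * 2) \<le> ennreal 3"
  proof (rule ennreal_leI)
    have "sqrt 2 \<le> 3/2" by (rule real_le_lsqrt) (auto simp: power2_eq_square)
    then show "sqrt 2 * 2 \<le> 3" by simp
  qed
  finally show ?thesis by simp
qed

text \<open>The left sum counts at most \<open>2 d + 1\<close> levels of entry to the next cell, with a factor \<open>3\<close> for each of the at
most \<open>2 d + 1\<close> weights.  The additional term \<open>3 \<cdot> 27\<^sup>k\<close> makes the induction close, since
\<open>2 k + 3 \<le> 3\<^sup>k\<^sup>+\<^sup>1\<close>.\<close>

lemma route_count_series_bound: "(\<Sum>d\<le>k. (2 * d + 1) * 3 ^ (2 * d + 1) * 54 ^ (k - d)) + 3 * 27 ^ k \<le> 6 * (54::nat) ^ k"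
proof (induction k)
  case (Suc k)
  have lin: "2 * k + 3 \<le> 3 ^ Suc k" for k :: nat by (induction k) auto
  have "(\<Sum>d\<le>Suc k. (2 * d + 1) * 3 ^ (2 * d + 1) * 54 ^ (Suc k - d))
    = 54 * (\<Sum>d\<le>k. (2 * d + 1) * 3 ^ (2 * d + 1) * 54 ^ (k - d)) + (2 * k + 3) * 3 ^ (2 * Suc k + 1)"
  proof -
    have G: "(\<Sum>d\<le>Suc k. f d * 54 ^ (Suc k - d)) = 54 * (\<Sum>d\<le>k. f d * 54 ^ (k - d)) + f (Suc k)" for f :: "nat \<Rightarrow> nat"
      by (auto simp: sum_distrib_left Suc_diff_le intro!: sum.cong)
    have e: "2 * k + 3 = 2 * Suc k + 1" by simp
    show ?thesis unfolding e by (rule G[of "\<lambda>d. (2 * d + 1) * 3 ^ (2 * d + 1)"])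
  qed
  also have "(2 * k + 3) * 3 ^ (2 * Suc k + 1) \<le> 3 ^ Suc k * (3::nat) ^ (2 * Suc k + 1)"
    using lin[of k] by (rule mult_right_mono) simp
  also have "3 ^ Suc k * (3::nat) ^ (2 * Suc k + 1) = 3 * 27 ^ Suc k"
  proof -
    have e: "Suc k + (2 * Suc k + 1) = 3 * Suc k + 1" by simp
    have "(3::nat) ^ (3 * Suc k + 1) = 3 * (3 ^ 3) ^ Suc k" unfolding power_add power_mult by simp
    then show ?thesis unfolding power_add[symmetric] e by simp
  qed
  finally show ?case using Suc by simp
qed simp

text \<open>The weights of the latest cell are independent of the past on which the rest of the sum depends, so the
mean factorizes one cell after the other.  The growth in \<open>k\<close> at rate \<open>54\<close> leaves a geometric series over the
number \<open>d\<close> of moves in the cell.\<close>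

lemma nn_integral_polymer_le:
  assumes F: "\<And>c. c \<le> n \<Longrightarrow> subalgebra M (F c)" "\<And>c. c < n \<Longrightarrow> subalgebra (F (Suc c)) (F c)"
    and \<Gamma>: "\<And>c j. c < n \<Longrightarrow> (\<lambda>\<omega>. \<Gamma> \<omega> c j) \<in> borel_measurable (F (Suc c))"
    and fac: "\<And>c J U. \<lbrakk>c < n; finite J; U \<in> borel_measurable (F c)\<rbrakk> \<Longrightarrow>
       (\<integral>\<^sup>+\<omega>. (\<Prod>j\<in>J. \<Gamma> \<omega> c j) * U \<omega> \<partial>M) \<le> 3 ^ card J * (\<integral>\<^sup>+\<omega>. U \<omega> \<partial>M)"
    and M: "prob_space M" and c: "c \<le> n"
  shows "(\<lambda>\<omega>. polymer (\<Gamma> \<omega>) c e k) \<in> borel_measurable (F c) \<and>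
     (\<integral>\<^sup>+\<omega>. polymer (\<Gamma> \<omega>) c e k \<partial>M) \<le> of_nat (6 ^ c * 54 ^ k)"
  using c
proof (induction c arbitrary: e k)
  case 0
  interpret prob_space M by fact
  show ?case by (simp add: emeasure_space_1)
next
  case (Suc c)
  then have cn: "c < n" by simp
  have IH: "(\<lambda>\<omega>. polymer (\<Gamma> \<omega>) c e k) \<in> borel_measurable (F c)"
    "(\<integral>\<^sup>+\<omega>. polymer (\<Gamma> \<omega>) c e k \<partial>M) \<le> of_nat (6 ^ c * 54 ^ k)" for e k
    using Suc by auto
  have mS: "(\<lambda>\<omega>. polymer (\<Gamma> \<omega>) c e k) \<in> borel_measurable (F (Suc c))" for e k
    using IH(1) F(2)[OF cn] by (rule measurable_from_subalg[rotated])
  note [measurable] = mS \<Gamma>[OF cn]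
  have term_m: "(\<lambda>\<omega>. (\<Prod>j\<in>J. \<Gamma> \<omega> c j) * polymer (\<Gamma> \<omega>) c e' k') \<in> borel_measurable (F (Suc c))" for J e' k'
    by measurable
  have term_M: "(\<lambda>\<omega>. (\<Prod>j\<in>J. \<Gamma> \<omega> c j) * polymer (\<Gamma> \<omega>) c e' k') \<in> borel_measurable M" for J e' k'
    using term_m F(1)[OF Suc.prems] by (rule measurable_from_subalg[rotated])
  have "(\<integral>\<^sup>+\<omega>. polymer (\<Gamma> \<omega>) (Suc c) e k \<partial>M)
    = (\<Sum>d\<le>k. \<Sum>e'\<in>{e - d..e + d}. \<integral>\<^sup>+\<omega>. (\<Prod>j\<in>{e - d..e + d}. \<Gamma> \<omega> c j) * polymer (\<Gamma> \<omega>) c e' (k - d) \<partial>M)"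
    using term_M by (simp add: nn_integral_sum)
  also have "\<dots> \<le> (\<Sum>d\<le>k. \<Sum>e'\<in>{e - d..e + d}. of_nat (3 ^ (2 * d + 1) * (6 ^ c * 54 ^ (k - d))))"
  proof (intro sum_mono)
    fix d e' assume "d \<in> {..k}" "e' \<in> {e - d..e + d}"
    let ?J = "{e - d..e + d}"
    have "(\<integral>\<^sup>+\<omega>. (\<Prod>j\<in>?J. \<Gamma> \<omega> c j) * polymer (\<Gamma> \<omega>) c e' (k - d) \<partial>M)
      \<le> 3 ^ card ?J * (\<integral>\<^sup>+\<omega>. polymer (\<Gamma> \<omega>) c e' (k - d) \<partial>M)"
      using IH(1) by (intro fac cn) auto
    also have "\<dots> \<le> 3 ^ (2 * d + 1) * of_nat (6 ^ c * 54 ^ (k - d))"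
      by (intro mult_mono IH power_increasing) auto
    finally show "(\<integral>\<^sup>+\<omega>. (\<Prod>j\<in>?J. \<Gamma> \<omega> c j) * polymer (\<Gamma> \<omega>) c e' (k - d) \<partial>M)
      \<le> of_nat (3 ^ (2 * d + 1) * (6 ^ c * 54 ^ (k - d)))" by simp
  qed
  also have "\<dots> = of_nat (\<Sum>d\<le>k. card {e - d..e + d} * (3 ^ (2 * d + 1) * (6 ^ c * 54 ^ (k - d))))"
    by simp
  also have "\<dots> \<le> of_nat (6 ^ Suc c * 54 ^ k)"
  proof (rule of_nat_mono)
    have "(\<Sum>d\<le>k. card {e - d..e + d} * (3 ^ (2 * d + 1) * (6 ^ c * 54 ^ (k - d))))
      \<le> (\<Sum>d\<le>k. (2 * d + 1) * (3 ^ (2 * d + 1) * (6 ^ c * 54 ^ (k - d))))"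
      by (intro sum_mono mult_right_mono) auto
    also have "\<dots> = 6 ^ c * (\<Sum>d\<le>k. (2 * d + 1) * 3 ^ (2 * d + 1) * 54 ^ (k - d))"
      unfolding sum_distrib_left by (rule sum.cong) (simp_all only: mult_ac)
    also have "\<dots> \<le> 6 ^ c * (6 * 54 ^ k)" using route_count_series_bound[of k] by (intro mult_left_mono) auto
    finally show "(\<Sum>d\<le>k. card {e - d..e + d} * (3 ^ (2 * d + 1) * (6 ^ c * 54 ^ (k - d)))) \<le> 6 ^ Suc c * 54 ^ k"
      by simp
  qed
  finally show ?case using term_m by simp
qed

section \<open>The driving motions\<close>

lemma (in prob_space) indep_var_nn_integral:
  fixes X Y :: "'a \<Rightarrow> ennreal"
  assumes "indep_var borel X borel Y"
  shows "(\<integral>\<^sup>+\<omega>. X \<omega> * Y \<omega> \<partial>M) = (\<integral>\<^sup>+\<omega>. X \<omega> \<partial>M) * (\<integral>\<^sup>+\<omega>. Y \<omega> \<partial>M)"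
proof -
  have "indep_vars (\<lambda>_. borel) (case_bool X Y) UNIV"
    using assms unfolding indep_var_def by (rule indep_vars_cong[THEN iffD1, rotated -1]) (auto split: bool.split)
  from indep_vars_nn_integral[OF _ this] show ?thesis
    by (simp add: UNIV_bool mult.commute)
qed

lemma (in prob_space) indep_var_of_indep_set:
  assumes ind: "indep_set (sets A) (sets B)" and sp: "space A = space M" "space B = space M"
    and U: "U \<in> measurable A N1" and V: "V \<in> measurable B N2"
  shows "indep_var N1 U N2 V"
  unfolding indep_var_eq
proof (intro conjI)
  have sub: "sets A \<subseteq> events" "sets B \<subseteq> events"
    using indep_setD_ev1[OF ind] indep_setD_ev2[OF ind] .
  show "random_variable N1 U" "random_variable N2 V"
    using U V sub sp unfolding measurable_def by auto
  have "sigma_sets (space M) {U -` A' \<inter> space M |A'. A' \<in> sets N1} \<subseteq> sets A"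
    using sets.sigma_sets_subset[of "{U -` A' \<inter> space M |A'. A' \<in> sets N1}" A] measurable_sets[OF U] sp by auto
  moreover have "sigma_sets (space M) {V -` A' \<inter> space M |A'. A' \<in> sets N2} \<subseteq> sets B"
    using sets.sigma_sets_subset[of "{V -` A' \<inter> space M |A'. A' \<in> sets N2}" B] measurable_sets[OF V] sp by auto
  ultimately show "indep_set (sigma_sets (space M) {U -` A \<inter> space M |A. A \<in> sets N1})
     (sigma_sets (space M) {V -` A \<inter> space M |A. A \<in> sets N2})"
    using ind unfolding indep_sets2_eq by blast
qed

text \<open>The \<open>\<sigma>\<close>-algebra generated by the increments after time \<open>t\<close>, as it occurs in the definition of the driving
motions.\<close>

definition future :: "'a measure \<Rightarrow> (nat \<Rightarrow> real \<Rightarrow> 'a \<Rightarrow> real) \<Rightarrow> real \<Rightarrow> 'a measure" where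
  "future M B t = vimage_algebra (space M)
     (\<lambda>\<omega>. \<lambda>(i, s)\<in>{1..} \<times> {0..}. B i (t + s) \<omega> - B i t \<omega>) (\<Pi>\<^sub>M (i, s)\<in>{1..} \<times> {0..}. borel)"

lemma future_increment_measurable:
  assumes "1 \<le> i" "0 \<le> s"
  shows "(\<lambda>\<omega>. B i (t + s) \<omega> - B i t \<omega>) \<in> borel_measurable (future M B t)"
proof -
  let ?f = "\<lambda>\<omega>. \<lambda>(i, s)\<in>{1..} \<times> {0..}. B i (t + s) \<omega> - B i t \<omega>"
  let ?P = "\<Pi>\<^sub>M (i, s)\<in>{1::nat..} \<times> {0::real..}. (borel :: real measure)"
  have "?f \<in> measurable (future M B t) ?P"
    unfolding future_def by (rule measurable_vimage_algebra1) (auto simp: space_PiM)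
  from measurable_compose[OF this measurable_component_singleton[of "(i, s)"]] assms
  show ?thesis by simp
qed

locale driving_environment =
  fixes M :: "'a measure" and F :: "real \<Rightarrow> 'a measure" and B :: "nat \<Rightarrow> real \<Rightarrow> 'a \<Rightarrow> real"
  assumes MF: "filtered_prob_space M F" and B: "driving_brownian_motions M F B"
begin

sublocale prob_space M using MF by (simp add: filtered_prob_space_def)

lemma subalgebra_F: "0 \<le> t \<Longrightarrow> subalgebra M (F t)"
  using MF by (simp add: filtered_prob_space_def)

lemma subalgebra_F_mono: "0 \<le> s \<Longrightarrow> s \<le> t \<Longrightarrow> subalgebra (F t) (F s)"
  using MF by (simp add: filtered_prob_space_def)

lemma brownian: "1 \<le> j \<Longrightarrow> standard_brownian_motion M (B j)"
  using B by (simp add: driving_brownian_motions_def)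

lemma B_measurable_F: "\<lbrakk>1 \<le> j; 0 \<le> s; s \<le> t\<rbrakk> \<Longrightarrow> B j s \<in> borel_measurable (F t)"
  using B measurable_from_subalg[OF subalgebra_F_mono] unfolding driving_brownian_motions_def adapted_def by blast

lemma indep_past_future:
  assumes "0 \<le> t" "U \<in> measurable (F t) N1" "V \<in> measurable (future M B t) N2"
  shows "indep_var N1 U N2 V"
proof (rule indep_var_of_indep_set)
  show "indep_set (sets (F t)) (sets (future M B t))"
    using B assms unfolding driving_brownian_motions_def future_def by blast
  show "space (F t) = space M" using subalgebra_F[OF assms(1)] by (simp add: subalgebra_def)
  show "space (future M B t) = space M" by (simp add: future_def)
qed fact+

lemma AE_continuous: "AE \<omega> in M. \<forall>j\<ge>1. continuous_on {0..} (\<lambda>t. B j t \<omega>)"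
  unfolding AE_all_countable using brownian by (auto simp: standard_brownian_motion_def)

lemma AE_zero_start: "AE \<omega> in M. \<forall>j\<ge>1. B j 0 \<omega> = 0"
  unfolding AE_all_countable using brownian by (auto simp: standard_brownian_motion_def)

lemma brownian_increments:
  assumes t: "0 \<le> t" "t < t'"
  defines "D \<equiv> \<lambda>i \<omega>. B i t' \<omega> - B i t \<omega>"
  shows "1 \<le> i \<Longrightarrow> distributed M lborel (D i) (normal_density 0 (sqrt (t' - t)))"
    and "\<lbrakk>1 \<le> i; 1 \<le> j; i \<noteq> j\<rbrakk> \<Longrightarrow> indep_var borel (D i) borel (D j)"
    and "1 \<le> i \<Longrightarrow> D i \<in> borel_measurable (F t')"
    and "1 \<le> i \<Longrightarrow> D i \<in> borel_measurable (future M B t)"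
proof -
  show "distributed M lborel (D i) (normal_density 0 (sqrt (t' - t)))" if "1 \<le> i"
    using brownian[OF that] t unfolding standard_brownian_motion_def D_def by blast
  show "D i \<in> borel_measurable (F t')" if "1 \<le> i"
    unfolding D_def using t that by (intro borel_measurable_diff B_measurable_F) auto
  show "D i \<in> borel_measurable (future M B t)" if "1 \<le> i"
    using future_increment_measurable[OF that, of "t' - t" B t M] t by (simp add: D_def)
  show "indep_var borel (D i) borel (D j)" if ij: "1 \<le> i" "1 \<le> j" "i \<noteq> j"
  proof -
    let ?P = "\<Pi>\<^sub>M t\<in>{0::real..}. (borel :: real measure)"
    have "indep_vars (\<lambda>_. ?P) (\<lambda>j \<omega>. \<lambda>t\<in>{0..}. B j t \<omega>) {i, j}"
      using B ij unfolding driving_brownian_motions_def by (elim conjE) (rule indep_vars_subset, auto)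
    moreover have "(\<lambda>w. w t' - w t) \<in> borel_measurable ?P"
      using t by (intro borel_measurable_diff measurable_component_singleton) auto
    ultimately have "indep_vars (\<lambda>_. borel) (\<lambda>j \<omega>. (\<lambda>t\<in>{0..}. B j t \<omega>) t' - (\<lambda>t\<in>{0..}. B j t \<omega>) t) {i, j}"
      by (rule indep_vars_compose2)
    then have "indep_vars (\<lambda>_. borel) D {i, j}" using t by (simp add: D_def)
    then have "indep_var borel (D i) borel (\<lambda>\<omega>. \<Sum>k\<in>{j}. D k \<omega>)"
      using ij by (intro indep_vars_sum) auto
    then show ?thesis by simp
  qed
qed

text \<open>Level \<open>0\<close> carries no motion; the weight \<open>1\<close> there keeps the partition function unchanged.\<close>

definition energy :: "real \<Rightarrow> real \<Rightarrow> 'a \<Rightarrow> nat \<Rightarrow> ennreal" where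
  "energy a h \<omega> j = (if j = 0 then 1 else dyadic_energy a h (\<lambda>t. B j t \<omega>))"

lemma energy_measurable_F:
  assumes "0 \<le> a" "0 \<le> h"
  shows "(\<lambda>\<omega>. energy a h \<omega> j) \<in> borel_measurable (F (a + h))"
proof (cases "j = 0")
  case False
  have "(\<lambda>\<omega>. dyadic_energy a h (\<lambda>t. B j t \<omega>)) \<in> borel_measurable (F (a + h))"
    using assms False by (intro measurable_dyadic_energy B_measurable_F) auto
  then show ?thesis using False by (simp add: energy_def)
qed (simp add: energy_def)

lemma energy_measurable_future:
  assumes "0 \<le> a" "0 \<le> h"
  shows "(\<lambda>\<omega>. energy a h \<omega> j) \<in> borel_measurable (future M B a)"
proof (cases "j = 0")
  case False
  have "(\<lambda>\<omega>. dyadic_energy 0 h (\<lambda>s. B j (a + s) \<omega> - B j a \<omega>)) \<in> borel_measurable (future M B a)"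
    using assms False by (intro measurable_dyadic_energy future_increment_measurable) auto
  then show ?thesis using False dyadic_energy_shift[of a h] by (simp add: energy_def)
qed (simp add: energy_def)

text \<open>Energies of different levels are functions of independent motions, and each has mean at most \<open>3\<close>.\<close>

lemma expectation_prod_energy:
  assumes a: "0 \<le> a" and h: "0 < h" and J: "finite J"
  shows "(\<integral>\<^sup>+\<omega>. (\<Prod>j\<in>J. energy a h \<omega> j) \<partial>M) \<le> 3 ^ card J"
proof -
  define J' where "J' = J \<inter> {1..}"
  have J': "finite J'" "J' \<subseteq> {1..}" "J' \<subseteq> J" using J by (auto simp: J'_def)
  let ?P = "\<Pi>\<^sub>M t\<in>{0::real..}. (borel :: real measure)"
  have dm: "dyadic_energy a h \<in> borel_measurable ?P"
  proof -
    have "(\<lambda>w. dyadic_energy a h (\<lambda>t. w t)) \<in> borel_measurable ?P"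
      using a h by (intro measurable_dyadic_energy measurable_component_singleton) auto
    then show ?thesis by simp
  qed
  have restr: "dyadic_energy a h (\<lambda>t\<in>{0..}. B j t \<omega>) = dyadic_energy a h (\<lambda>t. B j t \<omega>)" for j \<omega>
  proof -
    have "a + real i * h / 2 ^ l \<in> {0..}" for i l using a h by simp
    then show ?thesis unfolding dyadic_energy_def by (simp only: restrict_apply if_True)
  qed
  have "indep_vars (\<lambda>_. ?P) (\<lambda>j \<omega>. \<lambda>t\<in>{0..}. B j t \<omega>) J'"
    using B J' unfolding driving_brownian_motions_def by (meson indep_vars_subset)
  then have "indep_vars (\<lambda>_. borel) (\<lambda>j \<omega>. dyadic_energy a h (\<lambda>t\<in>{0..}. B j t \<omega>)) J'"
    by (rule indep_vars_compose2) (rule dm)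
  then have ind: "indep_vars (\<lambda>_. borel) (\<lambda>j \<omega>. dyadic_energy a h (\<lambda>t. B j t \<omega>)) J'"
    by (simp only: restr)
  have "(\<Prod>j\<in>J. energy a h \<omega> j) = (\<Prod>j\<in>J'. dyadic_energy a h (\<lambda>t. B j t \<omega>))" for \<omega>
  proof -
    have "(\<Prod>j\<in>J. energy a h \<omega> j) = (\<Prod>j\<in>J'. energy a h \<omega> j)"
      using J by (intro prod.mono_neutral_right) (auto simp: J'_def energy_def)
    also have "\<dots> = (\<Prod>j\<in>J'. dyadic_energy a h (\<lambda>t. B j t \<omega>))"
      using J' by (intro prod.cong) (auto simp: energy_def)
    finally show ?thesis .
  qed
  then have "(\<integral>\<^sup>+\<omega>. (\<Prod>j\<in>J. energy a h \<omega> j) \<partial>M) = (\<Prod>j\<in>J'. \<integral>\<^sup>+\<omega>. dyadic_energy a h (\<lambda>t. B j t \<omega>) \<partial>M)"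
    using indep_vars_nn_integral[OF J'(1) ind] by simp
  also have "\<dots> \<le> (\<Prod>j\<in>J'. 3)"
    using J' by (intro prod_mono_ennreal expectation_dyadic_energy brownian a h) auto
  also have "\<dots> \<le> 3 ^ card J" using J' J by (auto intro!: power_increasing card_mono)
  finally show ?thesis .
qed

lemma expectation_prod_energy_times:
  assumes a: "0 \<le> a" and h: "0 < h" and J: "finite J" and U: "U \<in> borel_measurable (F a)"
  shows "(\<integral>\<^sup>+\<omega>. (\<Prod>j\<in>J. energy a h \<omega> j) * U \<omega> \<partial>M) \<le> 3 ^ card J * (\<integral>\<^sup>+\<omega>. U \<omega> \<partial>M)"
proof -
  have "(\<lambda>\<omega>. \<Prod>j\<in>J. energy a h \<omega> j) \<in> borel_measurable (future M B a)"
    using energy_measurable_future[of a h] a h by (intro borel_measurable_prod_ennreal) auto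
  then have "(\<integral>\<^sup>+\<omega>. U \<omega> * (\<Prod>j\<in>J. energy a h \<omega> j) \<partial>M) = (\<integral>\<^sup>+\<omega>. U \<omega> \<partial>M) * (\<integral>\<^sup>+\<omega>. (\<Prod>j\<in>J. energy a h \<omega> j) \<partial>M)"
    using U by (intro indep_var_nn_integral indep_past_future[OF a]) auto
  then show ?thesis using mult_left_mono[OF expectation_prod_energy[OF a h J], of "\<integral>\<^sup>+\<omega>. U \<omega> \<partial>M"]
    by (simp add: mult.commute)
qed

lemma AE_energy_finite:
  assumes T: "0 < T"
  shows "AE \<omega> in M. \<forall>N c j. energy (real c * (T / real (Suc N))) (T / real (Suc N)) \<omega> j < \<infinity>"
proof -
  have "AE \<omega> in M. energy a h \<omega> j < \<infinity>" if a: "0 \<le> a" and h: "0 < h" for a h j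
  proof -
    have "(\<integral>\<^sup>+\<omega>. (\<Prod>j\<in>{j}. energy a h \<omega> j) \<partial>M) \<le> 3 ^ card {j}"
      by (rule expectation_prod_energy[OF a h]) simp
    then have "(\<integral>\<^sup>+\<omega>. energy a h \<omega> j \<partial>M) \<le> 3" by simp
    then have "(\<integral>\<^sup>+\<omega>. energy a h \<omega> j \<partial>M) \<noteq> \<infinity>" by (auto simp: top_unique)
    moreover have "(\<lambda>\<omega>. energy a h \<omega> j) \<in> borel_measurable M"
      using measurable_from_subalg[OF subalgebra_F[of "a + h"] energy_measurable_F[of a h]] a h by auto
    ultimately have "AE \<omega> in M. energy a h \<omega> j \<noteq> \<infinity>" by (intro nn_integral_PInf_AE) auto
    then show ?thesis by (simp add: less_top)
  qed
  then show ?thesis using T by (simp only: AE_all_countable) simp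
qed

text \<open>Instead of a union bound for every \<open>N\<close>, the normalized partition functions are summed over \<open>N\<close> and over the
starting levels: the sum has finite mean, hence is almost surely finite, and its value bounds all terms at once.\<close>

lemma AE_polymer_bound:
  assumes T: "0 < T"
  shows "AE \<omega> in M. \<exists>D\<ge>1. \<forall>N j k. N = j + k + 1 \<longrightarrow>
    polymer (\<lambda>c j. energy (real c * (T / real N)) (T / real N) \<omega> j) N j k \<le> ennreal (D * 4096 ^ N)"
proof -
  define \<Gamma> where "\<Gamma> = (\<lambda>N \<omega> c j. energy (real c * (T / real N)) (T / real N) \<omega> j)"
  have pol: "(\<lambda>\<omega>. polymer (\<Gamma> N \<omega>) N j k) \<in> borel_measurable M \<and>
     (\<integral>\<^sup>+\<omega>. polymer (\<Gamma> N \<omega>) N j k \<partial>M) \<le> of_nat (6 ^ N * 54 ^ k)" if N: "0 < N" for N j k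
  proof -
    let ?h = "T / real N"
    have h: "0 < ?h" using T N by simp
    have nn: "0 \<le> real c * ?h" for c using h by (intro mult_nonneg_nonneg) auto
    have le: "real c * ?h \<le> real (Suc c) * ?h" for c using h by (intro mult_right_mono) auto
    have eq: "real (Suc c) * ?h = real c * ?h + ?h" for c
      unfolding of_nat_Suc distrib_right mult_1 by (rule add.commute)
    have *: "(\<lambda>\<omega>. polymer (\<Gamma> N \<omega>) N j k) \<in> borel_measurable (F (real N * ?h)) \<and>
     (\<integral>\<^sup>+\<omega>. polymer (\<Gamma> N \<omega>) N j k \<partial>M) \<le> of_nat (6 ^ N * 54 ^ k)"
    proof (rule nn_integral_polymer_le[where F = "\<lambda>c. F (real c * ?h)" and n = N])
      fix c and J :: "nat set" and U :: "'a \<Rightarrow> ennreal" assume "c < N" "finite J" "U \<in> borel_measurable (F (real c * ?h))"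
      then show "(\<integral>\<^sup>+\<omega>. (\<Prod>j\<in>J. \<Gamma> N \<omega> c j) * U \<omega> \<partial>M) \<le> 3 ^ card J * (\<integral>\<^sup>+\<omega>. U \<omega> \<partial>M)"
        unfolding \<Gamma>_def using nn h by (intro expectation_prod_energy_times) auto
    next
      fix c j
      show "(\<lambda>\<omega>. \<Gamma> N \<omega> c j) \<in> borel_measurable (F (real (Suc c) * ?h))"
        unfolding \<Gamma>_def eq using energy_measurable_F[OF nn less_imp_le[OF h]] .
    next
      fix c show "subalgebra M (F (real c * ?h))" by (rule subalgebra_F[OF nn])
      show "subalgebra (F (real (Suc c) * ?h)) (F (real c * ?h))" by (rule subalgebra_F_mono[OF nn le])
    qed (simp_all add: prob_space_axioms)
    then show ?thesis using measurable_from_subalg[OF subalgebra_F[OF nn]] by blast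
  qed
  define tot where "tot = (\<lambda>N \<omega>. \<Sum>j<N. polymer (\<Gamma> N \<omega>) N j (N - 1 - j))"
  have tot_m: "tot N \<in> borel_measurable M" for N
    unfolding tot_def using pol by (intro borel_measurable_sum) auto
  have tot_E: "(\<integral>\<^sup>+\<omega>. ennreal (1 / 4096 ^ N) * tot N \<omega> \<partial>M) \<le> ennreal ((1/2) ^ N)" for N
  proof -
    have "(\<integral>\<^sup>+\<omega>. tot N \<omega> \<partial>M) = (\<Sum>j<N. \<integral>\<^sup>+\<omega>. polymer (\<Gamma> N \<omega>) N j (N - 1 - j) \<partial>M)"
      unfolding tot_def using pol by (intro nn_integral_sum) auto
    also have "\<dots> \<le> (\<Sum>j<N. of_nat (6 ^ N * 54 ^ N))"
    proof (rule sum_mono)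
      fix j assume j: "j \<in> {..<N}"
      have "(\<integral>\<^sup>+\<omega>. polymer (\<Gamma> N \<omega>) N j (N - 1 - j) \<partial>M) \<le> of_nat (6 ^ N * 54 ^ (N - 1 - j))"
        using pol[of N j "N - 1 - j"] j by auto
      also have "\<dots> \<le> of_nat (6 ^ N * 54 ^ N)" by (intro of_nat_mono mult_left_mono power_increasing) auto
      finally show "(\<integral>\<^sup>+\<omega>. polymer (\<Gamma> N \<omega>) N j (N - 1 - j) \<partial>M) \<le> of_nat (6 ^ N * 54 ^ N)" .
    qed
    also have "\<dots> = of_nat (N * (6 ^ N * 54 ^ N))" by simp
    also have "\<dots> \<le> of_nat (2 ^ N * (6 ^ N * 54 ^ N))"
      by (intro of_nat_mono mult_right_mono) (auto intro: less_imp_le)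
    \<comment> \<open>the number of starting levels is at most \<open>2\<^sup>N\<close>, and \<open>648 / 4096 \<le> 1 / 2\<close>\<close>
    also have "2 ^ N * (6 ^ N * 54 ^ N) = (648::nat) ^ N" by (simp add: power_mult_distrib[symmetric])
    also have "of_nat (648 ^ N) = ennreal (648 ^ N)" by (simp add: ennreal_of_nat_eq_real_of_nat)
    finally have "ennreal (1 / 4096 ^ N) * (\<integral>\<^sup>+\<omega>. tot N \<omega> \<partial>M) \<le> ennreal (1 / 4096 ^ N) * ennreal (648 ^ N)"
      by (rule mult_left_mono) simp
    also have "\<dots> = ennreal (1 / 4096 ^ N * 648 ^ N)" by (rule ennreal_mult[symmetric]) auto
    also have "(1::real) / 4096 ^ N * 648 ^ N = (648 / 4096) ^ N" unfolding power_divide by simp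
    also have "\<dots> \<le> ennreal ((1/2) ^ N)" by (intro ennreal_leI power_mono) auto
    finally show ?thesis using tot_m by (simp add: nn_integral_cmult)
  qed
  have "(\<integral>\<^sup>+\<omega>. (\<Sum>N. ennreal (1 / 4096 ^ N) * tot N \<omega>) \<partial>M) = (\<Sum>N. \<integral>\<^sup>+\<omega>. ennreal (1 / 4096 ^ N) * tot N \<omega> \<partial>M)"
    using tot_m by (intro nn_integral_suminf) auto
  also have "\<dots> \<le> (\<Sum>N. ennreal ((1/2) ^ N))" by (intro suminf_le tot_E) auto
  also have "\<dots> = ennreal (\<Sum>N. (1/2) ^ N)" by (intro suminf_ennreal2) auto
  also have "\<dots> < \<infinity>" by simp
  finally have "(\<integral>\<^sup>+\<omega>. (\<Sum>N. ennreal (1 / 4096 ^ N) * tot N \<omega>) \<partial>M) \<noteq> \<infinity>" by simp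
  then have "AE \<omega> in M. (\<Sum>N. ennreal (1 / 4096 ^ N) * tot N \<omega>) \<noteq> \<infinity>"
    using tot_m by (intro nn_integral_PInf_AE) auto
  then show ?thesis
  proof (rule AE_mp, intro AE_I2 impI)
    fix \<omega> assume fin: "(\<Sum>N. ennreal (1 / 4096 ^ N) * tot N \<omega>) \<noteq> \<infinity>"
    define s where "s = enn2real (\<Sum>N. ennreal (1 / 4096 ^ N) * tot N \<omega>)"
    have s: "(\<Sum>N. ennreal (1 / 4096 ^ N) * tot N \<omega>) = ennreal s" using fin by (simp add: s_def less_top)
    have bound: "polymer (\<Gamma> N \<omega>) N j k \<le> ennreal (max 1 s * 4096 ^ N)" if N: "N = j + k + 1" for N j k
    proof -
      have "polymer (\<Gamma> N \<omega>) N j k = polymer (\<Gamma> N \<omega>) N j (N - 1 - j)" using N by simp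
      also have "\<dots> \<le> tot N \<omega>" unfolding tot_def using N by (intro member_le_sum) auto
      finally have "ennreal (1 / 4096 ^ N) * polymer (\<Gamma> N \<omega>) N j k \<le> ennreal (1 / 4096 ^ N) * tot N \<omega>"
        by (rule mult_left_mono) simp
      also have "\<dots> = (\<Sum>N\<in>{N}. ennreal (1 / 4096 ^ N) * tot N \<omega>)" by simp
      also have "\<dots> \<le> ennreal s" unfolding s[symmetric] by (rule sum_le_suminf) auto
      also have "\<dots> \<le> ennreal (max 1 s)" by (intro ennreal_leI) simp
      finally have le: "ennreal (4096 ^ N) * (ennreal (1 / 4096 ^ N) * polymer (\<Gamma> N \<omega>) N j k) \<le> ennreal (4096 ^ N) * ennreal (max 1 s)"
        by (rule mult_left_mono) simp
      have "ennreal (4096 ^ N) * ennreal (1 / 4096 ^ N) = ennreal (4096 ^ N * (1 / 4096 ^ N))"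
        by (rule ennreal_mult[symmetric]) auto
      then have one: "ennreal (4096 ^ N) * ennreal (1 / 4096 ^ N) = 1" by simp
      have "polymer (\<Gamma> N \<omega>) N j k = ennreal (4096 ^ N) * (ennreal (1 / 4096 ^ N) * polymer (\<Gamma> N \<omega>) N j k)"
        by (simp only: mult.assoc[symmetric] one mult_1)
      also note le
      also have "ennreal (4096 ^ N) * ennreal (max 1 s) = ennreal (4096 ^ N * max 1 s)"
        by (rule ennreal_mult[symmetric]) auto
      finally show ?thesis by (simp only: mult.commute)
    qed
    show "\<exists>D\<ge>1. \<forall>N j k. N = j + k + 1 \<longrightarrow>
      polymer (\<lambda>c j. energy (real c * (T / real N)) (T / real N) \<omega> j) N j k \<le> ennreal (D * 4096 ^ N)"
      using bound unfolding \<Gamma>_def by (intro exI[of _ "max 1 s"]) auto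
  qed
qed

lemma AE_bounded_path_variation:
  assumes g: "\<And>j. 1 \<le> j \<Longrightarrow> \<bar>g j\<bar> \<le> G"
  shows "AE \<omega> in M. bounded_path_variation (drifted g (\<lambda>j t. B j t \<omega>))"
proof -
  have G: "0 \<le> G" using g[of 1] by auto
  have "AE \<omega> in M. \<exists>C\<ge>0. \<forall>j t k i s v. 0 \<le> t \<longrightarrow> t \<le> real T \<longrightarrow>
     backward_path (drifted g (\<lambda>j t. B j t \<omega>)) j t k i s v \<longrightarrow> v \<le> C * sqrt (real (j + k + 1))" for T :: nat
  proof -
    define U where "U = real T + 1"
    have U: "0 < U" "real T \<le> U" by (auto simp: U_def)
    show ?thesis
      using AE_energy_finite[OF U(1)] AE_polymer_bound[OF U(1)] AE_continuous
    proof eventually_elim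
      case (elim \<omega>)
      then obtain D where D: "1 \<le> D" "\<And>N j k. N = j + k + 1 \<Longrightarrow>
        polymer (\<lambda>c j. energy (real c * (U / real N)) (U / real N) \<omega> j) N j k \<le> ennreal (D * 4096 ^ N)" by blast
      let ?C = "(105 * sqrt U + G * U) * (14 + ln D)"
      have "v \<le> ?C * sqrt (real (j + k + 1))"
        if that: "0 \<le> t" "t \<le> real T" "backward_path (drifted g (\<lambda>j t. B j t \<omega>)) j t k i s v" for j t k i s v
      proof (rule path_variation_bound[where g = g and B = "\<lambda>j t. B j t \<omega>" and N = "j + k + 1"
            and \<Gamma> = "\<lambda>c i. energy (real c * (U / real (j + k + 1))) (U / real (j + k + 1)) \<omega> i", OF U(1) G g])
        show "continuous_on {0..} (\<lambda>t. B i t \<omega>)" if "1 \<le> i" for i using elim(3) that by blast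
        show "energy (real c * (U / real (j + k + 1))) (U / real (j + k + 1)) \<omega> i
          = (if i = 0 then 1 else dyadic_energy (real c * (U / real (j + k + 1))) (U / real (j + k + 1)) (\<lambda>t. B i t \<omega>))" for c i
          by (simp only: energy_def)
        show "energy (real c * (U / real (j + k + 1))) (U / real (j + k + 1)) \<omega> i < \<infinity>" for c i
          using elim(1)[rule_format, of c "j + k" i] by (simp only: Suc_eq_plus1)
        show "0 < j + k + 1" "j + k + 1 = j + k + 1" by simp_all
        show "1 \<le> D" by (rule D(1))
        show "polymer (\<lambda>c i. energy (real c * (U / real (j + k + 1))) (U / real (j + k + 1)) \<omega> i) (j + k + 1) j k
          \<le> ennreal (D * 4096 ^ (j + k + 1))" by (rule D(2)) simp
        show "0 \<le> t" "t \<le> U" using that U by auto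
        show "backward_path (drifted g (\<lambda>j t. B j t \<omega>)) j t k i s v" by (rule that(3))
      qed
      moreover have "0 \<le> ?C" using U G D(1) by (intro mult_nonneg_nonneg add_nonneg_nonneg) auto
      ultimately show ?case by blast
    qed
  qed
  then show ?thesis unfolding bounded_path_variation_def AE_all_countable by blast
qed

end

section \<open>Gains of the driving motions\<close>

text \<open>The Cauchy-Schwarz inequality for the discount weights, whose total mass is at most \<open>1 / (1 - r)\<close>; it
avoids any computation of covariances between levels.\<close>

lemma disc_sum_square_le:
  assumes r: "0 \<le> r" "r < 1"
  shows "(disc_sum r f j)\<^sup>2 \<le> 1 / (1 - r) * disc_sum r (\<lambda>i. (f i)\<^sup>2) j"
proof (induction j)
  case (Suc j)
  define K where "K = 1 / (1 - r)"
  have K: "0 < K" "K = 1 + r * K" using r by (auto simp: K_def field_simps)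
  define x where "x = f (Suc j)"
  define y where "y = disc_sum r f j"
  define Y where "Y = disc_sum r (\<lambda>i. (f i)\<^sup>2) j"
  have yY: "y\<^sup>2 \<le> K * Y" using Suc by (simp add: K_def y_def Y_def)
  have "(x + r * y)\<^sup>2 * K \<le> K * x\<^sup>2 * K + r * y\<^sup>2 * K"
  proof -
    have "K * x\<^sup>2 * K + r * y\<^sup>2 * K - (x + r * y)\<^sup>2 * K = K * x\<^sup>2 * (K - 1) + r * y\<^sup>2 * (K - r * K) - 2 * x * r * y * K"
      by (simp add: power2_eq_square algebra_simps)
    also have "\<dots> = r * (K * x - y)\<^sup>2"
    proof -
      have e: "K - 1 = r * K" "K - r * K = 1" using K by linarith+
      show ?thesis unfolding e by (simp add: power2_eq_square algebra_simps)
    qed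
    also have "\<dots> \<ge> 0" using r by simp
    finally show ?thesis by simp
  qed
  then have "(x + r * y)\<^sup>2 * K \<le> (K * x\<^sup>2 + r * y\<^sup>2) * K" by (simp add: distrib_right)
  then have "(x + r * y)\<^sup>2 \<le> K * x\<^sup>2 + r * y\<^sup>2" using K by simp
  also have "\<dots> \<le> K * x\<^sup>2 + r * (K * Y)" using yY r by (intro add_left_mono mult_left_mono) auto
  also have "\<dots> = K * (x\<^sup>2 + r * Y)" by (simp add: algebra_simps)
  finally show ?case by (simp add: x_def y_def Y_def K_def)
qed simp

lemma step_avg_pow_square_le:
  assumes p: "0 \<le> p" "p \<le> 1"
  shows "((step_avg p ^^ k) f j)\<^sup>2 \<le> (step_avg p ^^ k) (\<lambda>i. (f i)\<^sup>2) j"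
proof (induction k arbitrary: j)
  case (Suc k)
  have convex: "((1 - p) * a + p * b)\<^sup>2 \<le> (1 - p) * a\<^sup>2 + p * b\<^sup>2" for a b :: real
  proof -
    have "(1 - p) * a\<^sup>2 + p * b\<^sup>2 - ((1 - p) * a + p * b)\<^sup>2 = p * (1 - p) * (a - b)\<^sup>2"
      by (simp add: power2_eq_square algebra_simps)
    also have "\<dots> \<ge> 0" using p by simp
    finally show ?thesis by simp
  qed
  have "(step_avg p g j)\<^sup>2 \<le> step_avg p (\<lambda>i. (g i)\<^sup>2) j" for g
    using convex by (simp add: step_avg_def)
  then have "((step_avg p ^^ Suc k) f j)\<^sup>2 \<le> step_avg p (\<lambda>i. ((step_avg p ^^ k) f i)\<^sup>2) j" by simp
  also have "\<dots> \<le> step_avg p ((step_avg p ^^ k) (\<lambda>i. (f i)\<^sup>2)) j"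
    using p Suc by (intro step_avg_mono) auto
  finally show ?case by simp
qed simp

text \<open>The function \<open>1 - r\<^sup>j\<close> is harmonic for the killed walk and bounded by \<open>1\<close>: it is the probability that the walk
from \<open>j\<close> never reaches \<open>0\<close>.\<close>

lemma step_avg_pow_survival:
  assumes p: "0 \<le> p" "p < 1/2" and c: "0 \<le> c"
  shows "c * (1 - (p / (1 - p)) ^ j) \<le> (step_avg p ^^ k) (\<lambda>i. if i = 0 then 0 else c) j"
proof (induction k arbitrary: j)
  case 0
  have "c * (1 - (p / (1 - p)) ^ j) \<le> c * 1" using p c by (intro mult_left_mono) auto
  then show ?case by simp
next
  case (Suc k)
  define r where "r = p / (1 - p)"
  have r: "(1 - p) * r = p" using p by (simp add: r_def)
  have "c * (1 - r ^ j) = step_avg p (\<lambda>i. c * (1 - r ^ i)) j" if j0: "j \<noteq> 0"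
  proof -
    obtain l where l: "j = Suc l" using j0 by (cases j) auto
    have r': "p * r + p = r" using r by (simp add: algebra_simps)
    have "(1 - p) * r ^ Suc j + p * r ^ l = ((1 - p) * r) * (r * r ^ l) + p * r ^ l"
      by (simp only: l power_Suc mult.assoc)
    also have "\<dots> = (p * r + p) * r ^ l" unfolding r by (simp add: algebra_simps)
    finally have e: "(1 - p) * r ^ Suc j + p * r ^ l = r ^ j" by (simp only: r' l power_Suc)
    have "step_avg p (\<lambda>i. c * (1 - r ^ i)) j = c * (1 - ((1 - p) * r ^ Suc j + p * r ^ l))"
      by (simp add: step_avg_def l algebra_simps)
    then show ?thesis by (simp only: e)
  qed
  moreover have "step_avg p (\<lambda>i. c * (1 - r ^ i)) j \<le> step_avg p ((step_avg p ^^ k) (\<lambda>i. if i = 0 then 0 else c)) j"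
    using p unfolding r_def by (intro step_avg_mono Suc) auto
  ultimately show ?case
  proof (cases "j = 0")
    case True
    then show ?thesis by (simp add: step_avg_def)
  qed (simp add: r_def)
qed

context prob_space
begin

lemma expectation_step_avg_pow:
  assumes "\<And>i. integrable M (f i)"
  shows "integrable M (\<lambda>\<omega>. (step_avg p ^^ k) (\<lambda>i. f i \<omega>) j) \<and>
    expectation (\<lambda>\<omega>. (step_avg p ^^ k) (\<lambda>i. f i \<omega>) j) = (step_avg p ^^ k) (\<lambda>i. expectation (f i)) j"
proof (induction k arbitrary: j)
  case (Suc k)
  show ?case
  proof (cases "j = 0")
    case True
    then show ?thesis by (simp add: step_avg_def)
  next
    case False
    then show ?thesis using Suc by (simp add: step_avg_def)
  qed
qed (simp add: assms)

lemma expectation_disc_sum: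
  assumes "\<And>i. 1 \<le> i \<Longrightarrow> integrable M (f i)"
  shows "integrable M (\<lambda>\<omega>. disc_sum r (\<lambda>i. f i \<omega>) j) \<and>
    expectation (\<lambda>\<omega>. disc_sum r (\<lambda>i. f i \<omega>) j) = disc_sum r (\<lambda>i. expectation (f i)) j"
  by (induction j) (use assms in auto)

lemma normal_moments:
  assumes D: "distributed M lborel X (normal_density 0 \<sigma>)" and \<sigma>: "0 < \<sigma>"
  shows "integrable M X" "expectation X = 0" "integrable M (\<lambda>\<omega>. (X \<omega>)\<^sup>2)" "expectation (\<lambda>\<omega>. (X \<omega>)\<^sup>2) = \<sigma>\<^sup>2"
    "expectation (\<lambda>\<omega>. \<bar>X \<omega>\<bar>) = \<sigma> * sqrt (2 / pi)"
proof -
  have m: "X \<in> borel_measurable M" using distributed_measurable[OF D] by simp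
  have "integrable M (\<lambda>\<omega>. (X \<omega>)\<^sup>2)"
    using integrable_normal_moment_abs[OF \<sigma>, of 0 2] by (subst distributed_integrable[OF D, symmetric]) auto
  then show 1: "integrable M (\<lambda>\<omega>. (X \<omega>)\<^sup>2)" .
  show "integrable M X" by (rule square_integrable_imp_integrable[OF m 1])
  show 2: "expectation X = 0" by (rule normal_distributed_expectation[OF \<sigma> D])
  show "expectation (\<lambda>\<omega>. (X \<omega>)\<^sup>2) = \<sigma>\<^sup>2" using normal_distributed_variance[OF \<sigma> D] 2 by simp
  have "expectation (\<lambda>\<omega>. \<bar>X \<omega>\<bar>) = (\<integral>x. normal_density 0 \<sigma> x * \<bar>x\<bar> \<partial>lborel)"
    by (rule distributed_integral[OF D, symmetric]) auto
  also have "\<dots> = \<sigma> * sqrt (2 / pi)" using integral_normal_moment_abs_odd[OF \<sigma>, of 0 0] by simp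
  finally show "expectation (\<lambda>\<omega>. \<bar>X \<omega>\<bar>) = \<sigma> * sqrt (2 / pi)" .
qed

text \<open>Each term is independent of the sum of the earlier ones, so the mixed terms vanish after centring.\<close>

lemma expectation_square_sum_le:
  fixes \<zeta> :: "nat \<Rightarrow> 'a \<Rightarrow> real"
  assumes F: "\<And>c. subalgebra M (F c)" "\<And>c. subalgebra (F (Suc c)) (F c)"
    and m: "\<And>c. c < n \<Longrightarrow> \<zeta> c \<in> borel_measurable (F (Suc c))"
    and ind: "\<And>c U. c < n \<Longrightarrow> U \<in> borel_measurable (F c) \<Longrightarrow> indep_var borel U borel (\<zeta> c)"
    and sq: "\<And>c. c < n \<Longrightarrow> integrable M (\<lambda>\<omega>. (\<zeta> c \<omega>)\<^sup>2)" "\<And>c. c < n \<Longrightarrow> expectation (\<lambda>\<omega>. (\<zeta> c \<omega>)\<^sup>2) \<le> v"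
    and k: "k \<le> n"
  shows "(\<lambda>\<omega>. \<Sum>c<k. \<zeta> c \<omega> - expectation (\<zeta> c)) \<in> borel_measurable (F k) \<and>
    integrable M (\<lambda>\<omega>. (\<Sum>c<k. \<zeta> c \<omega> - expectation (\<zeta> c))\<^sup>2) \<and>
    expectation (\<lambda>\<omega>. (\<Sum>c<k. \<zeta> c \<omega> - expectation (\<zeta> c))\<^sup>2) \<le> real k * v"
  using k
proof (induction k)
  case (Suc k)
  define S where "S = (\<lambda>\<omega>. \<Sum>c<k. \<zeta> c \<omega> - expectation (\<zeta> c))"
  have kn: "k < n" using Suc by simp
  have S: "S \<in> borel_measurable (F k)" "integrable M (\<lambda>\<omega>. (S \<omega>)\<^sup>2)" "expectation (\<lambda>\<omega>. (S \<omega>)\<^sup>2) \<le> real k * v"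
    using Suc kn by (auto simp: S_def)
  have SM: "S \<in> borel_measurable M" "S \<in> borel_measurable (F (Suc k))"
    using measurable_from_subalg[OF F(1) S(1)] measurable_from_subalg[OF F(2) S(1)] .
  have Si: "integrable M S" by (rule square_integrable_imp_integrable[OF SM(1) S(2)])
  have zM: "\<zeta> k \<in> borel_measurable M" by (rule measurable_from_subalg[OF F(1) m[OF kn]])
  have zi: "integrable M (\<zeta> k)" by (rule square_integrable_imp_integrable[OF zM sq(1)[OF kn]])
  define e where "e = expectation (\<zeta> k)"
  define x where "x = (\<lambda>\<omega>. \<zeta> k \<omega> - e)"
  have xi: "integrable M x" "expectation x = 0" using zi by (auto simp: x_def e_def prob_space)
  have x2: "(x \<omega>)\<^sup>2 = (\<zeta> k \<omega>)\<^sup>2 - 2 * e * \<zeta> k \<omega> + e\<^sup>2" for \<omega> by (simp add: x_def power2_eq_square algebra_simps)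
  have x2i: "integrable M (\<lambda>\<omega>. (x \<omega>)\<^sup>2)" unfolding x2 using zi sq(1)[OF kn] by auto
  have x2e: "expectation (\<lambda>\<omega>. (x \<omega>)\<^sup>2) \<le> v"
  proof -
    have "expectation (\<lambda>\<omega>. (x \<omega>)\<^sup>2) = expectation (\<lambda>\<omega>. (\<zeta> k \<omega>)\<^sup>2) - e\<^sup>2"
      unfolding x2 using zi sq(1)[OF kn] by (simp add: prob_space e_def[symmetric] power2_eq_square)
    then show ?thesis using sq(2)[OF kn] zero_le_power2[of e] by linarith
  qed
  have "indep_var borel S borel (\<zeta> k)" by (rule ind[OF kn S(1)])
  then have "indep_var borel ((\<lambda>s. s) \<circ> S) borel ((\<lambda>z. z - e) \<circ> \<zeta> k)" by (rule indep_var_compose) auto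
  then have iv: "indep_var borel S borel x" by (simp add: comp_def x_def)
  have cross: "integrable M (\<lambda>\<omega>. S \<omega> * x \<omega>)" "expectation (\<lambda>\<omega>. S \<omega> * x \<omega>) = 0"
    using indep_var_integrable[OF iv Si xi(1)] indep_var_lebesgue_integral[OF iv Si xi(1)] xi(2) by auto
  have eq: "(\<Sum>c<Suc k. \<zeta> c \<omega> - expectation (\<zeta> c)) = S \<omega> + x \<omega>" for \<omega> by (simp add: S_def x_def e_def)
  have sqe: "(S \<omega> + x \<omega>)\<^sup>2 = (S \<omega>)\<^sup>2 + 2 * (S \<omega> * x \<omega>) + (x \<omega>)\<^sup>2" for \<omega> by (simp add: power2_eq_square algebra_simps)
  have "expectation (\<lambda>\<omega>. (S \<omega> + x \<omega>)\<^sup>2) = expectation (\<lambda>\<omega>. (S \<omega>)\<^sup>2) + expectation (\<lambda>\<omega>. (x \<omega>)\<^sup>2)"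
    unfolding sqe using S(2) cross x2i by simp
  then have "expectation (\<lambda>\<omega>. (S \<omega> + x \<omega>)\<^sup>2) \<le> real (Suc k) * v" using S(3) x2e by (simp add: algebra_simps)
  moreover have "integrable M (\<lambda>\<omega>. (S \<omega> + x \<omega>)\<^sup>2)" unfolding sqe using S(2) cross x2i by auto
  moreover have "(\<lambda>\<omega>. S \<omega> + x \<omega>) \<in> borel_measurable (F (Suc k))"
    using SM(2) m[OF kn] by (auto simp: x_def)
  ultimately show ?case unfolding eq by blast
qed simp

end

lemma step_avg_pow_block_gain_measurable:
  assumes "\<And>i. 1 \<le> i \<Longrightarrow> D i \<in> borel_measurable N"
  shows "(\<lambda>\<omega>. (step_avg p ^^ k) (block_gain p (\<lambda>i. D i \<omega>)) j) \<in> borel_measurable N"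
proof (induction k arbitrary: j)
  case 0
  have "(\<lambda>\<omega>. disc_sum r (\<lambda>i. D i \<omega>) j) \<in> borel_measurable N" for r
    by (induction j) (use assms in auto)
  note [measurable] = this
  show ?case
  proof (cases "j = 0")
    case False
    then have [measurable]: "D j \<in> borel_measurable N" "D (Suc j) \<in> borel_measurable N" using assms by auto
    show ?thesis using False by (simp add: block_gain_def)
  qed (simp add: block_gain_def)
next
  case (Suc k)
  then show ?case by (cases "j = 0") (auto simp: step_avg_def)
qed

context driving_environment
begin

text \<open>The discounted sum has mean zero, and \<open>D\<^sub>i - D\<^sub>i\<^sub>+\<^sub>1\<close> is normal with variance \<open>2 h\<close>, so its positive part has
mean \<open>\<surd>(h / \<pi>) \<ge> \<surd>h / 2\<close>.\<close>

lemma block_gain_moments: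
  assumes p: "0 \<le> p" "p < 1/2" and t: "0 \<le> t" "t < t'"
  defines "r \<equiv> p / (1 - p)" and "\<xi> \<equiv> \<lambda>i \<omega>. block_gain p (\<lambda>i. B i t' \<omega> - B i t \<omega>) i"
  shows "integrable M (\<xi> i)" "integrable M (\<lambda>\<omega>. (\<xi> i \<omega>)\<^sup>2)"
    "1 \<le> i \<Longrightarrow> expectation (\<xi> i) \<le> - ((1 - p) * sqrt (t' - t) / 2)"
    "expectation (\<lambda>\<omega>. (\<xi> i \<omega>)\<^sup>2) \<le> (2 / (1 - r)\<^sup>2 + 8) * (t' - t)"
proof -
  define h where "h = t' - t"
  have h: "0 < h" using t by (simp add: h_def)
  have r: "0 \<le> r" "r < 1" using p by (auto simp: r_def field_simps)
  define D where "D = (\<lambda>i \<omega>. B i t' \<omega> - B i t \<omega>)"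
  have dist: "distributed M lborel (D i) (normal_density 0 (sqrt h))" if "1 \<le> i" for i
    using brownian_increments(1)[OF t that] by (simp add: D_def h_def)
  have Di: "integrable M (D i)" "expectation (D i) = 0" "integrable M (\<lambda>\<omega>. (D i \<omega>)\<^sup>2)" "expectation (\<lambda>\<omega>. (D i \<omega>)\<^sup>2) = h"
    if "1 \<le> i" for i
    using normal_moments[OF dist[OF that]] h by auto
  define G where "G = (\<lambda>j \<omega>. disc_sum r (\<lambda>i. D i \<omega>) j)"
  have G: "integrable M (G j)" "expectation (G j) = 0" for j
  proof -
    have "disc_sum r (\<lambda>i. expectation (D i)) j = disc_sum r (\<lambda>i. 0) j" using Di by (intro disc_sum_cong) auto
    moreover have "disc_sum r (\<lambda>i. 0) j = 0" by (induction j) auto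
    ultimately show "integrable M (G j)" "expectation (G j) = 0"
      using expectation_disc_sum[of D r j] Di(1) unfolding G_def by auto
  qed
  have GM[measurable]: "G j \<in> borel_measurable M" for j using G(1)[of j] by auto
  define Q where "Q = (\<lambda>j \<omega>. 1 / (1 - r) * disc_sum r (\<lambda>i. (D i \<omega>)\<^sup>2) j)"
  have Q: "integrable M (Q j)" "expectation (Q j) \<le> h / (1 - r)\<^sup>2" for j
  proof -
    have e: "integrable M (\<lambda>\<omega>. disc_sum r (\<lambda>i. (D i \<omega>)\<^sup>2) j)"
      "expectation (\<lambda>\<omega>. disc_sum r (\<lambda>i. (D i \<omega>)\<^sup>2) j) = disc_sum r (\<lambda>i. expectation (\<lambda>\<omega>. (D i \<omega>)\<^sup>2)) j"
      using expectation_disc_sum[of "\<lambda>i \<omega>. (D i \<omega>)\<^sup>2" r j] Di(3) by auto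
    show "integrable M (Q j)" unfolding Q_def using e(1) by (rule integrable_mult_right)
    have "disc_sum r (\<lambda>i. expectation (\<lambda>\<omega>. (D i \<omega>)\<^sup>2)) j = disc_sum r (\<lambda>_. h) j"
      using Di by (intro disc_sum_cong) auto
    also have "\<dots> \<le> h / (1 - r)" using r h by (intro disc_sum_const_le) auto
    finally have "1 / (1 - r) * expectation (\<lambda>\<omega>. disc_sum r (\<lambda>i. (D i \<omega>)\<^sup>2) j) \<le> 1 / (1 - r) * (h / (1 - r))"
      unfolding e(2) using r by (intro mult_left_mono) auto
    then show "expectation (Q j) \<le> h / (1 - r)\<^sup>2" by (simp add: Q_def power2_eq_square)
  qed
  have GQ: "(G j \<omega>)\<^sup>2 \<le> Q j \<omega>" for j \<omega> unfolding G_def Q_def by (rule disc_sum_square_le[OF r])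
  have G2: "integrable M (\<lambda>\<omega>. (G j \<omega>)\<^sup>2)" for j
    by (rule Bochner_Integration.integrable_bound[OF Q(1)[of j]]) (use GQ in \<open>auto intro!: AE_I2 order_trans[OF GQ]\<close>)
  define E where "E = (\<lambda>j \<omega>. D j \<omega> - D (Suc j) \<omega>)"
  have E: "distributed M lborel (E j) (normal_density 0 (sqrt (2 * h)))" if "1 \<le> j" for j
  proof -
    have "indep_var borel (D j) borel (D (Suc j))"
      using brownian_increments(2)[OF t that, of "Suc j"] unfolding D_def by simp
    from diff_indep_normal[OF this _ _ dist[OF that] dist[of "Suc j"]] show ?thesis
      using h by (simp add: E_def)
  qed
  have Em: "integrable M (E j)" "expectation (E j) = 0" "integrable M (\<lambda>\<omega>. (E j \<omega>)\<^sup>2)" "expectation (\<lambda>\<omega>. (E j \<omega>)\<^sup>2) = 2 * h"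
     "expectation (\<lambda>\<omega>. \<bar>E j \<omega>\<bar>) = sqrt (2 * h) * sqrt (2 / pi)" if "1 \<le> j" for j
    using normal_moments[OF E[OF that]] h by auto
  have max_eq: "max 0 x = (x + \<bar>x\<bar>) / 2" for x :: real by (simp add: max_def)
  have P: "integrable M (\<lambda>\<omega>. max 0 (E j \<omega>))" "sqrt h / 2 \<le> expectation (\<lambda>\<omega>. max 0 (E j \<omega>))" if j: "1 \<le> j" for j
  proof -
    show "integrable M (\<lambda>\<omega>. max 0 (E j \<omega>))" unfolding max_eq using Em(1)[OF j] by auto
    have "expectation (\<lambda>\<omega>. max 0 (E j \<omega>)) = (expectation (E j) + expectation (\<lambda>\<omega>. \<bar>E j \<omega>\<bar>)) / 2"
      unfolding max_eq using Em(1)[OF j] by simp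
    also have "\<dots> = sqrt (2 * h * (2 / pi)) / 2" using Em(2,5)[OF j] by (simp only: real_sqrt_mult[symmetric]) simp
    also have "\<dots> \<ge> sqrt h / 2"
    proof -
      have "pi \<le> 4" using pi_less_4 by simp
      then have "h * pi \<le> h * 4" using h by (intro mult_left_mono) auto
      then have "h \<le> 2 * h * (2 / pi)" by (simp add: field_simps)
      then show ?thesis by (simp only: divide_right_mono real_sqrt_le_mono zero_le_numeral)
    qed
    finally show "sqrt h / 2 \<le> expectation (\<lambda>\<omega>. max 0 (E j \<omega>))" .
  qed
  have xi: "\<xi> i \<omega> = (if i = 0 then 0 else G i \<omega> - (1 - p) * max 0 (E i \<omega>))" for i \<omega>
    by (simp add: \<xi>_def block_gain_def G_def E_def D_def r_def)
  show int: "integrable M (\<xi> i)" for i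
    unfolding xi using G(1)[of i] P(1)[of i] by (cases "i = 0") auto
  show "expectation (\<xi> i) \<le> - ((1 - p) * sqrt (t' - t) / 2)" if i: "1 \<le> i"
  proof -
    have "expectation (\<xi> i) = - ((1 - p) * expectation (\<lambda>\<omega>. max 0 (E i \<omega>)))"
      unfolding xi using i G[of i] P(1)[OF i] by simp
    moreover have "(1 - p) * (sqrt h / 2) \<le> (1 - p) * expectation (\<lambda>\<omega>. max 0 (E i \<omega>))"
      using P(2)[OF i] p by (intro mult_left_mono) auto
    ultimately show ?thesis by (simp add: h_def)
  qed
  define R where "R = (\<lambda>i \<omega>. 2 * Q i \<omega> + 2 * (E i \<omega>)\<^sup>2)"
  have R: "integrable M (R i)" "expectation (R i) \<le> (2 / (1 - r)\<^sup>2 + 8) * h" if i: "1 \<le> i" for i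
  proof -
    show "integrable M (R i)" unfolding R_def using Q(1)[of i] Em(3)[OF i] by auto
    have "expectation (R i) = 2 * expectation (Q i) + 2 * (2 * h)"
      unfolding R_def using Q(1)[of i] Em(3,4)[OF i] by simp
    also have "\<dots> \<le> 2 * (h / (1 - r)\<^sup>2) + 8 * h" using Q(2)[of i] h by simp
    finally show "expectation (R i) \<le> (2 / (1 - r)\<^sup>2 + 8) * h" by (simp add: distrib_right)
  qed
  have xiR: "(\<xi> i \<omega>)\<^sup>2 \<le> R i \<omega>" if i: "1 \<le> i" for i \<omega>
  proof -
    have two: "(a - b)\<^sup>2 \<le> 2 * a\<^sup>2 + 2 * b\<^sup>2" for a b :: real
      using zero_le_power2[of "a + b"] by (simp add: power2_eq_square algebra_simps)
    have "\<bar>(1 - p) * max 0 (E i \<omega>)\<bar> \<le> 1 * \<bar>E i \<omega>\<bar>" unfolding abs_mult using p by (intro mult_mono) auto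
    then have "((1 - p) * max 0 (E i \<omega>))\<^sup>2 \<le> (E i \<omega>)\<^sup>2" by (simp add: abs_le_square_iff)
    then show ?thesis using two[of "G i \<omega>" "(1 - p) * max 0 (E i \<omega>)"] GQ[of i \<omega>] i by (simp add: xi R_def)
  qed
  show xi2: "integrable M (\<lambda>\<omega>. (\<xi> i \<omega>)\<^sup>2)" for i
  proof (cases "i = 0")
    case True
    then show ?thesis by (simp add: xi)
  next
    case False
    then have i: "1 \<le> i" by simp
    have "\<xi> i \<in> borel_measurable M" using int[of i] by auto
    then show ?thesis
      by (intro Bochner_Integration.integrable_bound[OF R(1)[OF i]])
        (auto intro!: AE_I2 order_trans[OF xiR[OF i]])
  qed
  show "expectation (\<lambda>\<omega>. (\<xi> i \<omega>)\<^sup>2) \<le> (2 / (1 - r)\<^sup>2 + 8) * (t' - t)"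
  proof (cases "i = 0")
    case True
    then show ?thesis using h by (simp add: xi h_def[symmetric])
  next
    case False
    then have i: "1 \<le> i" by simp
    have "expectation (\<lambda>\<omega>. (\<xi> i \<omega>)\<^sup>2) \<le> expectation (R i)"
      by (rule integral_mono[OF xi2 R(1)[OF i] xiR[OF i]])
    then show ?thesis using R(2)[OF i] by (simp add: h_def)
  qed
qed

text \<open>The law of the walk is deterministic, so the mean of the averaged gain is the average of the means; the
walk survives with probability at least \<open>1 - r\<close>, and \<open>q (1 - r) = 1 - 2 p\<close>.\<close>

lemma iterated_gain_moments:
  fixes k :: nat
  assumes p: "0 \<le> p" "p < 1/2" and t: "0 \<le> t" "t < t'"
  defines "r \<equiv> p / (1 - p)" and "\<zeta> \<equiv> \<lambda>\<omega>. (step_avg p ^^ k) (block_gain p (\<lambda>i. B i t' \<omega> - B i t \<omega>)) 1"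
  shows "integrable M (\<lambda>\<omega>. (\<zeta> \<omega>)\<^sup>2)" "expectation (\<lambda>\<omega>. (\<zeta> \<omega>)\<^sup>2) \<le> (2 / (1 - r)\<^sup>2 + 8) * (t' - t)"
    "expectation \<zeta> \<le> - ((1 - 2 * p) / 2 * sqrt (t' - t))"
    "\<zeta> \<in> borel_measurable (F t')" "\<zeta> \<in> borel_measurable (future M B t)"
proof -
  define \<xi> where "\<xi> = (\<lambda>i \<omega>. block_gain p (\<lambda>i. B i t' \<omega> - B i t \<omega>) i)"
  have \<zeta>: "\<zeta> \<omega> = (step_avg p ^^ k) (\<lambda>i. \<xi> i \<omega>) 1" for \<omega> by (simp add: \<zeta>_def \<xi>_def)
  have \<xi>m: "integrable M (\<xi> i)" "integrable M (\<lambda>\<omega>. (\<xi> i \<omega>)\<^sup>2)"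
    "1 \<le> i \<Longrightarrow> expectation (\<xi> i) \<le> - ((1 - p) * sqrt (t' - t) / 2)"
    "expectation (\<lambda>\<omega>. (\<xi> i \<omega>)\<^sup>2) \<le> (2 / (1 - r)\<^sup>2 + 8) * (t' - t)" for i
    unfolding \<xi>_def r_def by (fact block_gain_moments[OF p t])+
  have r: "0 \<le> r" "r < 1" using p by (auto simp: r_def field_simps)
  show F: "\<zeta> \<in> borel_measurable (F t')" "\<zeta> \<in> borel_measurable (future M B t)"
    unfolding \<zeta>_def using brownian_increments(3,4)[OF t] by (intro step_avg_pow_block_gain_measurable; simp)+
  have M: "\<zeta> \<in> borel_measurable M" using measurable_from_subalg[OF subalgebra_F F(1)] t by simp
  let ?q = "\<lambda>\<omega>. (step_avg p ^^ k) (\<lambda>i. (\<xi> i \<omega>)\<^sup>2) 1"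
  have q: "integrable M ?q" "expectation ?q = (step_avg p ^^ k) (\<lambda>i. expectation (\<lambda>\<omega>. (\<xi> i \<omega>)\<^sup>2)) 1"
    using expectation_step_avg_pow[where f = "\<lambda>i \<omega>. (\<xi> i \<omega>)\<^sup>2" and p = p and k = k and j = 1] \<xi>m(2) by auto
  have le: "(\<zeta> \<omega>)\<^sup>2 \<le> ?q \<omega>" for \<omega> unfolding \<zeta> using p by (intro step_avg_pow_square_le) auto
  show sq: "integrable M (\<lambda>\<omega>. (\<zeta> \<omega>)\<^sup>2)"
    by (rule Bochner_Integration.integrable_bound[OF q(1)]) (use M in \<open>auto intro!: AE_I2 order_trans[OF le]\<close>)
  have "expectation (\<lambda>\<omega>. (\<zeta> \<omega>)\<^sup>2) \<le> expectation ?q" by (rule integral_mono[OF sq q(1) le])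
  also have "\<dots> \<le> (step_avg p ^^ k) (\<lambda>i. (2 / (1 - r)\<^sup>2 + 8) * (t' - t)) 1"
    unfolding q(2) using p by (intro step_avg_pow_mono \<xi>m(4)) auto
  also have "\<dots> \<le> (2 / (1 - r)\<^sup>2 + 8) * (t' - t)"
    using p t by (intro step_avg_pow_const_le mult_nonneg_nonneg add_nonneg_nonneg) auto
  finally show "expectation (\<lambda>\<omega>. (\<zeta> \<omega>)\<^sup>2) \<le> (2 / (1 - r)\<^sup>2 + 8) * (t' - t)" .
  define c where "c = (1 - p) * sqrt (t' - t) / 2"
  have c: "0 \<le> c" using p t by (simp add: c_def)
  let ?g = "\<lambda>i::nat. if i = 0 then 0 else c"
  have "expectation \<zeta> = (step_avg p ^^ k) (\<lambda>i. expectation (\<xi> i)) 1"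
    using expectation_step_avg_pow[where f = \<xi> and p = p and k = k and j = 1] \<xi>m(1) unfolding \<zeta>[abs_def] by blast
  moreover have "(step_avg p ^^ k) (\<lambda>i. expectation (\<xi> i)) 1 + (step_avg p ^^ k) ?g 1 \<le> 0"
  proof -
    have "expectation (\<xi> i) + ?g i \<le> 0" for i
    proof (cases "i = 0")
      case True
      then show ?thesis by (simp add: \<xi>_def block_gain_def)
    next
      case False
      then show ?thesis using \<xi>m(3)[of i] by (simp add: c_def)
    qed
    then have "(step_avg p ^^ k) (\<lambda>i. expectation (\<xi> i) + ?g i) 1 \<le> (step_avg p ^^ k) (\<lambda>_. 0) 1"
      using p by (intro step_avg_pow_mono) auto
    also have "\<dots> \<le> 0" using p by (intro step_avg_pow_const_le) auto
    finally show ?thesis by (simp only: step_avg_pow_add)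
  qed
  moreover have "c * (1 - r ^ 1) \<le> (step_avg p ^^ k) ?g 1"
    unfolding r_def by (rule step_avg_pow_survival[OF p c])
  moreover have "c * (1 - r ^ 1) = (1 - 2 * p) / 2 * sqrt (t' - t)"
  proof -
    have "(1 - p) * (1 - r) = 1 - 2 * p" using p by (simp add: r_def field_simps)
    then have "((1 - p) * (1 - r)) * sqrt (t' - t) / 2 = (1 - 2 * p) * sqrt (t' - t) / 2" by simp
    then show ?thesis by (simp add: c_def mult_ac)
  qed
  ultimately show "expectation \<zeta> \<le> - ((1 - 2 * p) / 2 * sqrt (t' - t))" by linarith
qed

lemma total_gain_deviation:
  fixes T U N :: nat
  assumes p: "0 \<le> p" "p < 1/2" and U: "0 < U" and N: "0 < N"
  obtains e where "e \<le> - ((1 - 2 * p) / 2 * sqrt (real N * real U))"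
    "(\<lambda>\<omega>. total_gain p N (block_increments (\<lambda>j t. B j t \<omega>) T U N) - e) \<in> borel_measurable M"
    "(\<integral>\<^sup>+\<omega>. ennreal ((total_gain p N (block_increments (\<lambda>j t. B j t \<omega>) T U N) - e)\<^sup>2) \<partial>M)
      \<le> ennreal ((2 / (1 - p / (1 - p))\<^sup>2 + 8) * real U)"
proof -
  let ?S = "\<lambda>\<omega>. total_gain p N (block_increments (\<lambda>j t. B j t \<omega>) T U N)"
  define h where "h = real U / real N"
  have h: "0 < h" "real N * h = real U" using U N by (auto simp: h_def)
  define t where "t = (\<lambda>c. real T + real c * h)"
  have t: "0 \<le> t c" "t c < t (Suc c)" "t (Suc c) - t c = h" for c
    using h by (auto simp: t_def algebra_simps)
  define \<zeta> where "\<zeta> = (\<lambda>c \<omega>. (step_avg p ^^ (N - Suc c)) (block_gain p (\<lambda>i. B i (t (Suc c)) \<omega> - B i (t c) \<omega>)) 1)"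
  define v where "v = (2 / (1 - p / (1 - p))\<^sup>2 + 8) * h"
  have mom: "integrable M (\<lambda>\<omega>. (\<zeta> c \<omega>)\<^sup>2)" "expectation (\<lambda>\<omega>. (\<zeta> c \<omega>)\<^sup>2) \<le> v"
    "expectation (\<zeta> c) \<le> - ((1 - 2 * p) / 2 * sqrt h)"
    "\<zeta> c \<in> borel_measurable (F (t (Suc c)))" "\<zeta> c \<in> borel_measurable (future M B (t c))" for c
    unfolding \<zeta>_def v_def
    by (fact iterated_gain_moments[where k = "N - Suc c", OF p t(1,2)[of c], unfolded t(3)])+
  have tot: "?S \<omega> = (\<Sum>c<N. \<zeta> c \<omega>)" for \<omega>
    unfolding total_gain_def block_increments_def[abs_def] \<zeta>_def t_def h_def ..
  define e where "e = (\<Sum>c<N. expectation (\<zeta> c))"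
  have main: "(\<lambda>\<omega>. \<Sum>c<N. \<zeta> c \<omega> - expectation (\<zeta> c)) \<in> borel_measurable (F (t N)) \<and>
    integrable M (\<lambda>\<omega>. (\<Sum>c<N. \<zeta> c \<omega> - expectation (\<zeta> c))\<^sup>2) \<and>
    expectation (\<lambda>\<omega>. (\<Sum>c<N. \<zeta> c \<omega> - expectation (\<zeta> c))\<^sup>2) \<le> real N * v"
  proof (rule expectation_square_sum_le[where n = N and F = "\<lambda>c. F (t c)"])
    show "indep_var borel V borel (\<zeta> c)" if "V \<in> borel_measurable (F (t c))" for c V
      by (rule indep_past_future[OF t(1) that mom(5)])
    show "subalgebra (F (t (Suc c))) (F (t c))" for c using t[of c] by (intro subalgebra_F_mono) auto
  qed (use mom t(1) in \<open>auto intro: subalgebra_F\<close>)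
  have S: "(\<Sum>c<N. \<zeta> c \<omega> - expectation (\<zeta> c)) = ?S \<omega> - e" for \<omega>
    by (simp add: tot e_def sum_subtractf)
  note main = main[unfolded S]
  show thesis
  proof (rule that)
    have "e \<le> (\<Sum>c<N. - ((1 - 2 * p) / 2 * sqrt h))" unfolding e_def by (intro sum_mono mom)
    also have "\<dots> = - ((1 - 2 * p) / 2 * (real N * sqrt h))" by simp
    also have "real N * sqrt h = sqrt (real N * real U)"
    proof -
      have "sqrt (real N * real U) = sqrt (real N * real N * h)" by (simp only: h(2)[symmetric] mult.assoc)
      also have "\<dots> = real N * sqrt h" by (simp add: real_sqrt_mult)
      finally show ?thesis by simp
    qed
    finally show "e \<le> - ((1 - 2 * p) / 2 * sqrt (real N * real U))" .
    show "(\<lambda>\<omega>. ?S \<omega> - e) \<in> borel_measurable M"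
      using main measurable_from_subalg[OF subalgebra_F[OF t(1)]] by blast
    have "(\<integral>\<^sup>+\<omega>. ennreal ((?S \<omega> - e)\<^sup>2) \<partial>M)
      = ennreal (expectation (\<lambda>\<omega>. (?S \<omega> - e)\<^sup>2))"
      using main by (intro nn_integral_eq_integral) auto
    also have "\<dots> \<le> ennreal (real N * v)" using main by (intro ennreal_leI) blast
    also have "real N * v = (2 / (1 - p / (1 - p))\<^sup>2 + 8) * real U"
      unfolding v_def h(2)[symmetric] by (rule mult.left_commute)
    finally show "(\<integral>\<^sup>+\<omega>. ennreal ((?S \<omega> - e)\<^sup>2) \<partial>M)
      \<le> ennreal ((2 / (1 - p / (1 - p))\<^sup>2 + 8) * real U)" .
  qed
qed

text \<open>The variance of the total gain stays bounded as \<open>N = 2\<^sup>l\<close> grows, while its mean is of order \<open>-\<surd>(N U)\<close>.  The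
squared deviations divided by \<open>2\<^sup>l\<close> are summable in mean, so they tend to zero almost surely.\<close>

lemma AE_total_gain:
  fixes T U :: nat
  assumes p: "0 \<le> p" "p < 1/2" and U: "0 < U"
  shows "AE \<omega> in M. \<exists>l0. \<forall>l\<ge>l0. total_gain p (2 ^ l) (block_increments (\<lambda>j t. B j t \<omega>) T U (2 ^ l))
    \<le> - ((1 - 2 * p) / 4) * sqrt (2 ^ l * real U)"
proof -
  define S where "S = (\<lambda>l \<omega>. total_gain p (2 ^ l) (block_increments (\<lambda>j t. B j t \<omega>) T U (2 ^ l)))"
  define K where "K = (2 / (1 - p / (1 - p))\<^sup>2 + 8) * real U"
  define a where "a = (1 - 2 * p) / 4"
  have a: "0 < a" using p by (simp add: a_def)
  have K: "0 \<le> K" unfolding K_def by (intro mult_nonneg_nonneg add_nonneg_nonneg) auto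
  have "\<exists>e. e \<le> - (2 * a * sqrt (2 ^ l * real U)) \<and> (\<lambda>\<omega>. S l \<omega> - e) \<in> borel_measurable M \<and>
    (\<integral>\<^sup>+\<omega>. ennreal ((S l \<omega> - e)\<^sup>2) \<partial>M) \<le> ennreal K" for l
  proof -
    have N: "0 < (2::nat) ^ l" by simp
    have eq: "real ((2::nat) ^ l) = 2 ^ l" "2 * ((1 - 2 * p) / 4) = (1 - 2 * p) / 2" by simp_all
    show ?thesis
      by (rule total_gain_deviation[OF p U N, of T, unfolded eq]) (unfold S_def K_def a_def eq, blast)
  qed
  then obtain e where e: "\<And>l. e l \<le> - (2 * a * sqrt (2 ^ l * real U))"
    "\<And>l. (\<lambda>\<omega>. S l \<omega> - e l) \<in> borel_measurable M"
    "\<And>l. (\<integral>\<^sup>+\<omega>. ennreal ((S l \<omega> - e l)\<^sup>2) \<partial>M) \<le> ennreal K" by metis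
  note [measurable] = e(2)
  define f where "f = (\<lambda>l \<omega>. (S l \<omega> - e l)\<^sup>2 * (1/2) ^ l)"
  have fm[measurable]: "f l \<in> borel_measurable M" for l unfolding f_def by measurable
  have "(\<integral>\<^sup>+\<omega>. (\<Sum>l. ennreal (f l \<omega>)) \<partial>M) = (\<Sum>l. \<integral>\<^sup>+\<omega>. ennreal (f l \<omega>) \<partial>M)"
    by (intro nn_integral_suminf) measurable
  also have "\<dots> \<le> (\<Sum>l. ennreal (K * (1/2) ^ l))"
  proof (rule suminf_le)
    fix l
    have "(\<integral>\<^sup>+\<omega>. ennreal (f l \<omega>) \<partial>M) = (\<integral>\<^sup>+\<omega>. ennreal ((S l \<omega> - e l)\<^sup>2) \<partial>M) * ennreal ((1/2) ^ l)"
      unfolding f_def by (subst nn_integral_multc[symmetric]) (auto simp: ennreal_mult)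
    also have "\<dots> \<le> ennreal K * ennreal ((1/2) ^ l)" by (intro mult_right_mono e) auto
    also have "\<dots> = ennreal (K * (1/2) ^ l)" by (rule ennreal_mult[symmetric]) (use K in auto)
    finally show "(\<integral>\<^sup>+\<omega>. ennreal (f l \<omega>) \<partial>M) \<le> ennreal (K * (1/2) ^ l)" .
  qed auto
  also have "\<dots> = ennreal (\<Sum>l. K * (1/2) ^ l)"
    by (intro suminf_ennreal2 summable_mult summable_geometric) (use K in auto)
  also have "\<dots> < \<infinity>" by simp
  finally have "(\<integral>\<^sup>+\<omega>. (\<Sum>l. ennreal (f l \<omega>)) \<partial>M) \<noteq> \<infinity>" by simp
  then have "AE \<omega> in M. (\<Sum>l. ennreal (f l \<omega>)) \<noteq> \<infinity>" by (intro nn_integral_PInf_AE) measurable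
  then show ?thesis
  proof (rule AE_mp, intro AE_I2 impI)
    fix \<omega> assume fin: "(\<Sum>l. ennreal (f l \<omega>)) \<noteq> \<infinity>"
    have "summable (\<lambda>l. f l \<omega>)" using fin by (intro summable_suminf_not_top) (auto simp: f_def)
    then have "(\<lambda>l. f l \<omega>) \<longlonglongrightarrow> 0" by (rule summable_LIMSEQ_zero)
    moreover have "0 < a\<^sup>2 * real U" using a U by simp
    ultimately have "\<forall>\<^sub>F l in sequentially. f l \<omega> < a\<^sup>2 * real U" by (rule order_tendstoD(2))
    then obtain l0 where l0: "\<And>l. l0 \<le> l \<Longrightarrow> f l \<omega> < a\<^sup>2 * real U"
      unfolding eventually_sequentially by blast
    have "S l \<omega> \<le> - a * sqrt (2 ^ l * real U)" if "l0 \<le> l" for l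
    proof -
      have "(S l \<omega> - e l)\<^sup>2 / 2 ^ l < a\<^sup>2 * real U" using l0[OF that] by (simp add: f_def power_one_over)
      then have "(S l \<omega> - e l)\<^sup>2 < a\<^sup>2 * real U * 2 ^ l" by (simp add: divide_less_eq)
      also have "\<dots> = (a * sqrt (2 ^ l * real U))\<^sup>2" by (simp add: power_mult_distrib)
      finally have "S l \<omega> - e l < a * sqrt (2 ^ l * real U)"
        by (rule power2_less_imp_less) (use a in simp)
      then show ?thesis using e(1)[of l] by linarith
    qed
    then show "\<exists>l0. \<forall>l\<ge>l0. total_gain p (2 ^ l) (block_increments (\<lambda>j t. B j t \<omega>) T U (2 ^ l))
      \<le> - ((1 - 2 * p) / 4) * sqrt (2 ^ l * real U)"
      unfolding S_def a_def by blast
  qed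
qed

end

section \<open>Pathwise uniqueness\<close>

text \<open>The pathwise statement: on an event of full measure, given by the two estimates for the driving motions,
no further randomness is used.\<close>

lemma competing_brownian_paths_unique:
  assumes p: "0 \<le> p" "p < 1/2" and g: "\<And>j. 1 \<le> j \<Longrightarrow> \<bar>g j\<bar> \<le> G"
    and B0: "\<And>j. 1 \<le> j \<Longrightarrow> B j 0 = 0"
    and var: "bounded_path_variation (drifted g B)"
    and gain: "large_gain p ((1 - 2 * p) / 4) B"
    and X: "competing_brownian_path p g x B X L" and X': "competing_brownian_path p g x' B X' L'"
    and start: "\<And>j. 1 \<le> j \<Longrightarrow> X j 0 = X' j 0" and j: "1 \<le> j" and t: "0 \<le> t"
  shows "X j t = X' j t"
proof -
  define r where "r = p / (1 - p)"
  have r: "0 \<le> r" "r < 1" using p by (auto simp: r_def field_simps)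
  define W where "W = (\<lambda>j t. disc_sum r (\<lambda>i. g i * t + B i t) j)"
  have init: "Y j 0 = y j" if "competing_brownian_path p g y B Y K" "1 \<le> j" for y Y K j
  proof -
    have "Y j 0 = y j + g j * 0 + B j 0 + p * K (j - 1) 0 - (1 - p) * K j 0" "K j 0 = 0" "K 0 0 = 0"
      using that unfolding competing_brownian_path_def Let_def by auto
    moreover have "K (j - 1) 0 = 0"
      using that \<open>K 0 0 = 0\<close> unfolding competing_brownian_path_def Let_def by (cases "j = 1") auto
    ultimately show ?thesis using B0[OF that(2)] by simp
  qed
  have ord: "mono_on {1..} (\<lambda>j. Y j t)" if "competing_brownian_path p g y B Y K" "0 \<le> t" for y Y K t
    using that unfolding competing_brownian_path_def Let_def by blast
  have xx: "x j = x' j" if "1 \<le> j" for j using init[OF X that] init[OF X' that] start[OF that] by simp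
  have x: "mono_on {1..} x" using ord[OF X, of 0] init[OF X] by (auto simp: mono_on_def)
  have n: "disc_sum r x' = disc_sum r x"
  proof
    fix j show "disc_sum r x' j = disc_sum r x j" by (rule disc_sum_cong) (simp add: xx)
  qed
  have Z: "obstacle_solution p (disc_sum r x) W (\<lambda>j t. disc_sum r (\<lambda>i. X i t) j)"
    unfolding W_def by (rule competing_brownian_path_obstacle[OF p r_def X])
  have Z': "obstacle_solution p (disc_sum r x) W (\<lambda>j t. disc_sum r (\<lambda>i. X' i t) j)"
    unfolding W_def n[symmetric] by (rule competing_brownian_path_obstacle[OF p r_def X'])
  have "W = (\<lambda>j t. disc_sum r (\<lambda>i. if i = 0 then 0 else g i * t + B i t) j)"
    unfolding W_def by (intro ext disc_sum_cong) auto
  then have Wvar: "bounded_path_variation W"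
    using bounded_path_variation_disc_sum[OF r _ var] by simp
  have W0: "W j 0 = 0" for j
  proof -
    have "W j 0 = disc_sum r (\<lambda>_. 0) j" unfolding W_def by (intro disc_sum_cong) (simp add: B0)
    also have "\<dots> = 0" by (induction j) auto
    finally show ?thesis .
  qed
  have a: "0 < (1 - 2 * p) / 4" using p by simp
  have gr: "superdiffusive_growth (\<lambda>j t. disc_sum r (\<lambda>i. X i t) j)"
    unfolding r_def
    by (rule superdiffusive_growth_of_gain[OF p Z[unfolded W_def r_def] ord[OF X] g a gain])
  have gr': "superdiffusive_growth (\<lambda>j t. disc_sum r (\<lambda>i. X' i t) j)"
    unfolding r_def
    by (rule superdiffusive_growth_of_gain[OF p Z'[unfolded W_def r_def] ord[OF X'] g a gain])
  have eq: "disc_sum r (\<lambda>i. X i t) m = disc_sum r (\<lambda>i. X' i t) m" for m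
  proof (rule antisym)
    show "disc_sum r (\<lambda>i. X i t) m \<le> disc_sum r (\<lambda>i. X' i t) m"
      by (rule obstacle_solution_le[OF p r_def x refl Z' Z Wvar W0 gr' t])
    show "disc_sum r (\<lambda>i. X' i t) m \<le> disc_sum r (\<lambda>i. X i t) m"
      by (rule obstacle_solution_le[OF p r_def x refl Z Z' Wvar W0 gr t])
  qed
  obtain l where "j = Suc l" using j by (cases j) auto
  then show ?thesis using eq[of "Suc l"] eq[of l] by simp
qed

theorem theorem2p5:
  fixes M :: "'a measure" and F :: "real \<Rightarrow> 'a measure"
    and B X X' :: "nat \<Rightarrow> real \<Rightarrow> 'a \<Rightarrow> real" and x x' :: "nat \<Rightarrow> 'a \<Rightarrow> real"
    and p :: real and g :: "nat \<Rightarrow> real" and \<gamma> :: "(nat \<Rightarrow> real) measure"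
  assumes p: "0 \<le> p" "p < 1/2"
    and g: "bdd_above ((\<lambda>j. \<bar>g j\<bar>) ` {1..})"
    and \<gamma>: "prob_space \<gamma>" "sets \<gamma> = sets (\<Pi>\<^sub>M j\<in>{1..}. borel)" "AE s in \<gamma>. mono_on {1..} s"
    and MF: "filtered_prob_space M F"
    and B: "driving_brownian_motions M F B"
    and x: "initial_conditions M F x" "initial_distribution M x = \<gamma>"
    and x': "initial_conditions M F x'" "initial_distribution M x' = \<gamma>"
    and X: "competing_brownian_particles M F p g x B X"
    and X': "competing_brownian_particles M F p g x' B X'"
    and start: "AE \<omega> in M. \<forall>j\<ge>1. X j 0 \<omega> = X' j 0 \<omega>"
  shows "AE \<omega> in M. \<forall>j\<ge>1. \<forall>t\<ge>0. X j t \<omega> = X' j t \<omega>"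
proof -
  interpret driving_environment M F B by unfold_locales fact+
  obtain G where G: "\<And>j. 1 \<le> j \<Longrightarrow> \<bar>g j\<bar> \<le> G" using g by (auto simp: bdd_above_def)
  obtain L where L: "AE \<omega> in M. competing_brownian_path p g (\<lambda>j. x j \<omega>) (\<lambda>j t. B j t \<omega>) (\<lambda>j t. X j t \<omega>) (\<lambda>j t. L j t \<omega>)"
    using X unfolding competing_brownian_particles_def by blast
  obtain L' where L': "AE \<omega> in M. competing_brownian_path p g (\<lambda>j. x' j \<omega>) (\<lambda>j t. B j t \<omega>) (\<lambda>j t. X' j t \<omega>) (\<lambda>j t. L' j t \<omega>)"
    using X' unfolding competing_brownian_particles_def by blast
  have gain: "AE \<omega> in M. large_gain p ((1 - 2 * p) / 4) (\<lambda>j t. B j t \<omega>)"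
    unfolding large_gain_def AE_all_countable using AE_total_gain[OF p] by (auto intro: AE_impI)
  have variation: "AE \<omega> in M. bounded_path_variation (drifted g (\<lambda>j t. B j t \<omega>))"
    by (rule AE_bounded_path_variation) (rule G)
  from L L' start gain variation AE_zero_start show ?thesis
  proof eventually_elim
    case (elim \<omega>)
    show ?case
    proof (intro allI impI)
      fix j :: nat and t :: real assume jt: "1 \<le> j" "0 \<le> t"
      show "X j t \<omega> = X' j t \<omega>"
      proof (rule competing_brownian_paths_unique[OF p _ _ elim(5,4,1,2) _ jt])
        show "\<bar>g i\<bar> \<le> G" if "1 \<le> i" for i by (rule G[OF that])
        show "B i 0 \<omega> = 0" if "1 \<le> i" for i using elim(6) that by blast
        show "X i 0 \<omega> = X' i 0 \<omega>" if "1 \<le> i" for i using elim(3) that by blast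
      qed
    qed
  qed
qed

end
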